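(* Consider the two-node tandem stochastic fluid network described in the context, and let $b=(0,1)$ and $y>0$. Then the following logarithmic asymptotics hold for the scaled buffer content of the second node at time $T$. (1) If $r_2\ge r_1+\gamma_2$, then $$\lim_{n\to\infty}\frac{1}{L(n)n^{\alpha}}\log\mathbf{P}\big(b^{\top}Z_n(T)\ge y\big)=-c_2y^{\alpha}.$$ (2) If $r_2<r_1+\gamma_2$ and $y\le(r_1+\gamma_2-r_2)T$, then $$\lim_{n\to\infty}\frac{1}{L(n)n^{\alpha}}\log\mathbf{P}\big(b^{\top}Z_n(T)\ge y\big)=-\min\Big\{c_1\Big(\frac{r_1-\gamma_1}{r_1+\gamma_2-r_2}\Big)^{\alpha},\,c_2\Big\}\,y^{\alpha}.$$ (3) If $r_2<r_1+\gamma_2$ and $y>(r_1+\gamma_2-r_2)T$, then $$\lim_{n\to\infty}\frac{1}{L(n)n^{\alpha}}\log\mathbf{P}\big(b^{\top}Z_n(T)\ge y\big)=-\min\Big\{c_2y^{\alpha},\ c_1\big((r_1-\gamma_1)T\big)^{\alpha}+c_2\big(y-(r_1+\gamma_2-r_2)T\big)^{\alpha}\Big\}.$$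
   Context: Fix $T>0$. $\mathbb{D}[0,T]$ is the space of real-valued càdlàg functions on $[0,T]$, and $\mathbb{D}^{\uparrow}[0,T]$ is the set of non-decreasing $\xi\in\mathbb{D}[0,T]$ with $\xi(0)\ge0$. Two-node tandem network: $d=2$, all fluid processed at node 1 is routed to node 2 and all fluid processed at node 2 leaves the system: $q_{12}=1$ and $q_{ij}=0$ otherwise. Thus $Q=\begin{pmatrix}0&1\\0&0\end{pmatrix}$ and $\mathcal{Q}=\mathrm{I}-Q^{\top}=\begin{pmatrix}1&0\\-1&1\end{pmatrix}$. Reflection map: for $\xi\in\mathbb{D}[0,T]^2$ let $\Psi(\xi)=\{\zeta\in\mathbb{D}^{\uparrow}[0,T]^2:\xi+\mathcal{Q}\zeta\ge0\}$ (componentwise, pointwise), $\psi_i(\xi)(t)=\inf\{\omega_i(t):\omega\in\Psi(\xi)\}$ (it is known that $\psi(\xi)\in\Psi(\xi)$), and $\phi(\xi)=\xi+\mathcal{Q}\psi(\xi)$. Model: both nodes have exogenous input. For $i=1,2$, $J_i(t)=\sum_{j=1}^{N_i(t)}J_i^{(j)}$ is a compound Poisson process with $N_i$ a unit-rate Poisson process and $(J_i^{(j)})_{j\ge1}$ i.i.d. nonnegative with mean $\gamma_i$, and $\mathbf{P}(J_i^{(1)}\ge x)=e^{-c_iL(x)x^{\alpha}}$, where $\alpha\in(0,1)$, $c_i\in(0,\infty)$, and $L$ is slowly varying with $L(x)/x^{1-\alpha}$ non-increasing for sufficiently large $x$. $J_1$ and $J_2$ are independent. $r=(r_1,r_2)^{\top}$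 is the vector of deterministic output rates, and stability $r>\mathcal{Q}^{-1}\gamma$ is assumed, i.e. $r_1>\gamma_1$ and $r_2>\gamma_1+\gamma_2$. The network starts empty: the potential content process is $X(t)=J(t)-\mathcal{Q}r\,t$, the buffer content process is $Z=\phi(X)$, and the scaled processes on $[0,T]$ are $X_n(t)=\frac1nX(nt)$ and $Z_n(t)=\frac1nZ(nt)$, so $Z_n=\phi(X_n)$. *)

theory Defs
  imports "HOL-Probability.Probability"
begin

subsection \<open>The spaces $D[0,T]$ and $D^{\uparrow}[0,T]$\<close>

text \<open>Paths are total functions on the reals; only their values on \<open>{0..T}\<close> are constrained.\<close>

definition cadlag_space :: "real \<Rightarrow> (real \<Rightarrow> real) set" where
  "cadlag_space T = {\<xi>.
     (\<forall>t\<in>{0..<T}. (\<xi> \<longlongrightarrow> \<xi> t) (at_right t)) \<and>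
     (\<forall>t\<in>{0<..T}. \<exists>l. (\<xi> \<longlongrightarrow> l) (at_left t))}"

definition cadlag_up_space :: "real \<Rightarrow> (real \<Rightarrow> real) set" where
  "cadlag_up_space T = {\<xi> \<in> cadlag_space T. mono_on {0..T} \<xi> \<and> 0 \<le> \<xi> 0}"

subsection \<open>The reflection map\<close>

definition reflection_matrix :: "real^'d^'d \<Rightarrow> real^'d^'d" where
  "reflection_matrix Q = mat 1 - transpose Q"

definition feasible_regulators ::
    "real \<Rightarrow> real^'d^'d \<Rightarrow> (real \<Rightarrow> real^'d) \<Rightarrow> (real \<Rightarrow> real^'d) set" where
  "feasible_regulators T Q \<xi> = {\<zeta>.
     (\<forall>i. (\<lambda>t. \<zeta> t $ i) \<in> cadlag_up_space T) \<and>
     (\<forall>t\<in>{0..T}. \<forall>i. 0 \<le> (\<xi> t + reflection_matrix Q *v \<zeta> t) $ i)}"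

definition regulator :: "real \<Rightarrow> real^'d^'d \<Rightarrow> (real \<Rightarrow> real^'d) \<Rightarrow> real \<Rightarrow> real^'d" where
  "regulator T Q \<xi> t = (\<chi> i. Inf {\<omega> t $ i | \<omega>. \<omega> \<in> feasible_regulators T Q \<xi>})"

definition reflected :: "real \<Rightarrow> real^'d^'d \<Rightarrow> (real \<Rightarrow> real^'d) \<Rightarrow> real \<Rightarrow> real^'d" where
  "reflected T Q \<xi> t = \<xi> t + reflection_matrix Q *v regulator T Q \<xi> t"

subsection \<open>Slow variation\<close>

definition slowly_varying :: "(real \<Rightarrow> real) \<Rightarrow> bool" where
  "slowly_varying L \<longleftrightarrow>
     L \<in> borel_measurable (restrict_space borel {0<..}) \<and>
     (\<forall>\<^sub>F x in at_top. 0 < L x) \<and>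
     (\<forall>a>0. ((\<lambda>x. L (a * x) / L x) \<longlongrightarrow> 1) at_top)"

subsection \<open>Compound Poisson processes\<close>

text \<open>Independence of the sigma-algebras generated by two families of random elements.
  The library's \<^const>\<open>prob_space.indep_var\<close> requires both random elements to have the same type.\<close>

definition (in prob_space) indep_families ::
    "'i set \<Rightarrow> 's measure \<Rightarrow> ('i \<Rightarrow> 'a \<Rightarrow> 's) \<Rightarrow> 'k set \<Rightarrow> 't measure \<Rightarrow> ('k \<Rightarrow> 'a \<Rightarrow> 't) \<Rightarrow> bool" where
  "indep_families I S X K S' Y \<longleftrightarrow>
     indep_set
       (sets (vimage_algebra (space M) (\<lambda>\<omega>. \<lambda>i\<in>I. X i \<omega>) (Pi\<^sub>M I (\<lambda>_. S))))
       (sets (vimage_algebra (space M) (\<lambda>\<omega>. \<lambda>k\<in>K. Y k \<omega>) (Pi\<^sub>M K (\<lambda>_. S'))))"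

text \<open>A Poisson process is a counting process indexed by \<open>{0..}\<close>. The truncated subtraction of
  increments is exact because paths are nondecreasing; left limits exist for the same reason.\<close>

definition (in prob_space) poisson_process :: "real \<Rightarrow> (real \<Rightarrow> 'a \<Rightarrow> nat) \<Rightarrow> bool" where
  "poisson_process rate N \<longleftrightarrow>
     (\<forall>t\<ge>0. random_variable (count_space UNIV) (N t)) \<and>
     (\<forall>\<omega>\<in>space M. N 0 \<omega> = 0 \<and> mono_on {0..} (\<lambda>t. N t \<omega>) \<and>
        (\<forall>t\<ge>0. ((\<lambda>s. N s \<omega>) \<longlongrightarrow> N t \<omega>) (at_right t))) \<and>
     (\<forall>(\<tau> :: nat \<Rightarrow> real) k. 0 \<le> \<tau> 0 \<longrightarrow> mono \<tau> \<longrightarrow>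
        indep_vars (\<lambda>_. count_space UNIV) (\<lambda>i \<omega>. N (\<tau> (Suc i)) \<omega> - N (\<tau> i) \<omega>) {..<k}) \<and>
     (\<forall>s t. 0 \<le> s \<longrightarrow> s < t \<longrightarrow>
        distr M (count_space UNIV) (\<lambda>\<omega>. N t \<omega> - N s \<omega>)
          = measure_pmf (poisson_pmf (rate * (t - s))))"

text \<open>Jump sizes are indexed by the integers \<open>j \<ge> 1\<close>; \<open>Y 0\<close> is never used.\<close>

definition (in prob_space) compound_poisson_input ::
    "(real \<Rightarrow> 'a \<Rightarrow> nat) \<Rightarrow> (nat \<Rightarrow> 'a \<Rightarrow> real) \<Rightarrow> bool" where
  "compound_poisson_input N Y \<longleftrightarrow>
     poisson_process 1 N \<and>
     indep_vars (\<lambda>_. borel) Y {1..} \<and>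
     (\<forall>j\<ge>1. distr M borel (Y j) = distr M borel (Y 1)) \<and>
     (\<forall>j\<ge>1. AE \<omega> in M. 0 \<le> Y j \<omega>) \<and>
     indep_families {0..} (count_space UNIV) N {1..} borel Y"

definition compound_poisson ::
    "(real \<Rightarrow> 'a \<Rightarrow> nat) \<Rightarrow> (nat \<Rightarrow> 'a \<Rightarrow> real) \<Rightarrow> real \<Rightarrow> 'a \<Rightarrow> real" where
  "compound_poisson N Y t \<omega> = (\<Sum>j = 1..N t \<omega>. Y j \<omega>)"

subsection \<open>The stochastic fluid network\<close>

definition content_potential ::
    "real^'d^'d \<Rightarrow> real^'d \<Rightarrow> ('d \<Rightarrow> real \<Rightarrow> 'a \<Rightarrow> real) \<Rightarrow> real \<Rightarrow> 'a \<Rightarrow> real^'d" where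
  "content_potential Q r J t \<omega> = (\<chi> i. J i t \<omega>) - t *\<^sub>R (reflection_matrix Q *v r)"

definition scaled_potential ::
    "real^'d^'d \<Rightarrow> real^'d \<Rightarrow> ('d \<Rightarrow> real \<Rightarrow> 'a \<Rightarrow> real) \<Rightarrow> nat \<Rightarrow> real \<Rightarrow> 'a \<Rightarrow> real^'d" where
  "scaled_potential Q r J n t \<omega> = (1 / real n) *\<^sub>R content_potential Q r J (real n * t) \<omega>"

text \<open>The scaled content \<open>Z\<^sub>n(t) = Z(n t) / n\<close> for \<open>t \<in> {0..T}\<close>, through the identity
  \<open>Z\<^sub>n = \<phi>(X\<^sub>n)\<close> for the reflection map on \<open>{0..T}\<close>.\<close>

definition scaled_content ::
    "real \<Rightarrow> real^'d^'d \<Rightarrow> real^'d \<Rightarrow> ('d \<Rightarrow> real \<Rightarrow> 'a \<Rightarrow> real) \<Rightarrow> nat \<Rightarrow> real \<Rightarrow> 'a \<Rightarrow> real^'d" where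
  "scaled_content T Q r J n t \<omega> = reflected T Q (\<lambda>s. scaled_potential Q r J n s \<omega>) t"

definition tandem_routing :: "real^2^2" where
  "tandem_routing = vector [vector [0, 1], vector [0, 0]]"

lemma reflection_matrix_tandem:
  "reflection_matrix tandem_routing = vector [vector [1, 0], vector [-1, 1]]"
  by (simp add: reflection_matrix_def tandem_routing_def vec_eq_iff forall_2 mat_def transpose_def)

lemma tandem_stability_iff:
  "(\<forall>i. (matrix_inv (reflection_matrix tandem_routing) *v \<gamma>) $ i < r $ i) \<longleftrightarrow>
     \<gamma> $ 1 < r $ 1 \<and> \<gamma> $ 1 + \<gamma> $ 2 < r $ 2"
proof -
  let ?B = "vector [vector [1, 0], vector [1, 1]] :: real^2^2"
  let ?A = "reflection_matrix tandem_routing"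
  have AB: "?A ** ?B = mat 1"
    by (simp add: reflection_matrix_tandem vec_eq_iff forall_2 mat_def matrix_matrix_mult_def sum_2)
  then have BA: "?B ** ?A = mat 1"
    by (rule matrix_left_right_inverse[THEN iffD1])
  have "matrix_inv ?A ** ?A = mat 1"
    unfolding matrix_inv_def
    by (rule someI2[where a = ?B]) (use AB BA in auto)
  then have "(matrix_inv ?A ** ?A) ** ?B = ?B"
    by simp
  then have "matrix_inv ?A = ?B"
    by (simp only: matrix_mul_assoc[symmetric] AB matrix_mul_rid)
  then show ?thesis
    by (simp add: forall_2 matrix_vector_mult_def sum_2)
qed

end

theory Submission
  imports Defs "HOL-Real_Asymp.Real_Asymp"
begin

text \<open>Write \<open>v x = L x * x powr \<alpha>\<close>, so that a jump at node \<open>i\<close> exceeds \<open>x\<close> with probability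
\<open>exp (- c\<^sub>i * v x)\<close>, and let \<open>\<kappa> = r\<^sub>1 + \<gamma>\<^sub>2 - r\<^sub>2\<close> be the rate at which node 2 fills up while node 1
works at full capacity and everything else behaves as on average. A content \<open>n * y\<close> of
node 2 at time \<open>n * T\<close> is caused by at most one big jump at each node. A jump of size \<open>n * z\<close> at node 2
shortly before \<open>n * T\<close> contributes \<open>n * z\<close>. If \<open>\<kappa> \<le> 0\<close>, nothing else is possible. If \<open>\<kappa> > 0\<close>, a jump at node 1 can only be felt through the output of that node, which is bounded by \<open>r\<^sub>1\<close>: to keep
node 1 busy for the last \<open>n * x / \<kappa>\<close> time units, and so contribute \<open>n * x\<close>, a jump of size
\<open>n * \<rho> * x\<close> with \<open>\<rho> = (r\<^sub>1 - \<gamma>\<^sub>1) / \<kappa>\<close> is needed, and \<open>x \<le> \<kappa> * T\<close> because node 1 cannot have been busy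
for longer than the whole horizon \<open>n * T\<close>. On the scale \<open>v n\<close> the cost of the combination is
\<open>c\<^sub>1 * (\<rho> * x) powr \<alpha> + c\<^sub>2 * (y - x) powr \<alpha>\<close>. This is concave in \<open>x\<close>, hence minimal at one of the two
extreme values \<open>x = 0\<close> and \<open>x = min y (\<kappa> * T)\<close>, and the three cases of the theorem are the resulting minima.\<close>

text \<open>The reflection map is made explicit in \<open>reflected_tandem\<close>: both regulators are running suprema. From
this formula, \<open>tandem_content_le\<close> and \<open>tandem_content_ge\<close> extract path by path the bounds behind the
heuristic. The upper bound says that if the input of node \<open>i\<close> over every final interval exceeds its mean by
at most \<open>x\<^sub>i\<close>, then the content is at most \<open>x\<^sub>2 + min (\<kappa> * T) (x\<^sub>1 / \<rho>)\<close>.\<close>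

text \<open>The probabilistic core concerns a single node. For the upper estimate (\<open>node_upper_bound\<close>) the
jumps above \<open>h = n * x\<close> are treated by a union bound, and the jumps below \<open>h\<close> by a Chernoff bound with
parameter just under \<open>c * v h / h\<close>; the latter works since \<open>v x / x\<close> is nonincreasing, which makes the
truncated exponential moment as small as \<open>1 + \<theta> * (\<gamma> + \<eta>)\<close> (\<open>truncated_mgf\<close>). The lower estimate
(\<open>node_lower_bound\<close>) prescribes one big jump in a unit interval and controls the subsequent input from
below by a second Chernoff bound. Since Poisson process and jumps are independent, both reduce to
statements on i.i.d. jumps, mixed over the number of jumps (\<open>increment_mixture\<close>). Finally the two
nodes are independent, so their estimates multiply: the upper bound for the network discretizes the
contribution of node 1 and the lower bound lets both nodes realize their optimal scenario.\<close>

section \<open>The reflection map of the tandem network\<close>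

definition run_sup :: "(real \<Rightarrow> real) \<Rightarrow> real \<Rightarrow> real" where
  "run_sup f t = (SUP s\<in>{0..t}. f s)"

lemma bdd_above_run_sup:
  fixes f :: "real \<Rightarrow> real"
  assumes "\<forall>s\<in>{0..T}. f s \<le> (B::real)" "t \<le> T"
  shows "bdd_above (f ` {0..t})"
proof (rule bdd_aboveI2[where M=B])
  fix s assume "s \<in> {0..t}"
  then have "s \<in> {0..T}" using assms(2) by auto
  then show "f s \<le> B" using assms(1) by blast
qed

lemma run_sup_upper:
  assumes "\<forall>s\<in>{0..T}. f s \<le> (B::real)" "t \<le> T" "0 \<le> s" "s \<le> t"
  shows "f s \<le> run_sup f t"
  unfolding run_sup_def using assms
  by (intro cSUP_upper bdd_above_run_sup[where T=T and B=B]) auto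

lemma run_sup_least:
  assumes "0 \<le> t" "\<And>s. 0 \<le> s \<Longrightarrow> s \<le> t \<Longrightarrow> f s \<le> C"
  shows "run_sup f t \<le> C"
  unfolding run_sup_def using assms by (intro cSUP_least) auto

lemma run_sup_mono:
  assumes "\<forall>s\<in>{0..T}. f s \<le> (B::real)"
  shows "mono_on {0..T} (run_sup f)"
proof (intro mono_onI)
  fix s t assume "s \<in> {0..T}" "t \<in> {0..T}" "s \<le> t"
  then show "run_sup f s \<le> run_sup f t"
    by (intro run_sup_least run_sup_upper[OF assms]) auto
qed

text \<open>A running supremum can only increase just after \<open>t\<close> through values of \<open>f\<close> just after \<open>t\<close>, and
these are close to \<open>f t\<close>.\<close>

lemma run_sup_right_continuous:
  assumes bnd: "\<forall>s\<in>{0..T}. f s \<le> (B::real)"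
    and t: "t \<in> {0..<T}" and rc: "(f \<longlongrightarrow> f t) (at_right t)"
  shows "(run_sup f \<longlongrightarrow> run_sup f t) (at_right t)"
proof (rule tendstoI)
  fix e :: real assume e: "0 < e"
  have "\<forall>\<^sub>F s in at_right t. dist (f s) (f t) < e / 2"
    using tendstoD[OF rc, of "e/2"] e by simp
  then obtain d where d: "d > t" "\<And>s. t < s \<Longrightarrow> s < d \<Longrightarrow> dist (f s) (f t) < e / 2"
    by (auto simp: eventually_at_right_field)
  have "dist (run_sup f u) (run_sup f t) < e" if u: "t < u" "u < min d T" for u
  proof -
    have "run_sup f t \<le> run_sup f u"
      using run_sup_mono[OF bnd] t u by (auto simp: mono_on_def)
    moreover have "run_sup f u \<le> run_sup f t + e / 2"
    proof (rule run_sup_least)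
      fix s assume s: "0 \<le> s" "s \<le> u"
      have ft: "f t \<le> run_sup f t" using run_sup_upper[OF bnd, where t=t and s=t] t by auto
      show "f s \<le> run_sup f t + e / 2"
      proof (cases "s \<le> t")
        case True
        then show ?thesis using run_sup_upper[OF bnd, where t=t and s=s] t s e by auto
      next
        case False
        then have "dist (f s) (f t) < e / 2" using d s u by auto
        then have "f s < f t + e / 2" unfolding dist_real_def by linarith
        then show ?thesis using ft by linarith
      qed
    qed (use t u in auto)
    ultimately show ?thesis using e by (auto simp: dist_real_def)
  qed
  moreover have "t < min d T" using d t by auto
  ultimately show "\<forall>\<^sub>F u in at_right t. dist (run_sup f u) (run_sup f t) < e"
    unfolding eventually_at_right_field by blast
qed

lemma mono_on_left_limit:
  fixes g :: "real \<Rightarrow> real"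
  assumes "mono_on {0..T} g" "t \<in> {0<..T}"
  shows "\<exists>l. (g \<longlongrightarrow> l) (at_left t)"
proof -
  have "(g \<longlongrightarrow> Sup (g ` ({..<t} \<inter> {0..T}))) (at t within ({..<t} \<inter> {0..T}))"
    by (rule Lim_left_bound[where K = "g t"]) (use assms in \<open>auto simp: mono_on_def\<close>)
  moreover have "at t within ({..<t} \<inter> {0..T}) = at_left t"
    by (rule at_within_nhd[where S = "{0<..<t+1}"]) (use assms in auto)
  ultimately show ?thesis by auto
qed

lemma run_sup_cadlag_up:
  assumes bnd: "\<forall>s\<in>{0..T}. f s \<le> (B::real)" and T: "0 \<le> T"
    and rc: "\<And>t. t \<in> {0..<T} \<Longrightarrow> (f \<longlongrightarrow> f t) (at_right t)" and f0: "0 \<le> f 0"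
  shows "run_sup f \<in> cadlag_up_space T"
proof -
  have "run_sup f 0 = f 0" by (simp add: run_sup_def)
  then show ?thesis
    using run_sup_mono[OF bnd] run_sup_right_continuous[OF bnd _ rc] 
      mono_on_left_limit[OF run_sup_mono[OF bnd]] f0
    by (auto simp: cadlag_up_space_def cadlag_space_def)
qed

lemma reflection_tandem_component:
  "(x + reflection_matrix tandem_routing *v z) $ 1 = x $ 1 + z $ 1"
  "(x + reflection_matrix tandem_routing *v z) $ 2 = x $ 2 - z $ 1 + z $ 2"
  by (simp_all add: reflection_matrix_tandem matrix_vector_mult_def sum_2)

text \<open>The arguments are the two coordinates of the potential; \<open>run_sup (\<lambda>s. - x1 s)\<close> is the unused
capacity of node 1, which is withdrawn from the input of node 2.\<close>

definition tandem_content :: "(real \<Rightarrow> real) \<Rightarrow> (real \<Rightarrow> real) \<Rightarrow> real \<Rightarrow> real" where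
  "tandem_content x1 x2 t =
     x2 t - run_sup (\<lambda>s. - x1 s) t + run_sup (\<lambda>s. run_sup (\<lambda>s. - x1 s) s - x2 s) t"

text \<open>Feasibility of a regulator reads \<open>\<zeta>\<^sub>1 \<ge> - \<xi>\<^sub>1\<close> and \<open>\<zeta>\<^sub>2 \<ge> \<zeta>\<^sub>1 - \<xi>\<^sub>2\<close>. Since regulators are monotone,
the first inequality forces \<open>\<zeta>\<^sub>1\<close> above the running supremum \<open>p1\<close> of \<open>- \<xi>\<^sub>1\<close>, and then the second one
forces \<open>\<zeta>\<^sub>2\<close> above the running supremum \<open>p2\<close> of \<open>p1 - \<xi>\<^sub>2\<close>. As \<open>p1\<close> and \<open>p2\<close> are themselves right
continuous, the pair is feasible and the componentwise infima are attained by it.\<close>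

lemma reflected_tandem:
  fixes \<xi> :: "real \<Rightarrow> real^2"
  assumes T: "0 \<le> T"
    and rc: "\<And>t i. t \<in> {0..<T} \<Longrightarrow> ((\<lambda>s. \<xi> s $ i) \<longlongrightarrow> \<xi> t $ i) (at_right t)"
    and bnd: "\<And>t i. t \<in> {0..T} \<Longrightarrow> - B \<le> \<xi> t $ i"
    and start: "\<And>i. \<xi> 0 $ i = 0"
  shows "reflected T tandem_routing \<xi> T $ 2 = tandem_content (\<lambda>s. \<xi> s $ 1) (\<lambda>s. \<xi> s $ 2) T"
proof -
  define p1 where "p1 = run_sup (\<lambda>s. - \<xi> s $ 1)"
  define p2 where "p2 = run_sup (\<lambda>s. p1 s - \<xi> s $ 2)"
  have b1: "\<forall>s\<in>{0..T}. - \<xi> s $ 1 \<le> B" using bnd[of _ 1] by fastforce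
  have p1B: "p1 s \<le> B" if "s \<in> {0..T}" for s
    unfolding p1_def by (rule run_sup_least) (use that b1 in auto)
  have b2: "\<forall>s\<in>{0..T}. p1 s - \<xi> s $ 2 \<le> B + B"
    using bnd[of _ 2] p1B by fastforce
  have p10: "p1 0 = 0" by (simp add: p1_def run_sup_def start)
  have rc1: "(p1 \<longlongrightarrow> p1 t) (at_right t)" if "t \<in> {0..<T}" for t
    unfolding p1_def by (rule run_sup_right_continuous[OF b1 that]) (auto intro!: tendsto_intros rc that)
  have c1: "p1 \<in> cadlag_up_space T"
    unfolding p1_def by (rule run_sup_cadlag_up[OF b1]) (auto intro!: tendsto_intros rc simp: start T)
  have c2: "p2 \<in> cadlag_up_space T"
    unfolding p2_def
    by (rule run_sup_cadlag_up[OF b2]) (auto intro!: tendsto_intros rc rc1 simp: start T p10)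
  define w :: "real \<Rightarrow> real^2" where "w = (\<lambda>t. vector [p1 t, p2 t])"
  have w: "w t $ 1 = p1 t" "w t $ 2 = p2 t" for t by (auto simp: w_def)
  have wmem: "w \<in> feasible_regulators T tandem_routing \<xi>"
  proof -
    have "0 \<le> \<xi> t $ 1 + p1 t" if "t \<in> {0..T}" for t
      using run_sup_upper[OF b1, where t=t and s=t] that by (auto simp: p1_def)
    moreover have "0 \<le> \<xi> t $ 2 - p1 t + p2 t" if "t \<in> {0..T}" for t
      using run_sup_upper[OF b2, where t=t and s=t] that by (auto simp: p2_def)
    ultimately show ?thesis
      unfolding feasible_regulators_def forall_2 mem_Collect_eq reflection_tandem_component
      using c1 c2 by (auto simp: w)
  qed
  have least: "p1 t \<le> z t $ 1" "p2 t \<le> z t $ 2"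
    if z: "z \<in> feasible_regulators T tandem_routing \<xi>" and t: "t \<in> {0..T}" for z t
  proof -
    have f: "0 \<le> \<xi> s $ 1 + z s $ 1" "0 \<le> \<xi> s $ 2 - z s $ 1 + z s $ 2" if "s \<in> {0..T}" for s
      using z that
      unfolding feasible_regulators_def forall_2 mem_Collect_eq reflection_tandem_component by auto
    have m: "z s $ i \<le> z t $ i" if "s \<in> {0..T}" "t \<in> {0..T}" "s \<le> t" for s t i
      using z that by (auto simp: feasible_regulators_def cadlag_up_space_def mono_on_def)
    have g: "p1 t \<le> z t $ 1" if "t \<in> {0..T}" for t
      unfolding p1_def
    proof (rule run_sup_least)
      fix s assume "0 \<le> s" "s \<le> t"
      then show "- \<xi> s $ 1 \<le> z t $ 1" using f(1)[of s] m[of s t 1] that by auto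
    qed (use that in auto)
    show "p1 t \<le> z t $ 1" by (rule g[OF t])
    show "p2 t \<le> z t $ 2"
      unfolding p2_def
    proof (rule run_sup_least)
      fix s assume "0 \<le> s" "s \<le> t"
      then show "p1 s - \<xi> s $ 2 \<le> z t $ 2" using f(2)[of s] g[of s] m[of s t 2] t by auto
    qed (use t in auto)
  qed
  have TT: "T \<in> {0..T}" using T by auto
  have "regulator T tandem_routing \<xi> T $ 1 = p1 T"
    unfolding regulator_def vec_lambda_beta
  proof (rule cInf_eq_minimum)
    show "p1 T \<in> {z T $ 1 |z. z \<in> feasible_regulators T tandem_routing \<xi>}"
      using wmem w(1)[of T, symmetric] by blast
  qed (use least(1)[OF _ TT] in auto)
  moreover have "regulator T tandem_routing \<xi> T $ 2 = p2 T"
    unfolding regulator_def vec_lambda_beta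
  proof (rule cInf_eq_minimum)
    show "p2 T \<in> {z T $ 2 |z. z \<in> feasible_regulators T tandem_routing \<xi>}"
      using wmem w(2)[of T, symmetric] by blast
  qed (use least(2)[OF _ TT] in auto)
  ultimately show ?thesis
    unfolding reflected_def reflection_tandem_component tandem_content_def
    by (simp add: p1_def p2_def)
qed

text \<open>In terms of the last time \<open>s\<close> at which node 2 was empty, the content is the input of node 2 after
\<open>s\<close> plus the output of node 1 after \<open>s\<close> minus \<open>r2 * (T - s)\<close>. The output of node 1 during \<open>T - s\<close> is at most
\<open>r1 * (T - s)\<close>, which yields a contribution \<open>\<kappa> * (T - s)\<close>; it is also bounded through the input of
node 1, which yields \<open>v1 - (r1 - g1 - \<kappa>) * (T - s)\<close>. The first bound increases in \<open>T - s\<close>, the second one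
decreases, and both equal \<open>\<kappa> / (r1 - g1) * v1\<close> at \<open>T - s = v1 / (r1 - g1)\<close>.\<close>

lemma tandem_content_le:
  fixes j1 j2 :: "real \<Rightarrow> real"
  assumes T: "0 \<le> T" and j1: "\<And>s. s \<in> {0..T} \<Longrightarrow> j1 s \<ge> 0"
    and r1: "0 \<le> r1"
    and v1: "\<And>u. u \<in> {0..<T} \<Longrightarrow> j1 T - j1 u \<le> g1 * (T - u) + v1" "0 \<le> v1"
    and v2: "\<And>u. u \<in> {0..<T} \<Longrightarrow> j2 T - j2 u \<le> g2 * (T - u) + v2" "0 \<le> v2"
    and stab: "g1 < r1" "g1 + g2 < r2"
  defines "\<kappa> \<equiv> r1 + g2 - r2"
  defines "Z \<equiv> tandem_content (\<lambda>s. j1 s - r1 * s) (\<lambda>s. j2 s - (r2 - r1) * s) T"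
  shows "\<kappa> \<le> 0 \<Longrightarrow> Z \<le> v2"
    and "0 < \<kappa> \<Longrightarrow> Z \<le> v2 + min (\<kappa> * T) (\<kappa> / (r1 - g1) * v1)"
proof -
  define p where "p = run_sup (\<lambda>s. - (j1 s - r1 * s))"
  have b1: "\<forall>s\<in>{0..T}. - (j1 s - r1 * s) \<le> r1 * T"
    using j1 mult_left_mono[of _ T r1] r1 by force
  have v1': "j1 T - j1 u \<le> g1 * (T - u) + v1" if "u \<in> {0..T}" for u
    using v1 that by (cases "u = T") auto
  have v2': "j2 T - j2 u \<le> g2 * (T - u) + v2" if "u \<in> {0..T}" for u
    using v2 that by (cases "u = T") auto
  have pm: "p s \<le> p T" if "s \<in> {0..T}" for s
    unfolding p_def using run_sup_mono[OF b1] that T by (auto simp: mono_on_def)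
  have Zle: "Z \<le> C" if C: "\<And>s. s \<in> {0..T} \<Longrightarrow> \<kappa> * (T - s) - (p T - p s) + v2 \<le> C" for C
  proof -
    have "run_sup (\<lambda>s. p s - (j2 s - (r2 - r1) * s)) T \<le> C - (j2 T - (r2 - r1) * T) + p T"
    proof (rule run_sup_least[OF T])
      fix s assume s: "0 \<le> s" "s \<le> T"
      then show "p s - (j2 s - (r2 - r1) * s) \<le> C - (j2 T - (r2 - r1) * T) + p T"
        using C[of s] v2'[of s] by (auto simp: \<kappa>_def algebra_simps)
    qed
    then show ?thesis unfolding Z_def tandem_content_def p_def by simp
  qed
  show "Z \<le> v2" if "\<kappa> \<le> 0"
  proof (rule Zle)
    fix s assume s: "s \<in> {0..T}"
    have "\<kappa> * (T - s) \<le> 0" using that s by (simp add: mult_nonpos_nonneg)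
    then show "\<kappa> * (T - s) - (p T - p s) + v2 \<le> v2" using pm[OF s] by auto
  qed
  show "Z \<le> v2 + min (\<kappa> * T) (\<kappa> / (r1 - g1) * v1)" if k: "0 < \<kappa>"
  proof (rule Zle)
    fix s assume s: "s \<in> {0..T}"
    define d where "d = T - s"
    have d: "0 \<le> d" using s by (auto simp: d_def)
    have e1: "\<kappa> * (T - s) - (p T - p s) \<le> \<kappa> * d" using pm[OF s] by (auto simp: d_def)
    have "\<kappa> * d \<le> \<kappa> * T" using s k by (auto simp: d_def)
    moreover have "\<kappa> * (T - s) - (p T - p s) \<le> \<kappa> / (r1 - g1) * v1"
    proof (cases "d \<le> v1 / (r1 - g1)")
      case True
      then have "\<kappa> * d \<le> \<kappa> * (v1 / (r1 - g1))" using k by (intro mult_left_mono) auto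
      then show ?thesis using e1 by (simp add: field_simps)
    next
      case False
      have "p s \<le> p T + v1 - (r1 - g1) * d"
        unfolding p_def
      proof (rule run_sup_least)
        fix u assume u: "0 \<le> u" "u \<le> s"
        have "r1 * T - j1 T \<le> p T"
          unfolding p_def using run_sup_upper[OF b1, where t=T and s=T] T by auto
        moreover have "(r1 - g1) * (T - s) \<le> (r1 - g1) * (T - u)"
          using u stab by (intro mult_left_mono) auto
        ultimately show "- (j1 u - r1 * u)
            \<le> run_sup (\<lambda>s. - (j1 s - r1 * s)) T + v1 - (r1 - g1) * d"
          using v1'[of u] u s unfolding p_def[symmetric] d_def by (auto simp: algebra_simps)
      qed (use s in auto)
      moreover have "(r1 - g1 - \<kappa>) * (v1 / (r1 - g1)) \<le> (r1 - g1 - \<kappa>) * d"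
        using False stab by (intro mult_left_mono) (auto simp: \<kappa>_def)
      moreover have "v1 - (r1 - g1 - \<kappa>) * (v1 / (r1 - g1)) = \<kappa> / (r1 - g1) * v1"
        using stab by (simp add: field_simps)
      ultimately show ?thesis by (auto simp: d_def algebra_simps)
    qed
    ultimately show "\<kappa> * (T - s) - (p T - p s) + v2 \<le> v2 + min (\<kappa> * T) (\<kappa> / (r1 - g1) * v1)"
      using e1 by auto
  qed
qed

text \<open>The hypothesis \<open>lo1\<close> says that node 1 has work during all of \<open>{s0..T}\<close>, up to an amount \<open>e\<close> of
unused capacity. Node 2 then receives \<open>r1 * (T - s0) - e\<close> from node 1.\<close>

lemma tandem_content_ge:
  fixes j1 j2 :: "real \<Rightarrow> real"
  assumes s0: "0 \<le> s0" "s0 \<le> T" and j1: "\<And>s. s \<in> {0..T} \<Longrightarrow> j1 s \<ge> 0" 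
    and j2: "\<And>s. s \<in> {0..T} \<Longrightarrow> j2 s \<ge> 0"
    and r1: "0 \<le> r1" and e: "0 \<le> e"
    and lo1: "\<And>u. u \<in> {s0..T} \<Longrightarrow> j1 u - j1 s0 \<ge> r1 * (u - s0) - e"
    and lo2: "j2 T - j2 s0 \<ge> (r2 - r1) * (T - s0) + e + y"
  shows "y \<le> tandem_content (\<lambda>s. j1 s - r1 * s) (\<lambda>s. j2 s - (r2 - r1) * s) T"
proof -
  define p where "p = run_sup (\<lambda>s. - (j1 s - r1 * s))"
  have b1: "\<forall>s\<in>{0..T}. - (j1 s - r1 * s) \<le> r1 * T"
    using j1 mult_left_mono[of _ T r1] r1 by force
  have pb: "p s \<le> r1 * T" if "s \<in> {0..T}" for s
    unfolding p_def by (rule run_sup_least) (use that b1 in auto)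
  have b2: "\<forall>s\<in>{0..T}. p s - (j2 s - (r2 - r1) * s) \<le> r1 * T + \<bar>r2 - r1\<bar> * T"
  proof
    fix s assume s: "s \<in> {0..T}"
    have "(r2 - r1) * s \<le> \<bar>r2 - r1\<bar> * T"
      using s by (intro mult_mono) auto
    then show "p s - (j2 s - (r2 - r1) * s) \<le> r1 * T + \<bar>r2 - r1\<bar> * T"
      using pb[OF s] j2[OF s] by auto
  qed
  have "p T \<le> p s0 + e"
    unfolding p_def
  proof (rule run_sup_least)
    fix u assume u: "0 \<le> u" "u \<le> T"
    have up: "- (j1 u - r1 * u) \<le> p s0" if "u \<le> s0" "0 \<le> u" for u
      unfolding p_def by (rule run_sup_upper[OF b1]) (use s0 that in auto)
    show "- (j1 u - r1 * u) \<le> run_sup (\<lambda>s. - (j1 s - r1 * s)) s0 + e"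
      unfolding p_def[symmetric] using up[of u] up[of s0] lo1[of u] u s0 e
      by (cases "u \<le> s0") (auto simp: algebra_simps)
  qed (use s0 in auto)
  moreover have "p s0 - (j2 s0 - (r2 - r1) * s0) \<le> run_sup (\<lambda>s. p s - (j2 s - (r2 - r1) * s)) T"
    by (rule run_sup_upper[OF b2]) (use s0 in auto)
  ultimately show ?thesis
    using lo2 unfolding tandem_content_def p_def[symmetric] by (auto simp: algebra_simps)
qed

section \<open>Regularly varying exponents of index less than one\<close>

text \<open>The exponent \<open>v x = L x * x powr \<alpha>\<close> of the jump tails. Monotonicity is a consequence of its being the
exponent of a tail function; it replaces the uniform convergence theorem for slowly varying functions.\<close>

locale reg_var =
  fixes v :: "real \<Rightarrow> real" and \<alpha> x0 :: real
  assumes alpha: "0 < \<alpha>" "\<alpha> < 1"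
    and mono_v: "\<And>x y. 0 \<le> x \<Longrightarrow> x \<le> y \<Longrightarrow> v x \<le> v y"
    and pos_v: "\<forall>\<^sub>F x in at_top. 0 < v x"
    and ratio: "\<And>a. 0 < a \<Longrightarrow> ((\<lambda>x. v (a * x) / v x) \<longlongrightarrow> a powr \<alpha>) at_top"
    and x0: "0 < x0"
    and slope: "\<And>x y. x0 \<le> x \<Longrightarrow> x \<le> y \<Longrightarrow> v y / y \<le> v x / x"
begin

text \<open>Doubling the argument multiplies \<open>v\<close> by almost \<open>2 powr \<alpha>\<close>, hence eventually by more than
\<open>2 powr (\<alpha> / 2)\<close>; monotonicity fills the gaps between powers of two.\<close>

lemma power_lower_bound: "\<exists>C>0. \<forall>\<^sub>F x in at_top. C * x powr (\<alpha> / 2) \<le> v x"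
proof -
  have "2 powr (\<alpha> / 2) < 2 powr \<alpha>" using alpha by simp
  then have "\<forall>\<^sub>F x in at_top. 2 powr (\<alpha> / 2) < v (2 * x) / v x"
    using ratio[of 2] by (intro order_tendstoD) auto
  then have "\<forall>\<^sub>F x in at_top. 0 < v x \<and> 2 powr (\<alpha> / 2) < v (2 * x) / v x \<and> 1 \<le> x"
    using pos_v eventually_ge_at_top[of 1] by eventually_elim auto
  then obtain a where a: "\<And>x. a \<le> x \<Longrightarrow> 0 < v x \<and> 2 powr (\<alpha> / 2) < v (2 * x) / v x \<and> 1 \<le> x"
    by (auto simp: eventually_at_top_linorder)
  have a1: "1 \<le> a" "0 < v a" using a[of a] by auto
  have dbl: "v a * (2 ^ k) powr (\<alpha> / 2) \<le> v (2 ^ k * a)" for k :: nat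
  proof (induction k)
    case (Suc k)
    have "a \<le> 2 ^ k * a" using a1 by simp
    then have "2 powr (\<alpha> / 2) * v (2 ^ k * a) < v (2 * (2 ^ k * a))" "0 < v (2 ^ k * a)"
      using a[of "2 ^ k * a"] by (auto simp: field_simps)
    moreover have "2 powr (\<alpha> / 2) * (v a * (2 ^ k) powr (\<alpha> / 2)) \<le> 2 powr (\<alpha> / 2) * v (2 ^ k * a)"
      using Suc by (intro mult_left_mono) auto
    moreover have "(2 ^ Suc k) powr (\<alpha> / 2) = 2 powr (\<alpha> / 2) * (2 ^ k :: real) powr (\<alpha> / 2)"
      by (simp add: powr_mult)
    moreover have "2 ^ Suc k * a = 2 * (2 ^ k * a)" by simp
    ultimately show ?case by (simp only: mult.left_commute)
  qed (use a1 in simp)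
  define C where "C = v a * (1 / (2 * a)) powr (\<alpha> / 2)"
  have "C * x powr (\<alpha> / 2) \<le> v x" if x: "a \<le> x" for x
  proof -
    define k where "k = nat \<lfloor>log 2 (x / a)\<rfloor>"
    have xa: "1 \<le> x / a" using x a1 by simp
    have l0: "0 \<le> log 2 (x / a)" using xa by simp
    have "real k \<le> log 2 (x / a)" "log 2 (x / a) < real k + 1"
      unfolding k_def using l0 by linarith+
    then have "2 powr real k \<le> x / a" "x / a < 2 powr (real k + 1)"
      using xa by (auto simp: le_log_iff log_less_iff)
    then have k: "2 ^ k * a \<le> x" "x / (2 * a) \<le> 2 ^ k"
      using a1 by (auto simp: powr_realpow powr_add field_simps)
    have "(1 / (2 * a)) powr (\<alpha> / 2) * x powr (\<alpha> / 2) = (x / (2 * a)) powr (\<alpha> / 2)"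
      using a1 x by (simp add: powr_mult[symmetric])
    also have "\<dots> \<le> (2 ^ k) powr (\<alpha> / 2)"
      using k a1 x alpha by (intro powr_mono2) auto
    finally have "C * x powr (\<alpha> / 2) \<le> v a * (2 ^ k) powr (\<alpha> / 2)"
      unfolding C_def using a1 by (simp add: mult.assoc)
    also have "\<dots> \<le> v x"
      using dbl[of k] mono_v[of "2 ^ k * a" x] k a1 by auto
    finally show ?thesis .
  qed
  moreover have "0 < C" using a1 by (simp add: C_def)
  ultimately show ?thesis by (auto simp: eventually_at_top_linorder)
qed

text \<open>Polynomial prefactors are therefore negligible against \<open>exp (- b * v n)\<close>.\<close>

lemma v_dominates:
  assumes "0 < b"
  shows "filterlim (\<lambda>x. b * v x - K * ln x) at_top at_top"
proof -
  obtain C where C: "0 < C" "\<forall>\<^sub>F x in at_top. C * x powr (\<alpha> / 2) \<le> v x"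
    using power_lower_bound by auto
  have "filterlim (\<lambda>x. b * (C * x powr (\<alpha> / 2)) - K * ln x) at_top at_top"
    using assms C(1) alpha by real_asymp
  then show ?thesis
    by (rule filterlim_at_top_mono) (use C(2) assms in \<open>auto elim!: eventually_mono\<close>)
qed

text \<open>The quotient is eventually nonincreasing, so it converges; a nonzero limit would contradict that
doubling multiplies the quotient by asymptotically \<open>2 powr (\<alpha> - 1)\<close>, which differs from 1.\<close>

lemma v_over_x: "((\<lambda>x. v x / x) \<longlongrightarrow> 0) at_top"
proof -
  define g where "g = (\<lambda>x. v x / x)"
  have pos: "\<forall>\<^sub>F x in at_top. 0 < g x \<and> x0 \<le> x"
    using pos_v eventually_gt_at_top[of 0] eventually_ge_at_top[of x0]
    by eventually_elim (auto simp: g_def)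
  then obtain a where a: "\<And>x. a \<le> x \<Longrightarrow> 0 < g x \<and> x0 \<le> x"
    by (auto simp: eventually_at_top_linorder)
  have an: "g y \<le> g x" if "a \<le> x" "x \<le> y" for x y using slope[of x y] a[of x] that by (auto simp: g_def)
  define l where "l = (INF x\<in>{a..}. g x)"
  have bdd: "bdd_below (g ` {a..})" using a by (intro bdd_belowI2[where m=0]) (auto intro: less_imp_le)
  have lim: "(g \<longlongrightarrow> l) at_top"
  proof (rule order_tendstoI)
    fix e assume "e < l"
    moreover have "l \<le> g x" if "a \<le> x" for x unfolding l_def by (rule cINF_lower) (use bdd that in auto)
    ultimately show "\<forall>\<^sub>F x in at_top. e < g x"
      by (auto simp: eventually_at_top_linorder intro!: exI[of _ a] intro: less_le_trans)
  next
    fix e assume "l < e"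
    then obtain x where "a \<le> x" "g x < e"
      unfolding l_def using bdd by (auto simp: cINF_less_iff)
    then show "\<forall>\<^sub>F x in at_top. g x < e"
      using an by (auto simp: eventually_at_top_linorder intro!: exI[of _ x] intro: le_less_trans)
  qed
  have "l = 0"
  proof (rule ccontr)
    assume l: "l \<noteq> 0"
    have "((\<lambda>x. g (2 * x)) \<longlongrightarrow> l) at_top"
      by (rule filterlim_compose[OF lim]) real_asymp
    then have "((\<lambda>x. g (2 * x) / g x) \<longlongrightarrow> l / l) at_top"
      by (intro tendsto_divide lim l)
    moreover have "((\<lambda>x. (v (2 * x) / v x) * (1 / 2)) \<longlongrightarrow> 2 powr \<alpha> * (1 / 2)) at_top"
      by (intro tendsto_intros ratio) auto
    then have "((\<lambda>x. g (2 * x) / g x) \<longlongrightarrow> 2 powr \<alpha> * (1 / 2)) at_top"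
      by (rule Lim_transform_eventually)
         (use eventually_gt_at_top[of 0] in eventually_elim, auto simp: g_def)
    ultimately have "2 powr \<alpha> = 2"
      using l tendsto_unique[of at_top "\<lambda>x. g (2 * x) / g x"] by fastforce
    moreover have "2 powr \<alpha> < 2 powr 1" using alpha by (intro powr_less_mono) auto
    ultimately show False by simp
  qed
  then show ?thesis using lim by (simp add: g_def)
qed

lemma v_scaled:
  assumes "0 < a" "0 < e"
  shows "\<forall>\<^sub>F n in sequentially. \<bar>v (real n * a) - v (real n) * a powr \<alpha>\<bar> \<le> e * v (real n)"
proof -
  have "\<forall>\<^sub>F x in at_top. \<bar>v (x * a) - v x * a powr \<alpha>\<bar> \<le> e * v x"
    using tendstoD[OF ratio[OF assms(1)] assms(2)] pos_v
  proof eventually_elim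
    case (elim x)
    then have "\<bar>v (a * x) / v x - a powr \<alpha>\<bar> * v x \<le> e * v x"
      by (intro mult_right_mono) (auto simp: dist_real_def)
    moreover have "\<bar>v (a * x) / v x - a powr \<alpha>\<bar> * v x = \<bar>v (x * a) - v x * a powr \<alpha>\<bar>"
    proof -
      have "v (x * a) - v x * a powr \<alpha> = (v (a * x) / v x - a powr \<alpha>) * v x"
        using elim by (simp add: field_simps)
      then show ?thesis using elim by (simp add: abs_mult)
    qed
    ultimately show ?case by simp
  qed
  then show ?thesis
    by (rule eventually_compose_filterlim[OF _ filterlim_real_sequentially])
qed

end

section \<open>Concavity of powers\<close>

lemma powr_subadd:
  fixes a b :: real
  assumes "0 \<le> a" "0 \<le> b" "0 < p" "p \<le> 1"
  shows "(a + b) powr p \<le> a powr p + b powr p"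
proof (cases "a + b = 0")
  case False
  then have ab: "0 < a + b" using assms by auto
  have *: "x \<le> x powr p" if "0 \<le> x" "x \<le> 1" for x :: real
    using powr_mono'[of p 1 x] that assms by auto
  have "1 = a / (a + b) + b / (a + b)" using ab by (simp add: add_divide_distrib[symmetric])
  also have "\<dots> \<le> (a / (a + b)) powr p + (b / (a + b)) powr p"
    using assms ab by (intro add_mono *) auto
  also have "\<dots> = (a powr p + b powr p) / (a + b) powr p"
    using assms ab by (simp add: powr_divide add_divide_distrib)
  finally show ?thesis using ab by (simp add: field_simps)
qed (use assms in auto)

text \<open>Normalizing by the weighted mean \<open>m\<close>, this is the Bernoulli inequality
\<open>x powr p \<le> 1 + p * (x - 1)\<close> averaged over \<open>a / m\<close> and \<open>b / m\<close>.\<close>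

lemma powr_concave:
  fixes a b :: real
  assumes "0 \<le> a" "0 \<le> b" "0 < p" "p < 1" "0 \<le> t" "t \<le> 1"
  shows "(1 - t) * a powr p + t * b powr p \<le> ((1 - t) * a + t * b) powr p"
proof -
  define m where "m = (1 - t) * a + t * b"
  have bern: "x powr p \<le> 1 + p * (x - 1)" if "0 \<le> x" for x
    using Youngs_inequality_0[of p "1 - p" x 1] that assms
    by (cases "x = 0") (simp_all add: algebra_simps)
  have m0: "0 \<le> (1 - t) * a" "0 \<le> t * b" using assms by auto
  show ?thesis
  proof (cases "m = 0")
    case True
    then have "(1 - t) * a = 0" "t * b = 0" using m0 unfolding m_def by linarith+
    then show ?thesis by auto
  next
    case False
    then have m: "0 < m" using m0 by (auto simp: m_def)
    have "(1 - t) * (a / m) powr p + t * (b / m) powr p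
        \<le> (1 - t) * (1 + p * (a / m - 1)) + t * (1 + p * (b / m - 1))"
      using assms m by (intro add_mono mult_left_mono bern) auto
    also have "\<dots> = 1 + p * (m / m - 1)"
    proof -
      have "m / m = (1 - t) * (a / m) + t * (b / m)"
        by (subst m_def) (simp add: add_divide_distrib)
      then show ?thesis by (simp only:) (simp add: algebra_simps)
    qed
    finally have "((1 - t) * a powr p + t * b powr p) / m powr p \<le> 1"
      using m assms by (simp add: powr_divide add_divide_distrib)
    then show ?thesis using m unfolding m_def[symmetric] by (simp add: field_simps)
  qed
qed

text \<open>The cost of splitting the level \<open>y\<close> into a part \<open>x\<close> due to node 1 and a part \<open>y - x\<close> due to
  node 2. It is concave on \<open>{0..xs}\<close>, so the end points of this interval are optimal; beyond \<open>xs = y\<close> the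
  first term alone exceeds the value at \<open>y\<close>.\<close>

lemma split_cost_lower_bound:
  fixes A c2 p y x xs :: real
  assumes "0 \<le> A" "0 \<le> c2" "0 < p" "p < 1" "0 \<le> x" "0 \<le> xs" "xs \<le> y" "x \<le> xs \<or> xs = y"
  shows "min (c2 * y powr p) (A * xs powr p + c2 * (y - xs) powr p)
       \<le> A * x powr p + c2 * (max 0 (y - x)) powr p"
proof (cases "x \<le> xs")
  case True
  show ?thesis
  proof (cases "xs = 0")
    case True
    then show ?thesis using \<open>x \<le> xs\<close> assms by (auto simp: min_def)
  next
    case False
    define t where "t = x / xs"
    have t: "0 \<le> t" "t \<le> 1" "x = t * xs" using False assms True by (auto simp: t_def field_simps)
    have yx: "y - x = (1 - t) * y + t * (y - xs)" by (simp add: t(3) algebra_simps)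
    have 1: "t * xs powr p \<le> x powr p"
      using powr_concave[of 0 xs p t] t assms by simp
    have 2: "(1 - t) * y powr p + t * (y - xs) powr p \<le> (y - x) powr p"
      unfolding yx by (rule powr_concave) (use t assms in auto)
    have "min (c2 * y powr p) (A * xs powr p + c2 * (y - xs) powr p)
        \<le> (1 - t) * (c2 * y powr p) + t * (A * xs powr p + c2 * (y - xs) powr p)"
    proof -
      have "min a b \<le> (1 - t) * a + t * b" for a b :: real
      proof -
        have "(1 - t) * min a b + t * min a b \<le> (1 - t) * a + t * b"
          using t by (intro add_mono mult_left_mono) auto
        then show ?thesis by (simp add: algebra_simps)
      qed
      then show ?thesis .
    qed
    also have "\<dots> = A * (t * xs powr p) + c2 * ((1 - t) * y powr p + t * (y - xs) powr p)"
      by (simp add: algebra_simps)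
    also have "\<dots> \<le> A * x powr p + c2 * (y - x) powr p"
      using assms 1 2 by (intro add_mono mult_left_mono) auto
    finally show ?thesis using assms True by (simp add: max_def)
  qed
next
  case False
  then have "xs = y" using assms by auto
  moreover have "A * xs powr p \<le> A * x powr p"
    using False assms by (intro mult_left_mono powr_mono2) auto
  moreover have "0 \<le> c2 * (max 0 (y - x)) powr p" using assms by auto
  moreover have "c2 * (y - xs) powr p = 0" using \<open>xs = y\<close> by simp
  ultimately have "A * xs powr p + c2 * (y - xs) powr p \<le> A * x powr p + c2 * (max 0 (y - x)) powr p"
    by linarith
  then show ?thesis by (simp add: min_le_iff_disj)
qed

section \<open>Compound Poisson sums\<close>

lemma (in prob_space) emeasure_countable_mixture:
  fixes P :: "'a \<Rightarrow> 'p::countable"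
  assumes P[measurable]: "P \<in> measurable M (count_space UNIV)"
    and B[measurable]: "\<And>p. B p \<in> events"
    and ind: "\<And>p. prob ((P -` {p} \<inter> space M) \<inter> B p) = prob (P -` {p} \<inter> space M) * prob (B p)"
  shows "emeasure M {\<omega> \<in> space M. \<omega> \<in> B (P \<omega>)} = (\<integral>\<^sup>+\<omega>. emeasure M (B (P \<omega>)) \<partial>M)"
proof -
  define C where "C p = P -` {p} \<inter> space M" for p
  have C[measurable]: "C p \<in> events" for p
    unfolding C_def by (rule measurable_sets[OF P]) auto
  have "{\<omega> \<in> space M. \<omega> \<in> B (P \<omega>)} = (\<Union>p. C p \<inter> B p)" by (auto simp: C_def)
  then have "emeasure M {\<omega> \<in> space M. \<omega> \<in> B (P \<omega>)} = (\<integral>\<^sup>+p. emeasure M (C p \<inter> B p) \<partial>count_space UNIV)"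
    by (simp only:) (rule emeasure_UN_countable, auto simp: C_def disjoint_family_on_def)
  also have "\<dots> = (\<integral>\<^sup>+p. \<integral>\<^sup>+\<omega>. indicator (C p) \<omega> * emeasure M (B p) \<partial>M \<partial>count_space UNIV)"
  proof (intro nn_integral_cong)
    fix p
    have "emeasure M (C p \<inter> B p) = emeasure M (C p) * emeasure M (B p)"
      using ind[of p] by (simp add: emeasure_eq_measure C_def ennreal_mult)
    then show "emeasure M (C p \<inter> B p) = (\<integral>\<^sup>+\<omega>. indicator (C p) \<omega> * emeasure M (B p) \<partial>M)"
      by (simp add: nn_integral_multc)
  qed
  also have "\<dots> = (\<integral>\<^sup>+\<omega>. \<integral>\<^sup>+p. indicator (C p) \<omega> * emeasure M (B p) \<partial>count_space UNIV \<partial>M)"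
    by (rule nn_integral_count_space_nn_integral[symmetric]) auto
  also have "\<dots> = (\<integral>\<^sup>+\<omega>. emeasure M (B (P \<omega>)) \<partial>M)"
  proof (intro nn_integral_cong)
    fix \<omega> assume "\<omega> \<in> space M"
    then have "(\<integral>\<^sup>+p. indicator (C p) \<omega> * emeasure M (B p) \<partial>count_space UNIV)
        = (\<integral>\<^sup>+p. emeasure M (B p) * indicator {P \<omega>} p \<partial>count_space UNIV)"
      by (intro nn_integral_cong) (auto simp: C_def indicator_def)
    then show "(\<integral>\<^sup>+p. indicator (C p) \<omega> * emeasure M (B p) \<partial>count_space UNIV) = emeasure M (B (P \<omega>))"
      by (simp add: nn_integral_indicator_singleton)
  qed
  finally show ?thesis .
qed

locale compound_poisson_space = prob_space M for M :: "'a measure" +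
  fixes N :: "real \<Rightarrow> 'a \<Rightarrow> nat" and Y :: "nat \<Rightarrow> 'a \<Rightarrow> real"
  assumes input: "compound_poisson_input N Y"
begin

abbreviation J where "J \<equiv> compound_poisson N Y"

text \<open>The definition of a compound Poisson input states the independence of counts and jumps for precisely
this \<open>\<sigma>\<close>-algebra.\<close>

definition jump_algebra :: "'a measure" where
  "jump_algebra = vimage_algebra (space M) (\<lambda>\<omega>. \<lambda>k\<in>{1..}. Y k \<omega>) (Pi\<^sub>M {1..} (\<lambda>_. borel))"

lemma N_measurable [measurable]: "0 \<le> t \<Longrightarrow> N t \<in> measurable M (count_space UNIV)"
  using input by (auto simp: compound_poisson_input_def poisson_process_def)

lemma N_path:
  assumes "\<omega> \<in> space M"
  shows N_0: "N 0 \<omega> = 0" and N_mono: "0 \<le> s \<Longrightarrow> s \<le> t \<Longrightarrow> N s \<omega> \<le> N t \<omega>"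
    and N_right: "0 \<le> t \<Longrightarrow> ((\<lambda>s. N s \<omega>) \<longlongrightarrow> N t \<omega>) (at_right t)"
  using input assms
  by (auto simp: compound_poisson_input_def poisson_process_def mono_on_def)

lemma N_increment:
  assumes "0 \<le> s" "s < t"
  shows "distr M (count_space UNIV) (\<lambda>\<omega>. N t \<omega> - N s \<omega>) = measure_pmf (poisson_pmf (t - s))"
  using input assms by (auto simp: compound_poisson_input_def poisson_process_def)

lemma Y_indep: "indep_vars (\<lambda>_. borel) Y {1..}"
  using input by (auto simp: compound_poisson_input_def)

lemma Y_measurable [measurable]: "1 \<le> j \<Longrightarrow> Y j \<in> borel_measurable M"
  using Y_indep by (auto simp: indep_vars_def)

lemma Y_distr: "1 \<le> j \<Longrightarrow> distr M borel (Y j) = distr M borel (Y 1)"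
  using input unfolding compound_poisson_input_def by blast

lemma Y_nonneg: "AE \<omega> in M. \<forall>j\<ge>1. 0 \<le> Y j \<omega>"
  using input by (auto simp: compound_poisson_input_def AE_all_countable)

lemma Y_jump_algebra: "1 \<le> j \<Longrightarrow> Y j \<in> borel_measurable jump_algebra"
proof -
  assume j: "1 \<le> j"
  have "(\<lambda>\<omega>. \<lambda>k\<in>{1..}. Y k \<omega>) \<in> measurable jump_algebra (Pi\<^sub>M {1..} (\<lambda>_. borel))"
    unfolding jump_algebra_def by (rule measurable_vimage_algebra1) (auto simp: space_PiM)
  then have "(\<lambda>\<omega>. (\<lambda>k\<in>{1..}. Y k \<omega>) j) \<in> borel_measurable jump_algebra"
    by (rule measurable_compose) (use j in \<open>auto intro: measurable_component_singleton\<close>)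
  then show ?thesis using j by simp
qed

lemma space_jump_algebra [simp]: "space jump_algebra = space M"
  by (simp add: jump_algebra_def)

lemma indep_counts_jumps:
  assumes "0 \<le> s" "s \<le> t" and "B \<in> sets jump_algebra"
  shows "B \<in> events"
    and "prob (((\<lambda>\<omega>. (N s \<omega>, N t \<omega> - N s \<omega>)) -` {p} \<inter> space M) \<inter> B)
         = prob ((\<lambda>\<omega>. (N s \<omega>, N t \<omega> - N s \<omega>)) -` {p} \<inter> space M) * prob B"
proof -
  define A where "A = vimage_algebra (space M) (\<lambda>\<omega>. \<lambda>i\<in>{0..}. N i \<omega>) (Pi\<^sub>M {0..} (\<lambda>_. count_space UNIV))"
  have ind: "indep_set (sets A) (sets jump_algebra)"
    using input unfolding compound_poisson_input_def indep_families_def A_def jump_algebra_def by blast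
  then show "B \<in> events" using assms(3) indep_setD_ev2 by blast
  have NA: "N i \<in> measurable A (count_space UNIV)" if i: "0 \<le> i" for i
  proof -
    have "(\<lambda>\<omega>. \<lambda>k\<in>{0..}. N k \<omega>) \<in> measurable A (Pi\<^sub>M {0..} (\<lambda>_. count_space UNIV))"
      unfolding A_def by (rule measurable_vimage_algebra1) (auto simp: space_PiM)
    then have "(\<lambda>\<omega>. (\<lambda>k\<in>{0..}. N k \<omega>) i) \<in> measurable A (count_space UNIV)"
      by (rule measurable_compose) (use i in \<open>auto intro: measurable_component_singleton\<close>)
    then show ?thesis using i by simp
  qed
  have [measurable]: "N s \<in> measurable A (count_space UNIV)" "N t \<in> measurable A (count_space UNIV)"
    using NA assms by auto
  have "(\<lambda>\<omega>. (N s \<omega>, N t \<omega> - N s \<omega>)) \<in> measurable A (count_space UNIV)"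
    by measurable
  then have "(\<lambda>\<omega>. (N s \<omega>, N t \<omega> - N s \<omega>)) -` {p} \<inter> space A \<in> sets A"
    by (rule measurable_sets) auto
  moreover have "space A = space M" by (simp add: A_def)
  ultimately show "prob (((\<lambda>\<omega>. (N s \<omega>, N t \<omega> - N s \<omega>)) -` {p} \<inter> space M) \<inter> B)
         = prob ((\<lambda>\<omega>. (N s \<omega>, N t \<omega> - N s \<omega>)) -` {p} \<inter> space M) * prob B"
    using indep_setD[OF ind _ assms(3)] by auto
qed

text \<open>Conditioning on the number of jumps before \<open>s\<close> and during \<open>{s<..t}\<close>: given these two numbers, an
event about the jumps has its unconditional probability.\<close>

lemma increment_mixture:
  assumes st: "0 \<le> s" "s < t" and B: "\<And>k K. B k K \<in> sets jump_algebra"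
  shows "emeasure M {\<omega> \<in> space M. \<omega> \<in> B (N s \<omega>) (N t \<omega> - N s \<omega>)}
    = (\<integral>\<^sup>+\<omega>. emeasure M (B (N s \<omega>) (N t \<omega> - N s \<omega>)) \<partial>M)"
proof -
  have [measurable]: "N s \<in> measurable M (count_space UNIV)" "N t \<in> measurable M (count_space UNIV)"
    using st by auto
  have "(\<lambda>\<omega>. (N s \<omega>, N t \<omega> - N s \<omega>)) \<in> measurable M (count_space UNIV)"
    by measurable
  from emeasure_countable_mixture[OF this, where B = "\<lambda>(k, K). B k K"]
  show ?thesis
    using indep_counts_jumps[OF st(1) less_imp_le[OF st(2)] B] by (auto split: prod.split)
qed

lemma poisson_nn_integral:
  assumes st: "0 \<le> s" "s < t" and g: "\<And>K. 0 \<le> g K"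
    and sm: "(\<lambda>K. g K * ((t - s) ^ K / fact K)) sums S"
  shows "(\<integral>\<^sup>+\<omega>. ennreal (g (N t \<omega> - N s \<omega>)) \<partial>M) = ennreal (exp (- (t - s)) * S)"
proof -
  have [measurable]: "N s \<in> measurable M (count_space UNIV)" "N t \<in> measurable M (count_space UNIV)"
    using st by auto
  have "(\<integral>\<^sup>+\<omega>. ennreal (g (N t \<omega> - N s \<omega>)) \<partial>M)
      = (\<integral>\<^sup>+K. ennreal (g K) \<partial>distr M (count_space UNIV) (\<lambda>\<omega>. N t \<omega> - N s \<omega>))"
    by (subst nn_integral_distr) auto
  also have "\<dots> = (\<integral>\<^sup>+K. ennreal (pmf (poisson_pmf (t - s)) K) * ennreal (g K) \<partial>count_space UNIV)"
    unfolding N_increment[OF st] by (rule nn_integral_measure_pmf)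
  also have "\<dots> = (\<Sum>K. ennreal (exp (- (t - s)) * (g K * ((t - s) ^ K / fact K))))"
    using st g by (subst nn_integral_count_space_nat)
      (auto simp: ennreal_mult[symmetric] mult_ac intro!: suminf_cong)
  also have "\<dots> = ennreal (exp (- (t - s)) * S)"
    using st g by (intro suminf_ennreal_eq sums_mult sm) auto
  finally show ?thesis .
qed

text \<open>If the conditional probability is bounded in terms of the number of jumps during \<open>{s<..t}\<close> alone, the
mixture is an exponential series.\<close>

lemma prob_mixture_le:
  assumes st: "0 \<le> s" "s < t" and B: "\<And>k K. B k K \<in> sets jump_algebra"
    and g: "\<And>k K. prob (B k K) \<le> g K"
    and sm: "(\<lambda>K. g K * ((t - s) ^ K / fact K)) sums S"
  shows "prob {\<omega> \<in> space M. \<omega> \<in> B (N s \<omega>) (N t \<omega> - N s \<omega>)} \<le> exp (- (t - s)) * S"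
proof -
  have g0: "0 \<le> g K" for K using g[of undefined K] measure_nonneg order_trans by blast
  have "emeasure M {\<omega> \<in> space M. \<omega> \<in> B (N s \<omega>) (N t \<omega> - N s \<omega>)}
      \<le> (\<integral>\<^sup>+\<omega>. ennreal (g (N t \<omega> - N s \<omega>)) \<partial>M)"
    by (subst increment_mixture[OF st B])
      (intro nn_integral_mono, auto simp: emeasure_eq_measure g intro!: ennreal_leI)
  also have "\<dots> = ennreal (exp (- (t - s)) * S)" by (rule poisson_nn_integral[OF st g0 sm])
  finally have "emeasure M {\<omega> \<in> space M. \<omega> \<in> B (N s \<omega>) (N t \<omega> - N s \<omega>)} \<le> \<dots>" .
  moreover have "0 \<le> S"
    using sums_le[OF _ sums_zero sm] g0 st by auto
  ultimately show ?thesis by (simp add: emeasure_eq_measure)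
qed

lemma prob_mixture_eq:
  assumes st: "0 \<le> s" "s < t" and B: "\<And>k K. B k K \<in> sets jump_algebra"
    and g: "\<And>k K. prob (B k K) = g K"
    and sm: "(\<lambda>K. g K * ((t - s) ^ K / fact K)) sums S"
  shows "prob {\<omega> \<in> space M. \<omega> \<in> B (N s \<omega>) (N t \<omega> - N s \<omega>)} = exp (- (t - s)) * S"
proof -
  have g0: "0 \<le> g K" for K using g[of undefined K] measure_nonneg by metis
  have "emeasure M {\<omega> \<in> space M. \<omega> \<in> B (N s \<omega>) (N t \<omega> - N s \<omega>)}
      = (\<integral>\<^sup>+\<omega>. ennreal (g (N t \<omega> - N s \<omega>)) \<partial>M)"
    by (subst increment_mixture[OF st B]) (simp add: emeasure_eq_measure g)
  also have "\<dots> = ennreal (exp (- (t - s)) * S)" by (rule poisson_nn_integral[OF st g0 sm])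
  finally have "emeasure M {\<omega> \<in> space M. \<omega> \<in> B (N s \<omega>) (N t \<omega> - N s \<omega>)} = \<dots>" .
  moreover have "0 \<le> S"
    using sums_le[OF _ sums_zero sm] g0 st by auto
  ultimately show ?thesis by (simp add: emeasure_eq_measure)
qed

lemma nn_integral_prod_jumps:
  fixes f :: "nat \<Rightarrow> real \<Rightarrow> ennreal"
  assumes I: "finite I" "I \<subseteq> {1..}" and f[measurable]: "\<And>j. f j \<in> borel_measurable borel"
  shows "(\<integral>\<^sup>+\<omega>. (\<Prod>j\<in>I. f j (Y j \<omega>)) \<partial>M) = (\<Prod>j\<in>I. \<integral>\<^sup>+\<omega>. f j (Y 1 \<omega>) \<partial>M)"
proof -
  have "indep_vars (\<lambda>_. borel) (\<lambda>j \<omega>. f j (Y j \<omega>)) I"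
    by (rule indep_vars_compose2[OF indep_vars_subset[OF Y_indep I(2)]]) auto
  then have "(\<integral>\<^sup>+\<omega>. (\<Prod>j\<in>I. f j (Y j \<omega>)) \<partial>M) = (\<Prod>j\<in>I. \<integral>\<^sup>+\<omega>. f j (Y j \<omega>) \<partial>M)"
    by (intro indep_vars_nn_integral I) auto
  also have "\<dots> = (\<Prod>j\<in>I. \<integral>\<^sup>+\<omega>. f j (Y 1 \<omega>) \<partial>M)"
  proof (intro prod.cong refl)
    fix j assume "j \<in> I"
    then have j: "1 \<le> j" using I by auto
    have "(\<integral>\<^sup>+\<omega>. f j (Y j \<omega>) \<partial>M) = (\<integral>\<^sup>+x. f j x \<partial>distr M borel (Y j))"
      using j by (subst nn_integral_distr) auto
    also have "\<dots> = (\<integral>\<^sup>+\<omega>. f j (Y 1 \<omega>) \<partial>M)"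
      unfolding Y_distr[OF j] by (subst nn_integral_distr) auto
    finally show "(\<integral>\<^sup>+\<omega>. f j (Y j \<omega>) \<partial>M) = (\<integral>\<^sup>+\<omega>. f j (Y 1 \<omega>) \<partial>M)" .
  qed
  finally show ?thesis .
qed

lemma prob_jump_eq:
  assumes "1 \<le> j" and [measurable]: "A \<in> sets borel"
  shows "prob {\<omega> \<in> space M. Y j \<omega> \<in> A} = prob {\<omega> \<in> space M. Y 1 \<omega> \<in> A}"
proof -
  have "prob {\<omega> \<in> space M. Y j \<omega> \<in> A} = measure (distr M borel (Y j)) A"
    using assms by (subst measure_distr) (auto simp: vimage_def Int_def conj_commute)
  also have "\<dots> = prob {\<omega> \<in> space M. Y 1 \<omega> \<in> A}"
    unfolding Y_distr[OF assms(1)] by (subst measure_distr) (auto simp: vimage_def Int_def conj_commute)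
  finally show ?thesis .
qed

text \<open>Either some jump reaches \<open>h\<close>, or all jumps are below \<open>h\<close> and the Markov inequality applies to the
exponential of the sum of the truncated jumps.\<close>

lemma jump_sum_upper_tail:
  assumes I: "finite I" "I \<subseteq> {1..}" and \<theta>: "0 \<le> \<theta>" and \<mu>: "0 \<le> \<mu>"
    and mgf: "(\<integral>\<^sup>+\<omega>. ennreal (exp (\<theta> * Y 1 \<omega>) * indicator {..<h} (Y 1 \<omega>)) \<partial>M) \<le> ennreal \<mu>"
  shows "prob {\<omega> \<in> space M. a \<le> (\<Sum>j\<in>I. Y j \<omega>)}
     \<le> card I * prob {\<omega> \<in> space M. h \<le> Y 1 \<omega>} + exp (- \<theta> * a) * \<mu> ^ card I"
proof -
  have Ym[measurable]: "Y j \<in> borel_measurable M" if "j \<in> I" for j using that I by auto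
  define E where "E = {\<omega> \<in> space M. a \<le> (\<Sum>j\<in>I. Y j \<omega>) \<and> (\<forall>j\<in>I. Y j \<omega> < h)}"
  have E[measurable]: "E \<in> events" unfolding E_def using I by measurable
  have "emeasure M E = (\<integral>\<^sup>+\<omega>. indicator E \<omega> \<partial>M)" by simp
  also have "\<dots> \<le> (\<integral>\<^sup>+\<omega>. ennreal (exp (- \<theta> * a)) *
      (\<Prod>j\<in>I. ennreal (exp (\<theta> * Y j \<omega>) * indicator {..<h} (Y j \<omega>))) \<partial>M)"
  proof (intro nn_integral_mono)
    fix \<omega>
    show "indicator E \<omega> \<le> ennreal (exp (- \<theta> * a)) *
      (\<Prod>j\<in>I. ennreal (exp (\<theta> * Y j \<omega>) * indicator {..<h} (Y j \<omega>)))"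
    proof (cases "\<omega> \<in> E")
      case True
      have "(\<Prod>j\<in>I. ennreal (exp (\<theta> * Y j \<omega>) * indicator {..<h} (Y j \<omega>)))
          = (\<Prod>j\<in>I. ennreal (exp (\<theta> * Y j \<omega>)))"
        using True by (intro prod.cong) (auto simp: E_def)
      also have "\<dots> = ennreal (exp (\<theta> * (\<Sum>j\<in>I. Y j \<omega>)))"
        using I by (simp add: prod_ennreal exp_sum sum_distrib_left)
      finally have "ennreal (exp (- \<theta> * a)) *
          (\<Prod>j\<in>I. ennreal (exp (\<theta> * Y j \<omega>) * indicator {..<h} (Y j \<omega>)))
          = ennreal (exp (\<theta> * ((\<Sum>j\<in>I. Y j \<omega>) - a)))"
        by (simp add: ennreal_mult[symmetric] exp_add[symmetric] algebra_simps)
      moreover have "1 \<le> exp (\<theta> * ((\<Sum>j\<in>I. Y j \<omega>) - a))"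
        using True \<theta> by (simp add: E_def)
      ultimately show ?thesis using True by (simp add: ennreal_leI[of 1, simplified])
    qed simp
  qed
  also have "\<dots> = ennreal (exp (- \<theta> * a)) *
      (\<Prod>j\<in>I. \<integral>\<^sup>+\<omega>. ennreal (exp (\<theta> * Y 1 \<omega>) * indicator {..<h} (Y 1 \<omega>)) \<partial>M)"
    by (subst nn_integral_cmult)
       (auto intro!: arg_cong2[where f="(*)"] borel_measurable_prod_ennreal simp: nn_integral_prod_jumps[OF I, where f="\<lambda>_ y. ennreal (exp (\<theta> * y) * indicator {..<h} y)"])
  also have "\<dots> \<le> ennreal (exp (- \<theta> * a)) * (\<Prod>j\<in>I. ennreal \<mu>)"
    using mgf by (intro mult_left_mono prod_mono_ennreal) simp_all
  also have "\<dots> = ennreal (exp (- \<theta> * a) * \<mu> ^ card I)"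
    using \<mu> by (simp add: ennreal_power ennreal_mult)
  finally have PE: "prob E \<le> exp (- \<theta> * a) * \<mu> ^ card I"
    using \<mu> by (simp add: emeasure_eq_measure)
  define G where "G = (\<Union>j\<in>I. {\<omega> \<in> space M. Y j \<omega> \<in> {h..}})"
  have G[measurable]: "G \<in> events" unfolding G_def using I by (intro sets.finite_UN) auto
  have "prob G \<le> (\<Sum>j\<in>I. prob {\<omega> \<in> space M. Y j \<omega> \<in> {h..}})"
    unfolding G_def using I by (intro finite_measure_subadditive_finite) auto
  also have "\<dots> = (\<Sum>j\<in>I. prob {\<omega> \<in> space M. h \<le> Y 1 \<omega>})"
    using I by (intro sum.cong refl) (subst prob_jump_eq, auto)
  finally have PG: "prob G \<le> card I * prob {\<omega> \<in> space M. h \<le> Y 1 \<omega>}" by simp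
  have "prob {\<omega> \<in> space M. a \<le> (\<Sum>j\<in>I. Y j \<omega>)} \<le> prob (G \<union> E)"
    by (intro finite_measure_mono) (auto simp: G_def E_def not_le)
  also have "\<dots> \<le> prob G + prob E" by (rule measure_Un_le) auto
  finally show ?thesis using PE PG by simp
qed

text \<open>The jump \<open>i\<close> is carried along because in the lower bound for a node the subsequent jumps have to
behave well jointly with a big jump; independence splits off the factor \<open>prob (b \<le> Y 1)\<close>.\<close>

lemma jump_sum_lower_tail:
  assumes I: "finite I" "I \<subseteq> {1..}" and i: "1 \<le> i" "i \<notin> I" and \<theta>: "0 \<le> \<theta>" and \<mu>: "0 \<le> \<mu>"
    and mgf: "(\<integral>\<^sup>+\<omega>. ennreal (exp (- \<theta> * Y 1 \<omega>)) \<partial>M) \<le> ennreal \<mu>"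
  shows "prob {\<omega> \<in> space M. b \<le> Y i \<omega> \<and> (\<Sum>j\<in>I. Y j \<omega>) \<le> a}
     \<le> prob {\<omega> \<in> space M. b \<le> Y 1 \<omega>} * (exp (\<theta> * a) * \<mu> ^ card I)"
proof -
  have Ym[measurable]: "Y j \<in> borel_measurable M" if "j \<in> I" for j using that I by auto
  have [measurable]: "Y i \<in> borel_measurable M" using i by auto
  define E where "E = {\<omega> \<in> space M. b \<le> Y i \<omega> \<and> (\<Sum>j\<in>I. Y j \<omega>) \<le> a}"
  define f :: "nat \<Rightarrow> real \<Rightarrow> ennreal"
    where "f = (\<lambda>j y. if j = i then indicator {b..} y else ennreal (exp (- \<theta> * y)))"
  have f[measurable]: "f j \<in> borel_measurable borel" for j by (simp add: f_def)
  have E[measurable]: "E \<in> events" unfolding E_def by measurable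
  have "emeasure M E = (\<integral>\<^sup>+\<omega>. indicator E \<omega> \<partial>M)" by simp
  also have "\<dots> \<le> (\<integral>\<^sup>+\<omega>. ennreal (exp (\<theta> * a)) * (\<Prod>j\<in>insert i I. f j (Y j \<omega>)) \<partial>M)"
  proof (intro nn_integral_mono)
    fix \<omega>
    show "indicator E \<omega> \<le> ennreal (exp (\<theta> * a)) * (\<Prod>j\<in>insert i I. f j (Y j \<omega>))"
    proof (cases "\<omega> \<in> E")
      case True
      have "(\<Prod>j\<in>insert i I. f j (Y j \<omega>)) = f i (Y i \<omega>) * (\<Prod>j\<in>I. f j (Y j \<omega>))"
        using i I by simp
      also have "f i (Y i \<omega>) = 1" using True by (simp add: f_def E_def)
      also have "(\<Prod>j\<in>I. f j (Y j \<omega>)) = (\<Prod>j\<in>I. ennreal (exp (- \<theta> * Y j \<omega>)))"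
        using i by (intro prod.cong) (auto simp: f_def)
      also have "\<dots> = ennreal (exp (- \<theta> * (\<Sum>j\<in>I. Y j \<omega>)))"
        using I by (subst prod_ennreal) (simp_all only: exp_sum sum_distrib_left, auto)
      finally have "ennreal (exp (\<theta> * a)) * (\<Prod>j\<in>insert i I. f j (Y j \<omega>))
          = ennreal (exp (\<theta> * (a - (\<Sum>j\<in>I. Y j \<omega>))))"
        by (simp add: ennreal_mult[symmetric] exp_add[symmetric] algebra_simps)
      moreover have "1 \<le> exp (\<theta> * (a - (\<Sum>j\<in>I. Y j \<omega>)))"
        using True \<theta> by (simp add: E_def)
      ultimately show ?thesis using True by (simp add: ennreal_leI[of 1, simplified])
    qed simp
  qed
  also have "\<dots> = ennreal (exp (\<theta> * a)) * (\<Prod>j\<in>insert i I. \<integral>\<^sup>+\<omega>. f j (Y 1 \<omega>) \<partial>M)"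
  proof (subst nn_integral_cmult)
    show "(\<lambda>\<omega>. \<Prod>j\<in>insert i I. f j (Y j \<omega>)) \<in> borel_measurable M"
      by (intro borel_measurable_prod_ennreal measurable_compose[OF _ f]) (use I i in auto)
    show "ennreal (exp (\<theta> * a)) * (\<integral>\<^sup>+\<omega>. (\<Prod>j\<in>insert i I. f j (Y j \<omega>)) \<partial>M)
        = ennreal (exp (\<theta> * a)) * (\<Prod>j\<in>insert i I. \<integral>\<^sup>+\<omega>. f j (Y 1 \<omega>) \<partial>M)"
      by (subst nn_integral_prod_jumps) (use I i in auto)
  qed
  also have "(\<Prod>j\<in>insert i I. \<integral>\<^sup>+\<omega>. f j (Y 1 \<omega>) \<partial>M)
      = emeasure M {\<omega> \<in> space M. b \<le> Y 1 \<omega>} * (\<Prod>j\<in>I. \<integral>\<^sup>+\<omega>. ennreal (exp (- \<theta> * Y 1 \<omega>)) \<partial>M)"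
  proof -
    have "(\<integral>\<^sup>+\<omega>. f i (Y 1 \<omega>) \<partial>M) = (\<integral>\<^sup>+\<omega>. indicator {\<omega> \<in> space M. b \<le> Y 1 \<omega>} \<omega> \<partial>M)"
      by (intro nn_integral_cong) (auto simp: f_def indicator_def)
    also have "\<dots> = emeasure M {\<omega> \<in> space M. b \<le> Y 1 \<omega>}" by (rule nn_integral_indicator) simp
    finally have 1: "(\<integral>\<^sup>+\<omega>. f i (Y 1 \<omega>) \<partial>M) = emeasure M {\<omega> \<in> space M. b \<le> Y 1 \<omega>}" .
    have 2: "(\<Prod>j\<in>I. \<integral>\<^sup>+\<omega>. f j (Y 1 \<omega>) \<partial>M) = (\<Prod>j\<in>I. \<integral>\<^sup>+\<omega>. ennreal (exp (- \<theta> * Y 1 \<omega>)) \<partial>M)"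
      using i by (intro prod.cong refl nn_integral_cong) (auto simp: f_def)
    show ?thesis using I i by (subst prod.insert) (simp_all only: 1 2 not_False_eq_True)
  qed
  also have "ennreal (exp (\<theta> * a)) * (emeasure M {\<omega> \<in> space M. b \<le> Y 1 \<omega>} * (\<Prod>j\<in>I. \<integral>\<^sup>+\<omega>. ennreal (exp (- \<theta> * Y 1 \<omega>)) \<partial>M))
     \<le> ennreal (exp (\<theta> * a)) * (emeasure M {\<omega> \<in> space M. b \<le> Y 1 \<omega>} * (\<Prod>j\<in>I. ennreal \<mu>))"
    using mgf by (intro mult_left_mono prod_mono_ennreal) simp_all
  also have "\<dots> = ennreal (prob {\<omega> \<in> space M. b \<le> Y 1 \<omega>} * (exp (\<theta> * a) * \<mu> ^ card I))"
    using \<mu> by (simp add: ennreal_power ennreal_mult[symmetric] emeasure_eq_measure mult_ac)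
  finally show ?thesis
    using \<mu> by (simp add: emeasure_eq_measure E_def)
qed

end

lemma exp_series: "(\<lambda>K. x ^ K / fact K) sums exp (x::real)"
  using exp_converges[of x] by (simp add: field_simps)

lemma exp_series_weighted: "(\<lambda>K. real K * (x ^ K / fact K)) sums (x * exp (x::real))"
proof -
  have "(\<lambda>K. x * (x ^ K / fact K)) sums (x * exp x)" by (intro sums_mult exp_series)
  moreover have "x * (x ^ K / fact K) = real (Suc K) * (x ^ Suc K / fact (Suc K))" for K
    by (simp add: divide_simps)
  ultimately have "(\<lambda>K. real (Suc K) * (x ^ Suc K / fact (Suc K))) sums (x * exp x)" by simp
  from this[THEN sums_Suc] show ?thesis by simp
qed

context compound_poisson_space
begin

lemma J_measurable [measurable]:
  assumes "0 \<le> t"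
  shows "J t \<in> borel_measurable M"
proof -
  have "(\<lambda>\<omega>. (\<Sum>j = 1..N t \<omega>. Y j \<omega>)) \<in> borel_measurable M"
    by (rule measurable_compose_countable[where f = "\<lambda>k \<omega>. \<Sum>j = 1..k. Y j \<omega>"])
       (use assms in \<open>auto intro!: borel_measurable_sum\<close>)
  then show ?thesis by (simp add: compound_poisson_def[abs_def])
qed

lemma J_increment:
  assumes "\<omega> \<in> space M" "0 \<le> s" "s \<le> t"
  shows "J t \<omega> - J s \<omega> = (\<Sum>j\<in>{N s \<omega> + 1..N s \<omega> + (N t \<omega> - N s \<omega>)}. Y j \<omega>)"
proof -
  have "N s \<omega> \<le> N t \<omega>" using N_mono assms by auto
  then have "{1..N t \<omega>} = {1..N s \<omega>} \<union> {N s \<omega> + 1..N s \<omega> + (N t \<omega> - N s \<omega>)}" by auto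
  then show ?thesis
    unfolding compound_poisson_def by (simp add: sum.union_disjoint)
qed

text \<open>Mixing the bound for a sum of \<open>K\<close> jumps over the Poisson number \<open>K\<close>: the first term has mean
\<open>(t - s) * prob (h \<le> Y 1)\<close>, the second one is the probability generating function at \<open>\<mu>\<close>.\<close>

lemma increment_upper_tail:
  assumes st: "0 \<le> s" "s < t" and \<theta>: "0 \<le> \<theta>" and \<mu>: "0 \<le> \<mu>"
    and mgf: "(\<integral>\<^sup>+\<omega>. ennreal (exp (\<theta> * Y 1 \<omega>) * indicator {..<h} (Y 1 \<omega>)) \<partial>M) \<le> ennreal \<mu>"
  shows "prob {\<omega> \<in> space M. a \<le> J t \<omega> - J s \<omega>}
     \<le> (t - s) * prob {\<omega> \<in> space M. h \<le> Y 1 \<omega>} + exp (- \<theta> * a + (t - s) * (\<mu> - 1))"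
proof -
  define p where "p = prob {\<omega> \<in> space M. h \<le> Y 1 \<omega>}"
  define B where "B k K = {\<omega> \<in> space M. a \<le> (\<Sum>j\<in>{k + 1..k + K}. Y j \<omega>)}" for k K
  have [measurable]: "B k K \<in> sets jump_algebra" for k K
  proof -
    have [measurable]: "Y j \<in> borel_measurable jump_algebra" if "j \<in> {k + 1..k + K}" for j
      using that by (intro Y_jump_algebra) auto
    have "{\<omega> \<in> space jump_algebra. a \<le> (\<Sum>j\<in>{k + 1..k + K}. Y j \<omega>)} \<in> sets jump_algebra"
      by measurable
    then show ?thesis by (simp add: B_def)
  qed
  have "prob {\<omega> \<in> space M. \<omega> \<in> B (N s \<omega>) (N t \<omega> - N s \<omega>)}
      \<le> exp (- (t - s)) * (p * ((t - s) * exp (t - s)) + exp (- \<theta> * a) * exp (\<mu> * (t - s)))"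
  proof (rule prob_mixture_le[OF st, where g = "\<lambda>K. K * p + exp (- \<theta> * a) * \<mu> ^ K"])
    show "prob (B k K) \<le> real K * p + exp (- \<theta> * a) * \<mu> ^ K" for k K
      using jump_sum_upper_tail[where I = "{k + 1..k + K}" and a = a, OF _ _ \<theta> \<mu> mgf] by (simp add: B_def p_def)
    have "(\<lambda>K. p * (real K * ((t - s) ^ K / fact K)) + exp (- \<theta> * a) * ((\<mu> * (t - s)) ^ K / fact K))
       sums (p * ((t - s) * exp (t - s)) + exp (- \<theta> * a) * exp (\<mu> * (t - s)))"
      by (intro sums_add sums_mult exp_series exp_series_weighted)
    then show "(\<lambda>K. (real K * p + exp (- \<theta> * a) * \<mu> ^ K) * ((t - s) ^ K / fact K))
       sums (p * ((t - s) * exp (t - s)) + exp (- \<theta> * a) * exp (\<mu> * (t - s)))"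
      by (rule back_subst[of "\<lambda>f. f sums _"])
        (simp add: fun_eq_iff distrib_right power_mult_distrib add_divide_distrib distrib_left mult_ac)
  qed auto
  also have "\<dots> = (t - s) * p + exp (- \<theta> * a + (t - s) * (\<mu> - 1))"
    by (simp add: exp_add[symmetric] exp_minus algebra_simps) (simp add: exp_diff exp_minus exp_add field_simps)
  also have "{\<omega> \<in> space M. \<omega> \<in> B (N s \<omega>) (N t \<omega> - N s \<omega>)} = {\<omega> \<in> space M. a \<le> J t \<omega> - J s \<omega>}"
    using st by (auto simp: B_def J_increment)
  finally show ?thesis by (simp add: p_def)
qed

end

section \<open>Exponential moments of the jumps\<close>

locale heavy_tailed_node = compound_poisson_space M N Y + reg_var v \<alpha> x0
  for M :: "'a measure" and N Y v \<alpha> x0 +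
  fixes c g :: real
  assumes c: "0 < c"
    and tail: "\<And>x. 0 \<le> x \<Longrightarrow> prob {\<omega> \<in> space M. x \<le> Y 1 \<omega>} = exp (- (c * v x))"
    and mean: "has_bochner_integral M (Y 1) g"
begin

lemma Y1_integrable: "integrable M (Y 1)" and Y1_integral: "integral\<^sup>L M (Y 1) = g"
  using mean by (auto simp: has_bochner_integral_iff)

lemma Y1_nonneg: "AE \<omega> in M. 0 \<le> Y 1 \<omega>"
  using Y_nonneg by eventually_elim auto

lemma g_nonneg: "0 \<le> g"
  using integral_nonneg_AE[OF Y1_nonneg] Y1_integral by simp

text \<open>The parameter \<open>\<theta> h\<close> tends to zero, so for jumps up to \<open>\<delta> / \<theta> h\<close> the exponential is almost linear, which
accounts for \<open>1 + \<theta> h * (g + \<eta> / 2)\<close>. A larger jump \<open>y < h\<close> satisfies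
\<open>\<theta> h * y \<le> (1 - e) * c * v y\<close>, because \<open>v y / y\<close> is nonincreasing; hence its contribution is at most of
the order of the sum of \<open>exp (- e * c * v k)\<close> over the integers \<open>k \<ge> \<delta> / \<theta> h\<close>. Half of the exponent
makes the series converge, and the other half makes it smaller than \<open>\<eta> / 2 * \<theta> h\<close>, since \<open>v\<close>
dominates the logarithm.\<close>

lemma truncated_mgf:
  assumes e: "0 < e" "e < 1" and \<eta>: "0 < \<eta>"
  defines "\<theta> \<equiv> \<lambda>h. (1 - e) * (c * v h / h)"
  shows "\<forall>\<^sub>F h in at_top.
    (\<integral>\<^sup>+\<omega>. ennreal (exp (\<theta> h * Y 1 \<omega>) * indicator {..<h} (Y 1 \<omega>)) \<partial>M) \<le> ennreal (1 + \<theta> h * (g + \<eta>))"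
proof -
  define \<delta> where "\<delta> = min 1 (\<eta> / (2 * (g + 1)))"
  have \<delta>: "0 < \<delta>" "\<delta> \<le> 1" "\<delta> * g \<le> \<eta> / 2"
  proof -
    show "0 < \<delta>" "\<delta> \<le> 1" using \<eta> g_nonneg by (auto simp: \<delta>_def)
    have "\<delta> * g \<le> \<eta> / (2 * (g + 1)) * (g + 1)"
      using \<eta> g_nonneg by (intro mult_mono) (auto simp: \<delta>_def)
    moreover have "\<eta> / (2 * (g + 1)) * (g + 1) = \<eta> / 2" using g_nonneg by (simp add: divide_simps)
    ultimately show "\<delta> * g \<le> \<eta> / 2" by linarith
  qed
  \<comment> \<open>One half of \<open>e * c\<close> is spent on summability, the other half on smallness.\<close>
  define b where "b = e * c / 2"
  have b: "0 < b" using e c by (simp add: b_def)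
  define C where "C = (\<Sum>k. exp (- b * v (real k)))"
  have summ: "summable (\<lambda>k. exp (- b * v (real k)))"
  proof (rule summable_comparison_test_ev)
    have "\<forall>\<^sub>F x in at_top. 0 \<le> b * v x - 2 * ln x"
      using v_dominates[OF b, of 2] unfolding filterlim_at_top by blast
    then have "\<forall>\<^sub>F k in sequentially. 0 \<le> b * v (real k) - 2 * ln (real k)"
      by (rule eventually_compose_filterlim[OF _ filterlim_real_sequentially])
    then show "\<forall>\<^sub>F k in sequentially. norm (exp (- b * v (real k))) \<le> real k powr (- 2)"
      using eventually_gt_at_top[of 0]
      by eventually_elim (auto simp: powr_def)
    show "summable (\<lambda>k. real k powr (- 2))" by (simp add: summable_real_powr_iff)
  qed
  have C: "0 \<le> C" unfolding C_def by (intro suminf_nonneg summ) auto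
  \<comment> \<open>The constant for which \<open>b * v A - ln A \<ge> K\<close> makes the contribution of the large jumps small enough.\<close>
  define K where "K = ln (1 + exp 1 * C * (2 / \<delta>) / (\<eta> / 2))"
  have K: "exp 1 * C * (2 / \<delta>) * exp (- K) \<le> \<eta> / 2"
  proof -
    have q: "0 \<le> exp 1 * C * (2 / \<delta>) / (\<eta> / 2)" using C \<delta> \<eta> by auto
    then have "exp K = 1 + exp 1 * C * (2 / \<delta>) / (\<eta> / 2)" unfolding K_def by (subst exp_ln) auto
    then have "exp 1 * C * (2 / \<delta>) \<le> \<eta> / 2 * exp K" using \<eta> \<delta> by (simp add: field_simps)
    then have "exp 1 * C * (2 / \<delta>) * exp (- K) \<le> \<eta> / 2 * exp K * exp (- K)" by (intro mult_right_mono) auto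
    then show ?thesis by (simp add: mult.assoc exp_add[symmetric])
  qed
  have \<theta>0: "(\<theta> \<longlongrightarrow> 0) at_top"
    using tendsto_mult_left[OF v_over_x, of "(1 - e) * c"] by (simp add: \<theta>_def mult_ac)
  have \<theta>pos: "\<forall>\<^sub>F h in at_top. 0 < \<theta> h \<and> 0 < h"
    using pos_v eventually_gt_at_top[of 0] by eventually_elim (use e c in \<open>auto simp: \<theta>_def\<close>)
  have "filterlim (\<lambda>h. (\<delta> / 2) * inverse (\<theta> h)) at_top at_top"
    by (rule filterlim_tendsto_pos_mult_at_top[OF tendsto_const])
       (use \<delta> \<theta>pos \<theta>0 in \<open>auto intro!: filterlim_inverse_at_top elim: eventually_mono\<close>)
  then have lim: "filterlim (\<lambda>h. \<delta> / (2 * \<theta> h)) at_top at_top"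
    by (simp add: field_simps)
  have "\<forall>\<^sub>F x in at_top. K \<le> b * v x - 1 * ln x \<and> x0 \<le> x \<and> 1 \<le> x"
    using v_dominates[OF b, of 1] eventually_ge_at_top[of x0] eventually_ge_at_top[of 1]
    by (auto simp: filterlim_at_top eventually_conj_iff)
  then have "\<forall>\<^sub>F h in at_top. K \<le> b * v (\<delta> / (2 * \<theta> h)) - 1 * ln (\<delta> / (2 * \<theta> h))
      \<and> x0 \<le> \<delta> / (2 * \<theta> h) \<and> 1 \<le> \<delta> / (2 * \<theta> h)"
    by (rule eventually_compose_filterlim[OF _ lim])
  moreover have "\<forall>\<^sub>F h in at_top. \<theta> h < 1" using order_tendstoD(2)[OF \<theta>0, of 1] by simp
  ultimately show ?thesis using \<theta>pos
  proof eventually_elim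
    case (elim h)
    define t where "t = \<theta> h"
    define A where "A = \<delta> / (2 * t)"
    have t: "0 < t" "t < 1" "0 < h" "K \<le> b * v A - ln A" "x0 \<le> A" "1 \<le> A"
      using elim by (auto simp: t_def A_def)
    define m where "m = nat \<lfloor>\<delta> / t\<rfloor>"
    define H where "H = nat \<lceil>h\<rceil>"
    have dt: "\<delta> / t = 2 * A" using t by (simp add: A_def)
    have mA: "A \<le> real m" "real m \<le> \<delta> / t"
      using t(6) unfolding m_def dt by linarith+
    have tailsum: "(\<Sum>k\<in>{m..<H}. exp (t * (real k + 1)) * exp (- (c * v (real k)))) \<le> \<eta> / 2 * t"
    proof -
      have "exp (t * (real k + 1)) * exp (- (c * v (real k))) \<le> exp 1 * exp (- b * v A) * exp (- b * v (real k))"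
        if k: "k \<in> {m..<H}" for k
      proof -
        have k0: "x0 \<le> real k" "A \<le> real k" "0 < real k" "real k \<le> h"
          using k mA t x0 by (auto simp: H_def) linarith
        have "v h / h \<le> v (real k) / real k" by (rule slope) (use k0 in auto)
        then have "(1 - e) * c * (v h / h) * real k \<le> (1 - e) * c * (v (real k) / real k) * real k"
          using e c k0 by (intro mult_right_mono mult_left_mono) auto
        then have "t * real k \<le> (1 - e) * c * v (real k)"
          using k0 by (simp add: t_def \<theta>_def mult_ac)
        moreover have "b * v A \<le> b * v (real k)" using b k0 t by (intro mult_left_mono mono_v) auto
        ultimately have "t * (real k + 1) + - (c * v (real k)) \<le> 1 + - b * v A + - b * v (real k)"
          using t by (simp add: b_def algebra_simps)
        then show ?thesis by (simp only: exp_add[symmetric] exp_le_cancel_iff)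
      qed
      then have "(\<Sum>k\<in>{m..<H}. exp (t * (real k + 1)) * exp (- (c * v (real k))))
         \<le> (\<Sum>k\<in>{m..<H}. exp 1 * exp (- b * v A) * exp (- b * v (real k)))"
        by (rule sum_mono)
      also have "\<dots> = exp 1 * exp (- b * v A) * (\<Sum>k\<in>{m..<H}. exp (- b * v (real k)))"
        by (simp only: sum_distrib_left)
      also have "\<dots> \<le> exp 1 * exp (- b * v A) * C"
        unfolding C_def by (intro mult_left_mono sum_le_suminf summ) auto
      also have "\<dots> \<le> exp 1 * (exp (- K) / A) * C"
      proof (intro mult_left_mono mult_right_mono C)
        have "exp (- b * v A) \<le> exp (- K - ln A)" using t by auto
        also have "\<dots> = exp (- K) / A" using t by (simp add: exp_diff)
        finally show "exp (- b * v A) \<le> exp (- K) / A" .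
      qed auto
      also have "\<dots> = (exp 1 * C * (2 / \<delta>) * exp (- K)) * t"
        using t \<delta> by (simp add: A_def field_simps)
      also have "\<dots> \<le> \<eta> / 2 * t" using K t by (intro mult_right_mono) auto
      finally show ?thesis .
    qed
    \<comment> \<open>A majorant whose mean depends on the law of the jumps only through \<open>g\<close> and the tail at integers.\<close>
    define F where "F = (\<lambda>y. 1 + (1 + \<delta>) * t * y + (\<Sum>k\<in>{m..<H}. exp (t * (real k + 1)) * indicator {real k..} y))"
    have pw: "exp (t * y) * indicator {..<h} y \<le> F y" if y: "0 \<le> y" for y
    proof -
      have S0: "0 \<le> (\<Sum>k\<in>{m..<H}. exp (t * (real k + 1)) * indicator {real k..} y)"
        by (intro sum_nonneg) auto
      have L0: "0 \<le> (1 + \<delta>) * t * y" using t \<delta> y by auto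
      consider "h \<le> y" | "y < h" "t * y \<le> \<delta>" | "y < h" "\<delta> < t * y" by linarith
      then show ?thesis
      proof cases
        case 1
        then show ?thesis using S0 L0 by (simp add: F_def)
      next
        case 2
        have ty: "0 \<le> t * y" using t y by auto
        have "exp (t * y) \<le> 1 + t * y + (t * y)\<^sup>2" using ty 2 \<delta> by (intro exp_bound) auto
        moreover have "(t * y)\<^sup>2 \<le> \<delta> * (t * y)" 
          unfolding power2_eq_square using 2 ty by (intro mult_right_mono) auto
        ultimately show ?thesis using S0 2 by (simp add: F_def algebra_simps)
      next
        case 3
        define k where "k = nat \<lfloor>y\<rfloor>"
        have k: "real k \<le> y" "y < real k + 1" using y by (auto simp: k_def)
        have "\<delta> / t < y" using 3 t by (simp add: field_simps)
        then have "m \<le> k" unfolding m_def k_def by (intro nat_mono floor_mono) auto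
        moreover have "k < H" using 3 k unfolding H_def by linarith
        ultimately have km: "k \<in> {m..<H}" by auto
        have "exp (t * y) \<le> exp (t * (real k + 1)) * indicator {real k..} y"
          using k t by auto
        also have "\<dots> \<le> (\<Sum>k\<in>{m..<H}. exp (t * (real k + 1)) * indicator {real k..} y)"
          using km by (intro member_le_sum) auto
        finally show ?thesis using L0 3 by (simp add: F_def)
      qed
    qed
    have ind: "(\<lambda>\<omega>. indicator {real k..} (Y 1 \<omega>) :: real) = (\<lambda>\<omega>. indicator {\<omega>. real k \<le> Y 1 \<omega>} \<omega>)" for k
      by (auto simp: indicator_def)
    have evk: "{\<omega>. real k \<le> Y 1 \<omega>} \<inter> space M = {\<omega> \<in> space M. real k \<le> Y 1 \<omega>}" for k by auto
    have int1: "integrable M (\<lambda>\<omega>. indicator {real k..} (Y 1 \<omega>) :: real)" for k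
      by (rule integrable_const_bound[where B=1]) auto
    have int2: "integral\<^sup>L M (\<lambda>\<omega>. indicator {real k..} (Y 1 \<omega>)) = exp (- (c * v (real k)))" for k
      unfolding ind using tail[of "real k"] evk[of k] by simp
    have ihb: "has_bochner_integral M (\<lambda>\<omega>. indicator {real k..} (Y 1 \<omega>)) (exp (- (c * v (real k))))" for k
      using int1 int2 by (simp only: has_bochner_integral_iff)
    have chb: "has_bochner_integral M (\<lambda>\<omega>. 1 :: real) 1"
      by (simp add: has_bochner_integral_iff prob_space)
    have Fhb: "has_bochner_integral M (\<lambda>\<omega>. F (Y 1 \<omega>))
        (1 + (1 + \<delta>) * t * g + (\<Sum>k\<in>{m..<H}. exp (t * (real k + 1)) * exp (- (c * v (real k)))))"
      unfolding F_def
      by (intro has_bochner_integral_add has_bochner_integral_sum has_bochner_integral_mult_right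
          ihb chb mean)
    then have Fint: "integrable M (\<lambda>\<omega>. F (Y 1 \<omega>))"
      and "integral\<^sup>L M (\<lambda>\<omega>. F (Y 1 \<omega>)) = 1 + (1 + \<delta>) * t * g + (\<Sum>k\<in>{m..<H}. exp (t * (real k + 1)) * exp (- (c * v (real k))))"
      by (simp_all only: has_bochner_integral_iff)
    note this(2)
    also have "\<dots> \<le> 1 + t * (g + \<eta>)"
    proof -
      have "t * (\<delta> * g) \<le> t * (\<eta> / 2)" using \<delta> t by (intro mult_left_mono) auto
      then show ?thesis using tailsum by (simp add: algebra_simps)
    qed
    finally have FI: "integral\<^sup>L M (\<lambda>\<omega>. F (Y 1 \<omega>)) \<le> 1 + t * (g + \<eta>)" .
    have "(\<integral>\<^sup>+\<omega>. ennreal (exp (t * Y 1 \<omega>) * indicator {..<h} (Y 1 \<omega>)) \<partial>M) \<le> (\<integral>\<^sup>+\<omega>. ennreal (F (Y 1 \<omega>)) \<partial>M)"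
      by (rule nn_integral_mono_AE) (use Y1_nonneg in eventually_elim, auto intro!: ennreal_leI pw)
    also have "\<dots> = ennreal (integral\<^sup>L M (\<lambda>\<omega>. F (Y 1 \<omega>)))"
    proof (rule nn_integral_eq_integral[OF Fint])
      show "AE \<omega> in M. 0 \<le> F (Y 1 \<omega>)"
        using Y1_nonneg
      proof eventually_elim
        case (elim \<omega>)
        then show ?case using pw[OF elim] by (rule_tac order_trans[OF _ pw]) auto
      qed
    qed
    also have "\<dots> \<le> ennreal (1 + t * (g + \<eta>))" using FI by (rule ennreal_leI)
    finally show ?case by (simp add: t_def)
  qed
qed

text \<open>The mean of \<open>(1 - exp (- \<theta> * Y 1)) / \<theta>\<close> tends to \<open>g\<close> as \<open>\<theta>\<close> decreases to zero, by dominated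
convergence along \<open>\<theta> = 1 / Suc k\<close>.\<close>

lemma laplace_transform_bound:
  assumes \<eta>: "0 < \<eta>"
  shows "\<exists>\<theta>>0. \<exists>\<mu>>0. (\<integral>\<^sup>+\<omega>. ennreal (exp (- \<theta> * Y 1 \<omega>)) \<partial>M) \<le> ennreal \<mu> \<and> \<mu> \<le> 1 - \<theta> * (g - \<eta>)"
proof -
  define f where "f = (\<lambda>k \<omega>. real (Suc k) * (1 - exp (- (Y 1 \<omega> / real (Suc k)))))"
  have "(\<lambda>k. integral\<^sup>L M (f k)) \<longlonglongrightarrow> integral\<^sup>L M (Y 1)"
  proof (rule integral_dominated_convergence[where w = "Y 1"])
    show "integrable M (Y 1)" by (rule Y1_integrable)
    show "AE \<omega> in M. (\<lambda>k. f k \<omega>) \<longlonglongrightarrow> Y 1 \<omega>"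
    proof (rule AE_I2)
      fix \<omega>
      show "(\<lambda>k. f k \<omega>) \<longlonglongrightarrow> Y 1 \<omega>" unfolding f_def by real_asymp
    qed
    show "AE \<omega> in M. norm (f k \<omega>) \<le> Y 1 \<omega>" for k
      using Y1_nonneg
    proof eventually_elim
      case (elim \<omega>)
      have "1 - exp (- (Y 1 \<omega> / real (Suc k))) \<le> Y 1 \<omega> / real (Suc k)"
        using exp_ge_add_one_self[of "- (Y 1 \<omega> / real (Suc k))"] by linarith
      then have "f k \<omega> \<le> real (Suc k) * (Y 1 \<omega> / real (Suc k))"
        unfolding f_def by (intro mult_left_mono) auto
      moreover have "0 \<le> f k \<omega>" unfolding f_def using elim by (intro mult_nonneg_nonneg) auto
      ultimately show ?case by simp
    qed
  qed (auto simp: f_def)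
  then have "\<forall>\<^sub>F k in sequentially. g - \<eta> < integral\<^sup>L M (f k)"
    by (rule order_tendstoD(1)) (use \<eta> Y1_integral in auto)
  then obtain k where k: "g - \<eta> < integral\<^sup>L M (f k)" by (auto simp: eventually_sequentially)
  define \<theta> where "\<theta> = 1 / real (Suc k)"
  define \<mu> where "\<mu> = integral\<^sup>L M (\<lambda>\<omega>. exp (- \<theta> * Y 1 \<omega>))"
  have \<theta>: "0 < \<theta>" by (simp add: \<theta>_def)
  have int: "integrable M (\<lambda>\<omega>. exp (- \<theta> * Y 1 \<omega>))"
    by (rule integrable_const_bound[where B=1])
       (use Y1_nonneg in eventually_elim, use \<theta> in auto)
  have "integral\<^sup>L M (f k) = real (Suc k) * (1 - \<mu>)"
    using int by (simp add: f_def \<mu>_def \<theta>_def prob_space field_simps del: of_nat_Suc)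
  then have "g - \<eta> \<le> (1 - \<mu>) / \<theta>" using k by (simp add: \<theta>_def mult.commute)
  then have "\<mu> \<le> 1 - \<theta> * (g - \<eta>)" using \<theta> by (simp add: field_simps)
  moreover have "(\<integral>\<^sup>+\<omega>. ennreal (exp (- \<theta> * Y 1 \<omega>)) \<partial>M) \<le> ennreal \<mu>"
    unfolding \<mu>_def by (subst nn_integral_eq_integral[OF int]) auto
  moreover have "0 < \<mu>"
  proof -
    have "\<mu> \<noteq> 0"
    proof
      assume "\<mu> = 0"
      then have "AE \<omega> in M. exp (- \<theta> * Y 1 \<omega>) = 0"
        unfolding \<mu>_def using integral_nonneg_eq_0_iff_AE[OF int] by auto
      then show False using AE_False by simp
    qed
    moreover have "0 \<le> \<mu>" unfolding \<mu>_def by (intro integral_nonneg_AE) auto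
    ultimately show ?thesis by simp
  qed
  ultimately show ?thesis using \<theta> by blast
qed

end

section \<open>Large deviations of a single node\<close>

context heavy_tailed_node
begin

lemma v_sequence_dominates:
  assumes "0 < b"
  shows "\<forall>\<^sub>F n in sequentially. K * ln (real n) + D \<le> b * v (real n)"
proof -
  have "\<forall>\<^sub>F x in at_top. D \<le> b * v x - K * ln x"
    using v_dominates[OF assms, of K] unfolding filterlim_at_top by blast
  then have "\<forall>\<^sub>F n in sequentially. D \<le> b * v (real n) - K * ln (real n)"
    by (rule eventually_compose_filterlim[OF _ filterlim_real_sequentially])
  then show ?thesis by eventually_elim auto
qed

lemma v_sequence_pos: "\<forall>\<^sub>F n in sequentially. 0 < v (real n)"
  by (rule eventually_compose_filterlim[OF pos_v filterlim_real_sequentially])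

text \<open>For each of the at most \<open>n * T + 1\<close> integers \<open>k\<close>, the tail bound is used with truncation level
\<open>h = n * x\<close> and parameter \<open>(1 - e) * c * v h / h\<close>. Restricting to integer starting times costs the
constant \<open>g\<close>, which is why it is subtracted in the event.\<close>

lemma node_upper_bound:
  assumes x: "0 < x" and \<epsilon>: "0 < \<epsilon>" and T: "0 < T"
  shows "\<forall>\<^sub>F n in sequentially.
    prob {\<omega> \<in> space M. \<exists>k::nat. real k < real n * T \<and>
        g * (real n * T - real k) + real n * x - g \<le> J (real n * T) \<omega> - J (real k) \<omega>}
    \<le> exp (- v (real n) * (c * x powr \<alpha> - \<epsilon>))"
proof -
  define e where "e = min (1 / 4) (\<epsilon> / (2 * (c * (1 + 2 * x powr \<alpha>))))"
  have ex: "0 \<le> x powr \<alpha>" by simp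
  have e: "0 < e" "e < 1" "2 * e < 1" "e * (c * (1 + 2 * x powr \<alpha>)) \<le> \<epsilon> / 2"
  proof -
    have d: "0 < c * (1 + 2 * x powr \<alpha>)" using c ex by (intro mult_pos_pos add_pos_nonneg) auto
    then show "0 < e" "e < 1" "2 * e < 1" using \<epsilon> by (auto simp: e_def)
    have *: "\<epsilon> / (2 * D) * D = \<epsilon> / 2" if "0 < D" for D :: real using that by simp
    have "e * (c * (1 + 2 * x powr \<alpha>)) \<le> \<epsilon> / (2 * (c * (1 + 2 * x powr \<alpha>))) * (c * (1 + 2 * x powr \<alpha>))"
      using d by (intro mult_right_mono) (auto simp: e_def)
    also have "\<dots> = \<epsilon> / 2" by (rule *[OF d])
    finally show "e * (c * (1 + 2 * x powr \<alpha>)) \<le> \<epsilon> / 2" .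
  qed
  \<comment> \<open>With this choice the error \<open>n * T * \<theta> * \<eta>\<close> over the whole horizon is the fraction \<open>e\<close> of \<open>\<theta> * h\<close>.\<close>
  define \<eta> where "\<eta> = e * x / T"
  have \<eta>: "0 < \<eta>" using e x T by (simp add: \<eta>_def)
  define \<theta> where "\<theta> = (\<lambda>h. (1 - e) * (c * v h / h))"
  have nx: "filterlim (\<lambda>n. real n * x) at_top sequentially"
    using x by real_asymp
  have E1: "\<forall>\<^sub>F n in sequentially. (\<integral>\<^sup>+\<omega>. ennreal (exp (\<theta> (real n * x) * Y 1 \<omega>)
      * indicator {..<real n * x} (Y 1 \<omega>)) \<partial>M) \<le> ennreal (1 + \<theta> (real n * x) * (g + \<eta>))"
    using truncated_mgf[OF e(1,2) \<eta>] unfolding \<theta>_def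
    by (rule eventually_compose_filterlim[OF _ nx])
  have \<theta>0: "(\<theta> \<longlongrightarrow> 0) at_top"
    using tendsto_mult_left[OF v_over_x, of "(1 - e) * c"] by (simp add: \<theta>_def mult_ac)
  have E2: "\<forall>\<^sub>F n in sequentially. \<theta> (real n * x) < 1"
    by (rule eventually_compose_filterlim[OF order_tendstoD(2)[OF \<theta>0] nx]) auto
  have E3: "\<forall>\<^sub>F n in sequentially. 0 < v (real n * x)"
    by (rule eventually_compose_filterlim[OF pos_v nx])
  have E4: "\<forall>\<^sub>F n in sequentially. 2 * ln (real n * T + 1) + g \<le> \<epsilon> / 2 * v (real n)"
  proof -
    have "filterlim (\<lambda>n. 3 * ln (real n) - 2 * ln (real n * T + 1) - g) at_top sequentially"
      using T by real_asymp
    then have "\<forall>\<^sub>F n in sequentially. 0 \<le> 3 * ln (real n) - 2 * ln (real n * T + 1) - g"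
      unfolding filterlim_at_top by blast
    moreover have "\<forall>\<^sub>F n in sequentially. 3 * ln (real n) + 0 \<le> \<epsilon> / 2 * v (real n)"
      by (rule v_sequence_dominates) (use \<epsilon> in auto)
    ultimately show ?thesis by eventually_elim auto
  qed
  show ?thesis
    using E1 E2 E3 E4 v_scaled[OF x e(1)] v_sequence_pos eventually_gt_at_top[of 0]
  proof eventually_elim
    case (elim n)
    define h where "h = real n * x"
    define p where "p = prob {\<omega> \<in> space M. h \<le> Y 1 \<omega>}"
    have h: "0 < h" using x elim by (simp add: h_def)
    have p: "p = exp (- (c * v h))" unfolding p_def by (rule tail) (use h in auto)
    define t where "t = \<theta> h"
    have t: "0 < t" "t < 1" using elim e c h by (auto simp: t_def \<theta>_def h_def)
    have th: "t * h = (1 - e) * c * v h" using h by (simp add: t_def \<theta>_def)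
    define Q where "Q = exp (g - (1 - 2 * e) * (c * v h))"
    have cv: "0 < c * v h" using c elim by (auto simp: h_def)
    define S where "S = real n * T"
    have S: "0 < S" using T elim by (simp add: S_def)
    define Ev where "Ev = (\<lambda>k. {\<omega> \<in> space M. g * (S - real k) + h - g \<le> J S \<omega> - J (real k) \<omega>})"
    have pk: "prob (Ev k) \<le> (S + 1) * Q" if k: "real k < S" for k
    proof -
      have "prob (Ev k) \<le> (S - real k) * p
          + exp (- t * (g * (S - real k) + h - g) + (S - real k) * ((1 + t * (g + \<eta>)) - 1))"
        unfolding p_def Ev_def
      proof (rule increment_upper_tail)
        show "(\<integral>\<^sup>+\<omega>. ennreal (exp (t * Y 1 \<omega>) * indicator {..<h} (Y 1 \<omega>)) \<partial>M) \<le> ennreal (1 + t * (g + \<eta>))"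
          using elim by (simp add: t_def h_def)
      qed (use k t g_nonneg \<eta> in auto)
      also have "\<dots> \<le> S * Q + Q"
      proof (intro add_mono mult_mono)
        have "- (c * v h) \<le> g - (1 - 2 * e) * (c * v h)"
          using g_nonneg mult_pos_pos[OF e(1) cv] by (simp add: algebra_simps)
        then show "p \<le> Q" by (simp add: p Q_def)
        have "- t * (g * (S - real k) + h - g) + (S - real k) * ((1 + t * (g + \<eta>)) - 1)
            = - (t * h) + t * g + (S - real k) * (t * \<eta>)" by (simp add: algebra_simps)
        also have "\<dots> \<le> - (t * h) + 1 * g + S * (t * \<eta>)"
          using t g_nonneg \<eta> S by (intro add_mono mult_right_mono) auto
        also have "S * (t * \<eta>) = e * (t * h)"
          using T by (simp add: S_def \<eta>_def h_def)
        also have "- (t * h) + 1 * g + e * (t * h) = g - (1 - e) * (1 - e) * (c * v h)"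
          unfolding th by (simp add: algebra_simps)
        also have "\<dots> \<le> g - (1 - 2 * e) * (c * v h)"
        proof -
          have "(1 - 2 * e) * (c * v h) \<le> (1 - e) * (1 - e) * (c * v h)"
            by (rule mult_right_mono) (use cv in \<open>auto simp: algebra_simps\<close>)
          then show ?thesis by simp
        qed
        finally show "exp (- t * (g * (S - real k) + h - g) + (S - real k) * ((1 + t * (g + \<eta>)) - 1)) \<le> Q"
          by (simp add: Q_def)
      qed (use S in \<open>auto simp: Q_def p\<close>)
      finally show ?thesis by (simp add: algebra_simps)
    qed
    define D where "D = {k::nat. real k < S}"
    have Dsub: "D \<subseteq> {..<nat \<lceil>S\<rceil>}" by (auto simp: D_def) linarith
    have Dfin: "finite D" by (rule finite_subset[OF Dsub]) auto
    have Dcard: "real (card D) \<le> S + 1"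
    proof -
      have "card D \<le> nat \<lceil>S\<rceil>" using card_mono[OF _ Dsub] by simp
      then show ?thesis using S by linarith
    qed
    have [measurable]: "J S \<in> borel_measurable M" "J (real k) \<in> borel_measurable M" for k :: nat
      using S by (auto intro: J_measurable)
    have Evm: "Ev k \<in> events" for k unfolding Ev_def by measurable
    have "{\<omega> \<in> space M. \<exists>k::nat. real k < real n * T \<and>
        g * (real n * T - real k) + real n * x - g \<le> J (real n * T) \<omega> - J (real k) \<omega>} = (\<Union>k\<in>D. Ev k)"
      by (auto simp: D_def Ev_def S_def h_def)
    moreover have "prob (\<Union>k\<in>D. Ev k) \<le> (\<Sum>k\<in>D. prob (Ev k))"
      using Dfin Evm by (intro finite_measure_subadditive_finite) auto
    moreover have "(\<Sum>k\<in>D. prob (Ev k)) \<le> (\<Sum>k\<in>D. (S + 1) * Q)"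
      by (intro sum_mono pk) (auto simp: D_def)
    moreover have "(\<Sum>k\<in>D. (S + 1) * Q) \<le> (S + 1) * ((S + 1) * Q)"
      using Dcard S by (auto simp: Q_def intro!: mult_right_mono)
    moreover have "(S + 1) * ((S + 1) * Q) \<le> exp (- v (real n) * (c * x powr \<alpha> - \<epsilon>))"
    proof -
      have "(S + 1) * ((S + 1) * Q) = exp (2 * ln (S + 1) + g - (1 - 2 * e) * (c * v h))"
      proof -
        have "exp (2 * ln (S + 1)) = (S + 1) * (S + 1)"
          using S by (simp add: exp_double power2_eq_square)
        then have "(S + 1) * ((S + 1) * Q) = exp (2 * ln (S + 1)) * exp (g - (1 - 2 * e) * (c * v h))"
          unfolding Q_def by simp
        also have "\<dots> = exp (2 * ln (S + 1) + (g - (1 - 2 * e) * (c * v h)))" by (rule exp_add[symmetric])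
        finally show ?thesis by (simp only: add_diff_eq)
      qed
      also have "\<dots> \<le> exp (- v (real n) * (c * x powr \<alpha> - \<epsilon>))"
      proof -
        have vn: "0 < v (real n)" using elim by simp
        have vh: "v (real n) * (x powr \<alpha> - e) \<le> v h"
          using elim by (auto simp: h_def algebra_simps abs_le_iff)
        have "(c * x powr \<alpha> - \<epsilon> / 2) \<le> (1 - 2 * e) * (c * (x powr \<alpha> - e))"
        proof -
          have "0 \<le> c * e * e * 2" using c e by auto
          then show ?thesis using e(4) by (simp add: algebra_simps)
        qed
        then have "(c * x powr \<alpha> - \<epsilon> / 2) * v (real n) \<le> (1 - 2 * e) * (c * (x powr \<alpha> - e)) * v (real n)"
          using vn by (intro mult_right_mono) auto
        also have "\<dots> = (1 - 2 * e) * (c * (v (real n) * (x powr \<alpha> - e)))" by simp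
        also have "\<dots> \<le> (1 - 2 * e) * (c * v h)"
          using vh c e by (intro mult_left_mono) auto
        finally show ?thesis using elim by (simp add: S_def algebra_simps)
      qed
      finally show ?thesis .
    qed
    ultimately show ?case by simp
  qed
qed

text \<open>If there is a jump during \<open>{s<..s + 1}\<close> and the first jump after \<open>s\<close> is at least \<open>n * a\<close> (event \<open>F\<close>), then
the desired lower bound on the input can fail at \<open>j\<close> only if the jumps after the first one sum to at
most \<open>g * j - n * \<epsilon>\<close> (event \<open>G j\<close>). The event \<open>F\<close> has probability at least one half of the tail at
\<open>n * a\<close>, while the Laplace transform makes all the \<open>G j\<close> together negligible relative to this tail.
Only the law of the increments of the Poisson process enters, so that the bound is uniform in \<open>s\<close>.\<close>

lemma node_lower_bound:
  assumes a: "0 < a" and \<epsilon>: "0 < \<epsilon>" and \<eta>: "0 < \<eta>" and T: "0 < T"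
  shows "\<forall>\<^sub>F n in sequentially. \<forall>s\<ge>0. \<forall>m. real m \<le> real n * T \<longrightarrow>
    exp (- v (real n) * (c * a powr \<alpha> + \<eta>))
    \<le> prob {\<omega> \<in> space M. \<forall>j\<in>{1..m}. real n * a + g * real j - real n * \<epsilon> \<le> J (s + real j) \<omega> - J s \<omega>}"
proof -
  define \<eta>' where "\<eta>' = \<epsilon> / (2 * T)"
  have \<eta>': "0 < \<eta>'" using \<epsilon> T by (simp add: \<eta>'_def)
  obtain \<theta> \<mu> where \<theta>: "0 < \<theta>" and \<mu>: "0 < \<mu>" "\<mu> \<le> 1 - \<theta> * (g - \<eta>')"
    and mgf: "(\<integral>\<^sup>+\<omega>. ennreal (exp (- \<theta> * Y 1 \<omega>)) \<partial>M) \<le> ennreal \<mu>"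
    using laplace_transform_bound[OF \<eta>'] by blast
  have "(\<lambda>n. real n * T * (1 / \<mu> * exp (- \<theta> * real n * \<epsilon> / 2))) \<longlonglongrightarrow> 0"
    using \<theta> \<epsilon> by real_asymp
  then have E1: "\<forall>\<^sub>F n in sequentially. real n * T * (1 / \<mu> * exp (- \<theta> * real n * \<epsilon> / 2)) < 1 / 4"
    by (rule order_tendstoD) auto
  have E2: "\<forall>\<^sub>F n in sequentially. 0 * ln (real n) + ln 4 \<le> \<eta> / 2 * v (real n)"
    by (rule v_sequence_dominates) (use \<eta> in auto)
  have "0 < \<eta> / (2 * c)" using \<eta> c by auto
  from E1 E2 v_scaled[OF a this] show ?thesis
  proof eventually_elim
    case (elim n)
    show ?case
    proof (intro allI impI)
      fix s :: real and m :: nat assume s: "0 \<le> s" and m: "real m \<le> real n * T"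
      define p where "p = prob {\<omega> \<in> space M. real n * a \<le> Y 1 \<omega>}"
      have p: "p = exp (- (c * v (real n * a)))" unfolding p_def by (rule tail) (use a in auto)
      define B0 where "B0 = (\<lambda>k K::nat. if K = 0 then {} else {\<omega> \<in> space M. real n * a \<le> Y (k + 1) \<omega>})"
      have B0m: "B0 k K \<in> sets jump_algebra" for k K
      proof -
        have [measurable]: "Y (k + 1) \<in> borel_measurable jump_algebra" by (intro Y_jump_algebra) auto
        have "{\<omega> \<in> space jump_algebra. real n * a \<le> Y (k + 1) \<omega>} \<in> sets jump_algebra" by measurable
        then show ?thesis by (simp add: B0_def)
      qed
      define F where "F = {\<omega> \<in> space M. \<omega> \<in> B0 (N s \<omega>) (N (s + 1) \<omega> - N s \<omega>)}"
      have "prob F = exp (- (s + 1 - s)) * (p * (exp 1 - 1))"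
        unfolding F_def
      proof (rule prob_mixture_eq[OF s _ B0m, where g = "\<lambda>K. if K = 0 then 0 else p"])
        show "prob (B0 k K) = (if K = 0 then 0 else p)" for k K
          using prob_jump_eq[of "k + 1" "{real n * a..}"] by (simp add: B0_def p_def)
        have "(\<lambda>K. p * (1 ^ K / fact K - (if K = 0 then 1 else 0))) sums (p * (exp 1 - (1::real)))"
          by (intro sums_mult sums_diff exp_series sums_single[of 0 "\<lambda>_. 1", simplified])
        then show "(\<lambda>K. (if K = 0 then 0 else p) * ((s + 1 - s) ^ K / fact K)) sums (p * (exp 1 - 1))"
          by (rule back_subst[of "\<lambda>f. f sums _"]) (auto simp: fun_eq_iff)
      qed auto
      then have "prob F = p * (1 - exp (- 1))"
        by (simp add: exp_minus field_simps)
      moreover have "exp (- 1) \<le> (1 / 2 :: real)"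
        using exp_ge_add_one_self[of 1] by (simp add: exp_minus field_simps)
      ultimately have F: "p / 2 \<le> prob F"
        by (simp add: p mult_left_mono[of "1/2" "1 - exp (-1)" p])
      define B where "B = (\<lambda>(j::nat) k (K::nat). if K = 0 then {} else
          {\<omega> \<in> space M. real n * a \<le> Y (k + 1) \<omega> \<and> (\<Sum>i\<in>{k + 2..k + K}. Y i \<omega>) \<le> g * j - real n * \<epsilon>})"
      have Bm: "B j k K \<in> sets jump_algebra" for j k K
      proof -
        have [measurable]: "Y (k + 1) \<in> borel_measurable jump_algebra" by (intro Y_jump_algebra) auto
        have [measurable]: "Y i \<in> borel_measurable jump_algebra" if "i \<in> {k + 2..k + K}" for i
          using that by (intro Y_jump_algebra) auto
        have "{\<omega> \<in> space jump_algebra. real n * a \<le> Y (k + 1) \<omega> \<and> (\<Sum>i\<in>{k + 2..k + K}. Y i \<omega>) \<le> g * j - real n * \<epsilon>} \<in> sets jump_algebra"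
          by measurable
        then show ?thesis by (simp add: B_def)
      qed
      define G where "G = (\<lambda>j. {\<omega> \<in> space M. \<omega> \<in> B j (N s \<omega>) (N (s + real j) \<omega> - N s \<omega>)})"
      have Gp: "prob (G j) \<le> p * (1 / \<mu> * exp (- \<theta> * real n * \<epsilon> / 2))" if j: "j \<in> {1..m}" for j
      proof -
        define q where "q = p * exp (\<theta> * (g * j - real n * \<epsilon>)) / \<mu>"
        have q: "0 \<le> q" using \<mu> by (simp add: q_def p)
        have "prob (G j) \<le> exp (- (s + real j - s)) * (q * exp (\<mu> * real j))"
          unfolding G_def
        proof (rule prob_mixture_le[OF s _ Bm, where g = "\<lambda>K. q * \<mu> ^ K"])
          show "prob (B j k K) \<le> q * \<mu> ^ K" for k K
          proof (cases K)
            case 0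
            then show ?thesis using q by (simp add: B_def)
          next
            case (Suc K')
            have "B j k K = {\<omega> \<in> space M. real n * a \<le> Y (k + 1) \<omega> \<and> (\<Sum>i\<in>{k + 2..k + K}. Y i \<omega>) \<le> g * j - real n * \<epsilon>}"
              using Suc by (simp only: B_def) simp
            moreover have "prob {\<omega> \<in> space M. real n * a \<le> Y (k + 1) \<omega> \<and> (\<Sum>i\<in>{k + 2..k + K}. Y i \<omega>) \<le> g * j - real n * \<epsilon>}
                \<le> p * (exp (\<theta> * (g * j - real n * \<epsilon>)) * \<mu> ^ card {k + 2..k + K})"
              unfolding p_def
              by (rule jump_sum_lower_tail[OF _ _ _ _ less_imp_le[OF \<theta>] less_imp_le[OF \<mu>(1)] mgf]) auto
            ultimately have "prob (B j k K) \<le> p * (exp (\<theta> * (g * j - real n * \<epsilon>)) * \<mu> ^ card {k + 2..k + K})"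
              by (simp only:)
            also have "card {k + 2..k + K} = K'" using Suc by simp
            finally show ?thesis using \<mu> Suc by (simp add: q_def)
          qed
          have "(\<lambda>K. q * ((\<mu> * real j) ^ K / fact K)) sums (q * exp (\<mu> * real j))"
            by (intro sums_mult exp_series)
          then show "(\<lambda>K. q * \<mu> ^ K * ((s + real j - s) ^ K / fact K)) sums (q * exp (\<mu> * real j))"
            by (simp add: power_mult_distrib mult_ac)
        qed (use j in auto)
        also have "\<dots> = p * (1 / \<mu> * exp (\<theta> * (g * j - real n * \<epsilon>) + real j * (\<mu> - 1)))"
          by (simp add: q_def exp_add[symmetric] algebra_simps)
        also have "\<dots> \<le> p * (1 / \<mu> * exp (- \<theta> * real n * \<epsilon> / 2))"
        proof -
          have "real j * (\<mu> - 1) \<le> real j * (- \<theta> * (g - \<eta>'))" using \<mu> by (intro mult_left_mono) auto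
          moreover have "real j * (\<theta> * \<eta>') \<le> real n * T * (\<theta> * \<eta>')"
            using j m \<theta> \<eta>' by (intro mult_right_mono) auto
          moreover have "real n * T * (\<theta> * \<eta>') = \<theta> * real n * \<epsilon> / 2" using T unfolding \<eta>'_def by simp
          moreover have "\<theta> * (g * j - real n * \<epsilon>) + real j * (- \<theta> * (g - \<eta>'))
              = real j * (\<theta> * \<eta>') - \<theta> * real n * \<epsilon>" by (simp add: algebra_simps)
          ultimately have "\<theta> * (g * j - real n * \<epsilon>) + real j * (\<mu> - 1) \<le> - \<theta> * real n * \<epsilon> / 2"
            by linarith
          then show ?thesis using \<mu> by (intro mult_left_mono) (auto simp: p)
        qed
        finally show ?thesis .
      qed
      define E where "E = {\<omega> \<in> space M. \<forall>j\<in>{1..m}. real n * a + g * real j - real n * \<epsilon> \<le> J (s + real j) \<omega> - J s \<omega>}"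
      have mix: "{\<omega> \<in> space M. \<omega> \<in> B' (N s \<omega>) (N u \<omega> - N s \<omega>)} \<in> events"
        if B': "\<And>k K. B' k K \<in> sets jump_algebra" and u: "s \<le> u" for B' u
      proof -
        have [measurable]: "B' k K \<in> events" for k K using indep_counts_jumps(1)[OF s u B'] .
        have [measurable]: "N s \<in> measurable M (count_space UNIV)" "N u \<in> measurable M (count_space UNIV)"
          using s u by auto
        have "{\<omega> \<in> space M. \<omega> \<in> B' (N s \<omega>) (N u \<omega> - N s \<omega>)}
          = (\<Union>k. \<Union>K. {\<omega> \<in> space M. N s \<omega> = k \<and> N u \<omega> - N s \<omega> = K} \<inter> B' k K)" by auto
        also have "\<dots> \<in> events" by measurable
        finally show ?thesis .
      qed
      have Fm: "F \<in> events" unfolding F_def using B0m by (intro mix) auto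
      have Gm: "G j \<in> events" for j unfolding G_def using Bm by (intro mix) auto
      have [measurable]: "J s \<in> borel_measurable M" "J (s + real j) \<in> borel_measurable M" for j
        using s by (auto intro: J_measurable)
      have Em: "E \<in> events" unfolding E_def by measurable
      have "F \<subseteq> E \<union> (\<Union>j\<in>{1..m}. G j)"
      proof
        fix \<omega> assume "\<omega> \<in> F"
        then have w: "\<omega> \<in> space M" "N s \<omega> < N (s + 1) \<omega>" "real n * a \<le> Y (N s \<omega> + 1) \<omega>"
          by (auto simp: F_def B0_def split: if_splits)
        show "\<omega> \<in> E \<union> (\<Union>j\<in>{1..m}. G j)"
        proof (rule ccontr)
          assume n: "\<omega> \<notin> E \<union> (\<Union>j\<in>{1..m}. G j)"
          then obtain j where j: "j \<in> {1..m}"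
            "J (s + real j) \<omega> - J s \<omega> < real n * a + g * real j - real n * \<epsilon>"
            using w by (auto simp: E_def not_le)
          define K where "K = N (s + real j) \<omega> - N s \<omega>"
          have "N (s + 1) \<omega> \<le> N (s + real j) \<omega>" using N_mono[OF w(1)] s j by auto
          then have K: "0 < K" using w by (simp add: K_def)
          have "\<omega> \<notin> G j" using n j by auto
          then have "\<omega> \<notin> B j (N s \<omega>) K" using w by (simp add: G_def K_def)
          then have "g * j - real n * \<epsilon> < (\<Sum>i\<in>{N s \<omega> + 2..N s \<omega> + K}. Y i \<omega>)"
            using w K by (simp add: B_def not_le)
          moreover have "J (s + real j) \<omega> - J s \<omega> = Y (N s \<omega> + 1) \<omega> + (\<Sum>i\<in>{N s \<omega> + 2..N s \<omega> + K}. Y i \<omega>)"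
            using K s w by (subst J_increment) (auto simp: K_def[symmetric] sum.atLeast_Suc_atMost)
          ultimately show False using j w by simp
        qed
      qed
      then have "prob F \<le> prob (E \<union> (\<Union>j\<in>{1..m}. G j))"
        using Em Gm by (intro finite_measure_mono) auto
      also have "\<dots> \<le> prob E + prob (\<Union>j\<in>{1..m}. G j)" using Em Gm by (intro measure_Un_le) auto
      also have "prob (\<Union>j\<in>{1..m}. G j) \<le> (\<Sum>j\<in>{1..m}. prob (G j))"
        using Gm by (intro finite_measure_subadditive_finite) auto
      also have "\<dots> \<le> (\<Sum>j\<in>{1..m}. p * (1 / \<mu> * exp (- \<theta> * real n * \<epsilon> / 2)))"
        by (intro sum_mono Gp)
      also have "\<dots> = real m * (p * (1 / \<mu> * exp (- \<theta> * real n * \<epsilon> / 2)))" by simp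
      also have "\<dots> \<le> (real n * T) * (p * (1 / \<mu> * exp (- \<theta> * real n * \<epsilon> / 2)))"
        using m \<mu> by (intro mult_right_mono) (auto simp: p)
      also have "\<dots> = p * (real n * T * (1 / \<mu> * exp (- \<theta> * real n * \<epsilon> / 2)))" by simp
      also have "\<dots> \<le> p * (1 / 4)" using elim by (intro mult_left_mono) (auto simp: p)
      finally have "p / 4 \<le> prob E" using F by simp
      moreover have "exp (- v (real n) * (c * a powr \<alpha> + \<eta>)) \<le> p / 4"
      proof -
        have "v (real n * a) \<le> v (real n) * a powr \<alpha> + \<eta> / (2 * c) * v (real n)"
          using elim by (simp add: abs_le_iff)
        then have "c * v (real n * a) \<le> c * (v (real n) * a powr \<alpha> + \<eta> / (2 * c) * v (real n))"
          using c by (intro mult_left_mono) auto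
        also have "\<dots> = v (real n) * (c * a powr \<alpha>) + \<eta> / 2 * v (real n)"
          using c by (simp add: algebra_simps)
        finally have "- v (real n) * (c * a powr \<alpha> + \<eta>) \<le> - (c * v (real n * a)) - ln 4"
          using elim by (simp add: algebra_simps)
        then have "exp (- v (real n) * (c * a powr \<alpha> + \<eta>)) \<le> exp (- (c * v (real n * a)) - ln 4)" by simp
        then show ?thesis by (simp add: p exp_diff)
      qed
      ultimately show "exp (- v (real n) * (c * a powr \<alpha> + \<eta>)) \<le> prob E" by simp
    qed
  qed
qed

end

section \<open>Paths, measurability and events of a single node\<close>

lemma run_sup_rational:
  fixes f :: "real \<Rightarrow> real"
  assumes bnd: "\<forall>s\<in>{0..T}. f s \<le> B" and t: "0 \<le> t" "t \<le> T"
    and rc: "\<And>s. s \<in> {0..<T} \<Longrightarrow> (f \<longlongrightarrow> f s) (at_right s)"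
  shows "run_sup f t = (SUP s\<in>insert t ({0..t} \<inter> \<rat>). f s)"
proof (rule antisym)
  let ?D = "insert t ({0..t} \<inter> \<rat>)"
  have bdd: "bdd_above (f ` ?D)"
    by (rule bdd_above_mono[OF bdd_above_run_sup[OF bnd t(2)]]) (use t in auto)
  show "(SUP s\<in>?D. f s) \<le> run_sup f t"
    by (rule cSUP_least) (use run_sup_upper[OF bnd t(2)] t in auto)
  show "run_sup f t \<le> (SUP s\<in>?D. f s)"
  proof (rule run_sup_least[OF t(1)])
    fix s assume s: "0 \<le> s" "s \<le> t"
    show "f s \<le> (SUP s\<in>?D. f s)"
    proof (cases "s = t")
      case True
      then show ?thesis by (intro cSUP_upper bdd) auto
    next
      case False
      then have st: "s < t" using s by auto
      have rcs: "(f \<longlongrightarrow> f s) (at_right s)" using rc[of s] s st t by auto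
      show ?thesis
      proof (rule ccontr)
        assume "\<not> f s \<le> (SUP s\<in>?D. f s)"
        then have "\<forall>\<^sub>F u in at_right s. (SUP s\<in>?D. f s) < f u"
          by (intro order_tendstoD[OF rcs]) auto
        then obtain d where d: "s < d" "\<And>u. s < u \<Longrightarrow> u < d \<Longrightarrow> (SUP s\<in>?D. f s) < f u"
          by (auto simp: eventually_at_right_field)
        obtain q where q: "q \<in> \<rat>" "s < q" "q < min d t"
          using Rats_dense_in_real[of s "min d t"] d st by auto
        then have "f q \<le> (SUP s\<in>?D. f s)" using s by (intro cSUP_upper bdd) auto
        then show False using d(2)[of q] q by auto
      qed
    qed
  qed
qed

lemma run_sup_measurable:
  fixes f :: "real \<Rightarrow> 'w \<Rightarrow> real"
  assumes bnd: "\<And>\<omega>. \<omega> \<in> space M \<Longrightarrow> \<forall>s\<in>{0..T}. f s \<omega> \<le> B \<omega>" and t: "0 \<le> t" "t \<le> T"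
    and rc: "\<And>\<omega> s. \<omega> \<in> space M \<Longrightarrow> s \<in> {0..<T} \<Longrightarrow> ((\<lambda>s. f s \<omega>) \<longlongrightarrow> f s \<omega>) (at_right s)"
    and meas: "\<And>s. s \<in> {0..T} \<Longrightarrow> f s \<in> borel_measurable M"
  shows "(\<lambda>\<omega>. run_sup (\<lambda>s. f s \<omega>) t) \<in> borel_measurable M"
proof -
  let ?D = "insert t ({0..t} \<inter> \<rat>)"
  have "(\<lambda>\<omega>. SUP s\<in>?D. f s \<omega>) \<in> borel_measurable M"
  proof (rule borel_measurable_cSUP)
    show "countable ?D" using countable_rat by (auto intro: countable_Int2)
    show "bdd_above ((\<lambda>s. f s \<omega>) ` ?D)" if "\<omega> \<in> space M" for \<omega>
      by (rule bdd_above_mono[OF bdd_above_run_sup[OF bnd[OF that] t(2)]]) (use t in auto)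
  qed (use meas t in auto)
  also have "(\<lambda>\<omega>. SUP s\<in>?D. f s \<omega>) \<in> borel_measurable M
      \<longleftrightarrow> (\<lambda>\<omega>. run_sup (\<lambda>s. f s \<omega>) t) \<in> borel_measurable M"
    by (intro measurable_cong run_sup_rational[OF bnd t rc, symmetric])
  finally show ?thesis .
qed

context compound_poisson_space
begin

lemma J_0: "\<omega> \<in> space M \<Longrightarrow> J 0 \<omega> = 0"
  by (simp add: compound_poisson_def N_0)

lemma J_right:
  assumes "\<omega> \<in> space M" "0 \<le> t"
  shows "((\<lambda>s. J s \<omega>) \<longlongrightarrow> J t \<omega>) (at_right t)"
proof (rule tendsto_eventually)
  have "\<forall>\<^sub>F s in at_right t. N s \<omega> = N t \<omega>"
    using N_right[OF assms] by (simp add: tendsto_discrete)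
  then show "\<forall>\<^sub>F s in at_right t. J s \<omega> = J t \<omega>"
    by eventually_elim (simp add: compound_poisson_def)
qed

lemma J_bounded:
  assumes "\<omega> \<in> space M" "0 \<le> s" "s \<le> t"
  shows "\<bar>J s \<omega>\<bar> \<le> (\<Sum>j = 1..N t \<omega>. \<bar>Y j \<omega>\<bar>)"
proof -
  have "\<bar>J s \<omega>\<bar> \<le> (\<Sum>j = 1..N s \<omega>. \<bar>Y j \<omega>\<bar>)"
    unfolding compound_poisson_def by (rule sum_abs)
  also have "\<dots> \<le> (\<Sum>j = 1..N t \<omega>. \<bar>Y j \<omega>\<bar>)"
    using N_mono[OF assms] by (intro sum_mono2) auto
  finally show ?thesis .
qed

lemma J_scaled_right:
  assumes "\<omega> \<in> space M" "0 \<le> t" "0 < n"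
  shows "((\<lambda>s. J (n * s) \<omega>) \<longlongrightarrow> J (n * t) \<omega>) (at_right t)"
  by (rule filterlim_compose[OF J_right[OF assms(1), of "n * t"]])
     (use assms in \<open>auto intro!: filterlim_times_pos[where p = t] filterlim_ident\<close>)

lemma J_mono: "AE \<omega> in M. \<forall>s t. 0 \<le> s \<longrightarrow> s \<le> t \<longrightarrow> J s \<omega> \<le> J t \<omega>"
proof -
  have "AE \<omega> in M. \<omega> \<in> space M \<and> (\<forall>j\<ge>1. 0 \<le> Y j \<omega>)" using Y_nonneg by auto
  then show ?thesis
  proof eventually_elim
    case (elim \<omega>)
    show ?case
    proof (intro allI impI)
      fix s t :: real assume "0 \<le> s" "s \<le> t"
      then have "0 \<le> J t \<omega> - J s \<omega>"
        using elim by (subst J_increment) (auto intro!: sum_nonneg)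
      then show "J s \<omega> \<le> J t \<omega>" by simp
    qed
  qed
qed

text \<open>The independence of the two nodes concerns their cumulative inputs and not their Poisson processes and
jumps. All events used for both nodes together therefore have to belong to this \<open>\<sigma>\<close>-algebra.\<close>

definition input_algebra :: "'a measure" where
  "input_algebra = vimage_algebra (space M) (\<lambda>\<omega>. \<lambda>t\<in>{0..}. J t \<omega>) (Pi\<^sub>M {0..} (\<lambda>_. borel))"

lemma space_input_algebra [simp]: "space input_algebra = space M"
  by (simp add: input_algebra_def)

lemma J_input_algebra: "0 \<le> t \<Longrightarrow> J t \<in> borel_measurable input_algebra"
proof -
  assume t: "0 \<le> t"
  have "(\<lambda>\<omega>. \<lambda>t\<in>{0..}. J t \<omega>) \<in> measurable input_algebra (Pi\<^sub>M {0..} (\<lambda>_. borel))"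
    unfolding input_algebra_def by (rule measurable_vimage_algebra1) (auto simp: space_PiM)
  then have "(\<lambda>\<omega>. (\<lambda>t\<in>{0..}. J t \<omega>) t) \<in> borel_measurable input_algebra"
    by (rule measurable_compose) (use t in \<open>auto intro: measurable_component_singleton\<close>)
  then show ?thesis using t by simp
qed

end

context heavy_tailed_node
begin

text \<open>For \<open>x \<le> 0\<close> the event is trivial, so that the bound below holds for the positive part of \<open>x\<close> without
case distinctions when a level is shared between the nodes.\<close>

definition excess :: "real \<Rightarrow> nat \<Rightarrow> real \<Rightarrow> 'a set" where
  "excess T n x = (if x \<le> 0 then space M else
    {\<omega> \<in> space M. \<exists>k::nat. real k < real n * T \<and>
        g * (real n * T - real k) + real n * x - g \<le> J (real n * T) \<omega> - J (real k) \<omega>})"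

lemma excess_sets:
  assumes "0 < T"
  shows "excess T n x \<in> sets input_algebra"
proof -
  have [measurable]: "J (real n * T) \<in> borel_measurable input_algebra"
      "J (real k) \<in> borel_measurable input_algebra" for k :: nat
    using assms by (auto intro: J_input_algebra)
  have "{\<omega> \<in> space input_algebra. \<exists>k::nat. real k < real n * T \<and>
        g * (real n * T - real k) + real n * x - g \<le> J (real n * T) \<omega> - J (real k) \<omega>} \<in> sets input_algebra"
    by measurable
  moreover have "space M \<in> sets input_algebra" using sets.top[of input_algebra] by simp
  ultimately show ?thesis by (simp add: excess_def)
qed

lemma excess_bound:
  assumes "0 < \<epsilon>" "0 < T"
  shows "\<forall>\<^sub>F n in sequentially. prob (excess T n x) \<le> exp (- v (real n) * (c * (max 0 x) powr \<alpha> - \<epsilon>))"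
proof (cases "x \<le> 0")
  case True
  show ?thesis
    using v_sequence_pos by eventually_elim (use True assms in \<open>simp add: excess_def prob_space\<close>)
next
  case False
  then show ?thesis using node_upper_bound[of x \<epsilon> T] assms by (simp add: excess_def max_def)
qed

text \<open>The final interval starting at \<open>n * u\<close> is contained in the one starting at the integer \<open>k\<close> below
\<open>n * u\<close>. The latter is longer by less than 1, which the constant \<open>g\<close> compensates.\<close>

lemma not_excess:
  assumes \<omega>: "\<omega> \<in> space M" "\<forall>s t. 0 \<le> s \<longrightarrow> s \<le> t \<longrightarrow> J s \<omega> \<le> J t \<omega>"
    and x: "\<omega> \<notin> excess T n x" and u: "u \<in> {0..<T}" and n: "0 < n"
  shows "J (real n * T) \<omega> / real n - J (real n * u) \<omega> / real n \<le> g * (T - u) + x"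
proof -
  define k where "k = nat \<lfloor>real n * u\<rfloor>"
  have k: "real k \<le> real n * u" "real n * u < real k + 1" using u n by (auto simp: k_def)
  moreover have "real n * u < real n * T" using u n by simp
  ultimately have "J (real n * T) \<omega> - J (real k) \<omega> < g * (real n * T - real k) + real n * x - g"
    using x \<omega>(1) unfolding excess_def by (auto simp: not_le split: if_splits)
  moreover have "J (real k) \<omega> \<le> J (real n * u) \<omega>" using \<omega> k by auto
  moreover have "g * (real n * u) \<le> g * (real k + 1)" using k g_nonneg by (intro mult_left_mono) auto
  ultimately have "J (real n * T) \<omega> - J (real n * u) \<omega> \<le> real n * (g * (T - u) + x)"
    by (simp add: algebra_simps)
  then show ?thesis using n by (simp add: field_simps)
qed

text \<open>The input scenario that fills up a node: after time \<open>s\<close> a big jump, followed by input at no less than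
the mean rate up to \<open>n * \<epsilon>\<close>. It is expressed by the cumulative input only, unlike the proof of its lower
bound.\<close>

definition surge :: "nat \<Rightarrow> nat \<Rightarrow> real \<Rightarrow> real \<Rightarrow> real \<Rightarrow> 'a set" where
  "surge n m s a \<epsilon> =
    {\<omega> \<in> space M. \<forall>j\<in>{1..m}. real n * a + g * real j - real n * \<epsilon> \<le> J (s + real j) \<omega> - J s \<omega>}"

lemma surge_sets:
  assumes "0 \<le> s"
  shows "surge n m s a \<epsilon> \<in> sets input_algebra"
proof -
  have "{\<omega> \<in> space input_algebra. \<forall>j\<in>{1..m}. real n * a + g * real j - real n * \<epsilon> \<le> J (s + real j) \<omega> - J s \<omega>} \<in> sets input_algebra"
  proof (rule sets.sets_Collect_finite_All)
    fix j :: nat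
    have "(\<lambda>\<omega>. J (s + real j) \<omega> - J s \<omega>) \<in> borel_measurable input_algebra"
      using assms by (intro borel_measurable_diff J_input_algebra) simp_all
    then show "{\<omega> \<in> space input_algebra. real n * a + g * real j - real n * \<epsilon> \<le> J (s + real j) \<omega> - J s \<omega>}
        \<in> sets input_algebra"
      by (rule borel_measurable_le[OF borel_measurable_const])
  qed simp
  then show ?thesis unfolding surge_def space_input_algebra .
qed

end

section \<open>Large deviations of the network\<close>

lemma log_asymptotics:
  fixes P V :: "nat \<Rightarrow> real"
  assumes V: "\<forall>\<^sub>F n in sequentially. 0 < V n"
    and up: "\<And>\<epsilon>. 0 < \<epsilon> \<Longrightarrow> \<forall>\<^sub>F n in sequentially. P n \<le> exp (- V n * (I - \<epsilon>))"
    and lo: "\<And>\<epsilon>. 0 < \<epsilon> \<Longrightarrow> \<forall>\<^sub>F n in sequentially. exp (- V n * (I + \<epsilon>)) \<le> P n"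
  shows "(\<lambda>n. 1 / V n * ln (P n)) \<longlonglongrightarrow> - I"
proof (rule tendstoI)
  fix e :: real assume e: "0 < e"
  then have "0 < e / 2" by simp
  from up[OF this] lo[OF this] V
  show "\<forall>\<^sub>F n in sequentially. dist (1 / V n * ln (P n)) (- I) < e"
  proof eventually_elim
    case (elim n)
    have P: "0 < P n" using elim(2) exp_gt_zero order_less_le_trans by blast
    have "ln (P n) \<le> - V n * (I - e / 2)" using elim(1) P ln_le_cancel_iff[of "P n" "exp (- V n * (I - e / 2))"] by simp
    moreover have "- V n * (I + e / 2) \<le> ln (P n)" using elim(2) P ln_le_cancel_iff[of "exp (- V n * (I + e / 2))" "P n"] by simp
    ultimately have "- (I + e / 2) \<le> 1 / V n * ln (P n)" "1 / V n * ln (P n) \<le> - (I - e / 2)"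
      using elim(3) by (simp_all add: field_simps)
    then show ?case using e by (simp add: dist_real_def abs_less_iff)
  qed
qed

locale tandem_network =
  node1: heavy_tailed_node M N1 Y1 v \<alpha> x0 c1 g1 + node2: heavy_tailed_node M N2 Y2 v \<alpha> x0 c2 g2
  for M :: "'a measure" and v \<alpha> x0 N1 Y1 c1 g1 N2 Y2 c2 g2 +
  fixes r1 r2 T :: real
  assumes T: "0 < T"
    and stable: "g1 < r1" "g1 + g2 < r2"
    and indep: "prob_space.indep_set M (sets node1.input_algebra) (sets node2.input_algebra)"
begin

abbreviation "\<kappa> \<equiv> r1 + g2 - r2"
abbreviation "\<rho> \<equiv> (r1 - g1) / \<kappa>"

definition j1 :: "nat \<Rightarrow> real \<Rightarrow> 'a \<Rightarrow> real" where "j1 n s \<omega> = node1.J (real n * s) \<omega> / real n"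
definition j2 :: "nat \<Rightarrow> real \<Rightarrow> 'a \<Rightarrow> real" where "j2 n s \<omega> = node2.J (real n * s) \<omega> / real n"

definition content :: "nat \<Rightarrow> 'a \<Rightarrow> real" where
  "content n \<omega> = tandem_content (\<lambda>s. j1 n s \<omega> - r1 * s) (\<lambda>s. j2 n s \<omega> - (r2 - r1) * s) T"

lemma r1_nonneg: "0 \<le> r1" using stable node1.g_nonneg by linarith

lemma nondecreasing_inputs:
  "AE \<omega> in M. \<omega> \<in> space M \<and> (\<forall>s t. 0 \<le> s \<longrightarrow> s \<le> t \<longrightarrow> node1.J s \<omega> \<le> node1.J t \<omega>) \<and>
     (\<forall>s t. 0 \<le> s \<longrightarrow> s \<le> t \<longrightarrow> node2.J s \<omega> \<le> node2.J t \<omega>)"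
  using node1.J_mono node2.J_mono by auto

lemma prob_Int:
  assumes "A \<in> sets node1.input_algebra" "B \<in> sets node2.input_algebra"
  shows "measure M (A \<inter> B) = measure M A * measure M B" "A \<in> sets M" "B \<in> sets M"
  using node1.indep_setD[OF indep assms] node1.indep_setD_ev1[OF indep] node1.indep_setD_ev2[OF indep] assms
  by blast+

lemma scaled_input:
  assumes "\<omega> \<in> space M" "0 < n"
  shows "t \<in> {0..<T} \<Longrightarrow> ((\<lambda>s. j1 n s \<omega>) \<longlongrightarrow> j1 n t \<omega>) (at_right t)"
    and "t \<in> {0..<T} \<Longrightarrow> ((\<lambda>s. j2 n s \<omega>) \<longlongrightarrow> j2 n t \<omega>) (at_right t)"
    and "\<exists>B\<ge>0. \<forall>t\<in>{0..T}. \<bar>j1 n t \<omega>\<bar> \<le> B \<and> \<bar>j2 n t \<omega>\<bar> \<le> B"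
proof -
  show "t \<in> {0..<T} \<Longrightarrow> ((\<lambda>s. j1 n s \<omega>) \<longlongrightarrow> j1 n t \<omega>) (at_right t)"
    unfolding j1_def by (intro tendsto_divide tendsto_const node1.J_scaled_right) (use assms in auto)
  show "t \<in> {0..<T} \<Longrightarrow> ((\<lambda>s. j2 n s \<omega>) \<longlongrightarrow> j2 n t \<omega>) (at_right t)"
    unfolding j2_def by (intro tendsto_divide tendsto_const node2.J_scaled_right) (use assms in auto)
  define A1 where "A1 = (\<Sum>j = 1..N1 (real n * T) \<omega>. \<bar>Y1 j \<omega>\<bar>)"
  define A2 where "A2 = (\<Sum>j = 1..N2 (real n * T) \<omega>. \<bar>Y2 j \<omega>\<bar>)"
  have "\<bar>j1 n t \<omega>\<bar> \<le> A1 / real n \<and> \<bar>j2 n t \<omega>\<bar> \<le> A2 / real n" if "t \<in> {0..T}" for t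
    using node1.J_bounded[OF assms(1), of "real n * t" "real n * T"]
      node2.J_bounded[OF assms(1), of "real n * t" "real n * T"] assms that
    by (simp add: j1_def j2_def A1_def A2_def divide_right_mono)
  moreover have "0 \<le> A1" "0 \<le> A2" unfolding A1_def A2_def by (auto intro: sum_nonneg)
  ultimately show "\<exists>B\<ge>0. \<forall>t\<in>{0..T}. \<bar>j1 n t \<omega>\<bar> \<le> B \<and> \<bar>j2 n t \<omega>\<bar> \<le> B"
    by (intro exI[of _ "A1 / real n + A2 / real n"]) (force intro: add_nonneg_nonneg divide_nonneg_nonneg)
qed

lemma drifted_bounds:
  assumes "\<omega> \<in> space M" "0 < n"
  shows "\<exists>B. (\<forall>s\<in>{0..T}. - (j1 n s \<omega> - r1 * s) \<le> B) \<and> (\<forall>s\<in>{0..T}. - (j2 n s \<omega> - (r2 - r1) * s) \<le> B)"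
proof -
  obtain B where B: "\<forall>t\<in>{0..T}. \<bar>j1 n t \<omega>\<bar> \<le> B \<and> \<bar>j2 n t \<omega>\<bar> \<le> B"
    using scaled_input(3)[OF assms] by auto
  have d: "a * s \<le> (\<bar>r1\<bar> + \<bar>r2 - r1\<bar>) * T" if "s \<in> {0..T}" "\<bar>a\<bar> \<le> \<bar>r1\<bar> + \<bar>r2 - r1\<bar>" for a s
    using that T by (intro mult_mono) auto
  show ?thesis
  proof (intro exI[of _ "B + (\<bar>r1\<bar> + \<bar>r2 - r1\<bar>) * T"] conjI ballI)
    fix s assume s: "s \<in> {0..T}"
    show "- (j1 n s \<omega> - r1 * s) \<le> B + (\<bar>r1\<bar> + \<bar>r2 - r1\<bar>) * T"
      using bspec[OF B s] d[OF s, of r1] by (simp add: abs_le_iff)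
    show "- (j2 n s \<omega> - (r2 - r1) * s) \<le> B + (\<bar>r1\<bar> + \<bar>r2 - r1\<bar>) * T"
      using bspec[OF B s] d[OF s, of "r2 - r1"] by (simp add: abs_le_iff)
  qed
qed

text \<open>The nested suprema range over an uncountable set of times; by right continuity of the inner and of
the outer process, rational times and the end point suffice.\<close>

lemma content_measurable:
  assumes n: "0 < n"
  shows "content n \<in> borel_measurable M"
proof -
  have m: "j1 n s \<in> borel_measurable M" "j2 n s \<in> borel_measurable M" if "0 \<le> s" for s
    using that n node1.J_measurable[of "real n * s"] node2.J_measurable[of "real n * s"]
    by (simp_all add: j1_def[abs_def] j2_def[abs_def])
  define p where "p = (\<lambda>s \<omega>. run_sup (\<lambda>s. - (j1 n s \<omega> - r1 * s)) s)"
  obtain B where B: "\<And>\<omega>. \<omega> \<in> space M \<Longrightarrow> (\<forall>s\<in>{0..T}. - (j1 n s \<omega> - r1 * s) \<le> B \<omega>) \<and>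
      (\<forall>s\<in>{0..T}. - (j2 n s \<omega> - (r2 - r1) * s) \<le> B \<omega>)"
    using drifted_bounds[OF _ n] by metis
  have pm: "p s \<in> borel_measurable M" if "s \<in> {0..T}" for s
    unfolding p_def
    by (rule run_sup_measurable[where B = B and T = T])
       (use B that m in \<open>auto intro!: tendsto_intros scaled_input[OF _ n]\<close>)
  have pB: "p s \<omega> \<le> B \<omega>" if "s \<in> {0..T}" "\<omega> \<in> space M" for s \<omega>
    unfolding p_def by (rule run_sup_least) (use that B in auto)
  have qm: "(\<lambda>\<omega>. run_sup (\<lambda>s. p s \<omega> - (j2 n s \<omega> - (r2 - r1) * s)) T) \<in> borel_measurable M"
  proof (rule run_sup_measurable[where B = "\<lambda>\<omega>. B \<omega> + B \<omega>" and T = T])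
    fix \<omega> assume w: "\<omega> \<in> space M"
    show "\<forall>s\<in>{0..T}. p s \<omega> - (j2 n s \<omega> - (r2 - r1) * s) \<le> B \<omega> + B \<omega>"
      using pB[OF _ w] B[OF w] by fastforce
    fix s assume s: "s \<in> {0..<T}"
    have "((\<lambda>s. p s \<omega>) \<longlongrightarrow> p s \<omega>) (at_right s)"
      unfolding p_def
      by (rule run_sup_right_continuous[where B = "B \<omega>"])
         (use B[OF w] s in \<open>auto intro!: tendsto_intros scaled_input[OF w n]\<close>)
    then show "((\<lambda>s. p s \<omega> - (j2 n s \<omega> - (r2 - r1) * s)) \<longlongrightarrow> p s \<omega> - (j2 n s \<omega> - (r2 - r1) * s)) (at_right s)"
      by (intro tendsto_intros scaled_input[OF w n] s)
  next
    fix s assume s: "s \<in> {0..T}"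
    show "(\<lambda>\<omega>. p s \<omega> - (j2 n s \<omega> - (r2 - r1) * s)) \<in> borel_measurable M"
      using pm[OF s] m(2)[of s] s by auto
  qed (use T in auto)
  have "(\<lambda>\<omega>. j2 n T \<omega> - (r2 - r1) * T - p T \<omega> + run_sup (\<lambda>s. p s \<omega> - (j2 n s \<omega> - (r2 - r1) * s)) T) \<in> borel_measurable M"
    using qm pm[of T] m(2)[of T] T by auto
  then show ?thesis by (simp add: content_def[abs_def] tandem_content_def p_def)
qed

lemma content_event: "0 < n \<Longrightarrow> {\<omega> \<in> space M. y \<le> content n \<omega>} \<in> sets M"
  using content_measurable[of n] by measurable

text \<open>In the second claim node 1 is unrestricted: whatever its input, it contributes at most \<open>\<kappa> * T\<close>.\<close>

lemma content_le:
  assumes \<omega>: "\<omega> \<in> space M" "\<forall>s t. 0 \<le> s \<longrightarrow> s \<le> t \<longrightarrow> node1.J s \<omega> \<le> node1.J t \<omega>"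
      "\<forall>s t. 0 \<le> s \<longrightarrow> s \<le> t \<longrightarrow> node2.J s \<omega> \<le> node2.J t \<omega>"
    and n: "0 < n" and x: "\<omega> \<notin> node2.excess T n x2" "0 < x2"
  shows "\<kappa> \<le> 0 \<Longrightarrow> content n \<omega> \<le> x2"
    and "0 < \<kappa> \<Longrightarrow> content n \<omega> \<le> x2 + \<kappa> * T"
    and "0 < \<kappa> \<Longrightarrow> \<omega> \<notin> node1.excess T n x1 \<Longrightarrow> 0 < x1 \<Longrightarrow> content n \<omega> \<le> x2 + x1 / \<rho>"
proof -
  have nn: "0 \<le> j1 n s \<omega>" if "s \<in> {0..T}" for s
    using \<omega>(2)[rule_format, of 0 "real n * s"] node1.J_0[OF \<omega>(1)] that n by (simp add: j1_def)
  have v2: "j2 n T \<omega> - j2 n u \<omega> \<le> g2 * (T - u) + x2" if "u \<in> {0..<T}" for u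
    unfolding j2_def by (rule node2.not_excess[OF \<omega>(1,3) x(1) that n])
  have v1: "j1 n T \<omega> - j1 n u \<omega> \<le> g1 * (T - u) + x1"
    if "\<omega> \<notin> node1.excess T n x1" "u \<in> {0..<T}" for u x1
    unfolding j1_def by (rule node1.not_excess[OF \<omega>(1,2) that n])
  define w where "w = j1 n T \<omega>"
  have w: "j1 n T \<omega> - j1 n u \<omega> \<le> g1 * (T - u) + w" if "u \<in> {0..<T}" for u
  proof -
    have "0 \<le> g1 * (T - u)" using that node1.g_nonneg by auto
    then show ?thesis using nn[of u] that by (simp add: w_def)
  qed
  have w0: "0 \<le> w" using nn[of T] T by (simp add: w_def)
  show "content n \<omega> \<le> x2" if "\<kappa> \<le> 0"
    unfolding content_def
    by (rule tandem_content_le(1)[where ?v1.0 = w and ?g1.0 = g1 and ?g2.0 = g2])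
       (use T nn r1_nonneg w w0 v2 x(2) stable that in auto)
  have "content n \<omega> \<le> x2 + min (\<kappa> * T) (\<kappa> / (r1 - g1) * w)" if "0 < \<kappa>"
    unfolding content_def
    by (rule tandem_content_le(2)[where ?v1.0 = w])
       (use T nn r1_nonneg w w0 v2 x(2) stable that in auto)
  then show "content n \<omega> \<le> x2 + \<kappa> * T" if "0 < \<kappa>" using that by fastforce
  show "content n \<omega> \<le> x2 + x1 / \<rho>" if "0 < \<kappa>" "\<omega> \<notin> node1.excess T n x1" "0 < x1"
  proof -
    have "content n \<omega> \<le> x2 + min (\<kappa> * T) (\<kappa> / (r1 - g1) * x1)"
      unfolding content_def
      by (rule tandem_content_le(2)[where ?v1.0 = x1])
         (use T nn r1_nonneg v1[OF that(2)] v2 x(2) stable that in auto)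
    also have "\<dots> \<le> x2 + \<kappa> / (r1 - g1) * x1" by simp
    also have "\<kappa> / (r1 - g1) * x1 = x1 / \<rho>" by simp
    finally show ?thesis by simp
  qed
qed

text \<open>If node 2 does not fill up even when node 1 works at full capacity, only its own input matters.\<close>

lemma upper_single_node:
  assumes "\<kappa> \<le> 0" "0 < y" "0 < \<epsilon>"
  shows "\<forall>\<^sub>F n in sequentially. measure M {\<omega> \<in> space M. y \<le> content n \<omega>} \<le> exp (- v (real n) * (c2 * y powr \<alpha> - \<epsilon>))"
proof -
  define \<delta> where "\<delta> = min (y / 2) ((\<epsilon> / (2 * c2)) powr (1 / \<alpha>))"
  have \<delta>: "0 < \<delta>" "\<delta> < y" using assms node2.c by (auto simp: \<delta>_def)
  have \<delta>p: "c2 * \<delta> powr \<alpha> \<le> \<epsilon> / 2"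
  proof -
    have "\<delta> powr \<alpha> \<le> ((\<epsilon> / (2 * c2)) powr (1 / \<alpha>)) powr \<alpha>"
      using \<delta> node1.alpha by (intro powr_mono2) (auto simp: \<delta>_def)
    also have "\<dots> = \<epsilon> / (2 * c2)" using node1.alpha assms node2.c by (simp add: powr_powr)
    finally have "c2 * \<delta> powr \<alpha> \<le> c2 * (\<epsilon> / (2 * c2))" using node2.c by (intro mult_left_mono) auto
    then show ?thesis using node2.c by simp
  qed
  have "y powr \<alpha> \<le> (y - \<delta>) powr \<alpha> + \<delta> powr \<alpha>"
    using powr_subadd[of "y - \<delta>" \<delta> \<alpha>] \<delta> node1.alpha by simp
  then have "c2 * y powr \<alpha> \<le> c2 * ((y - \<delta>) powr \<alpha> + \<delta> powr \<alpha>)" using node2.c by (intro mult_left_mono) auto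
  then have I: "c2 * y powr \<alpha> - \<epsilon> \<le> c2 * (max 0 (y - \<delta>)) powr \<alpha> - \<epsilon> / 2"
    using \<delta>p \<delta> by (simp add: algebra_simps)
  have "0 < \<epsilon> / 2" using assms by simp
  from node2.excess_bound[OF this T, of "y - \<delta>"] eventually_gt_at_top[of 0] node1.v_sequence_pos
  show ?thesis
  proof eventually_elim
    case (elim n)
    have "measure M {\<omega> \<in> space M. y \<le> content n \<omega>} \<le> measure M (node2.excess T n (y - \<delta>))"
    proof (rule node1.finite_measure_mono_AE)
      show "AE \<omega> in M. \<omega> \<in> {\<omega> \<in> space M. y \<le> content n \<omega>} \<longrightarrow> \<omega> \<in> node2.excess T n (y - \<delta>)"
        using nondecreasing_inputs
      proof eventually_elim
        case el: (elim \<omega>)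
        show ?case
        proof (intro impI, rule ccontr)
          assume "\<omega> \<in> {\<omega> \<in> space M. y \<le> content n \<omega>}" "\<omega> \<notin> node2.excess T n (y - \<delta>)"
          then have "content n \<omega> \<le> y - \<delta>" "y \<le> content n \<omega>"
            using content_le(1)[of \<omega> n "y - \<delta>"] el elim \<delta> assms by auto
          then show False using \<delta> by simp
        qed
      qed
      show "node2.excess T n (y - \<delta>) \<in> sets M"
        using prob_Int(3)[OF sets.top] node2.excess_sets[OF T] by blast
    qed
    also have "\<dots> \<le> exp (- v (real n) * (c2 * (max 0 (y - \<delta>)) powr \<alpha> - \<epsilon> / 2))" by (rule elim(1))
    also have "\<dots> \<le> exp (- v (real n) * (c2 * y powr \<alpha> - \<epsilon>))"
      using I elim(3) by (auto intro: mult_left_mono)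
    finally show ?case .
  qed
qed

text \<open>Laplace principle on the grid \<open>k * \<delta>\<close>. If \<open>k\<close> is the largest index such that the input of node 1 has an
excess \<open>\<rho> * k * \<delta>\<close>, then node 1 contributes at most \<open>(k + 1) * \<delta>\<close>, so that node 2 must have an excess
\<open>y - (k + 2) * \<delta>\<close>; the additional \<open>\<delta>\<close> makes the contradiction in the converse case strict. The
finitely many intersections have product probabilities, and the number of terms is absorbed by
\<open>exp (\<epsilon> / 4 * v n)\<close>.\<close>

lemma upper_two_nodes:
  assumes \<kappa>: "0 < \<kappa>" and y: "0 < y" and \<epsilon>: "0 < \<epsilon>"
  defines "xs \<equiv> min y (\<kappa> * T)"
  defines "I \<equiv> min (c2 * y powr \<alpha>) (c1 * (\<rho> * xs) powr \<alpha> + c2 * (y - xs) powr \<alpha>)"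
  shows "\<forall>\<^sub>F n in sequentially. measure M {\<omega> \<in> space M. y \<le> content n \<omega>} \<le> exp (- v (real n) * (I - \<epsilon>))"
proof -
  note alpha = node1.alpha
  \<comment> \<open>The mesh for which lowering the level of node 2 by \<open>2 * \<delta>\<close> changes the rate by at most \<open>\<epsilon> / 4\<close>.\<close>
  define \<delta> where "\<delta> = (\<epsilon> / (4 * c2)) powr (1 / \<alpha>) / 2"
  have \<delta>: "0 < \<delta>" using \<epsilon> node2.c by (auto simp: \<delta>_def)
  have \<delta>p: "c2 * (2 * \<delta>) powr \<alpha> = \<epsilon> / 4"
    using node1.alpha \<epsilon> node2.c by (simp add: \<delta>_def powr_powr)
  define m where "m = nat \<lfloor>\<kappa> * T / \<delta>\<rfloor>"
  have m: "real m * \<delta> \<le> \<kappa> * T" "\<kappa> * T < (real m + 1) * \<delta>"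
  proof -
    have "0 \<le> \<kappa> * T / \<delta>" using \<kappa> T \<delta> by auto
    then have "real m \<le> \<kappa> * T / \<delta>" "\<kappa> * T / \<delta> < real m + 1" unfolding m_def by linarith+
    then show "real m * \<delta> \<le> \<kappa> * T" "\<kappa> * T < (real m + 1) * \<delta>" using \<delta> by (simp_all add: field_simps)
  qed
  have \<rho>: "0 < \<rho>" using \<kappa> stable by simp
  define A1 where "A1 = (\<lambda>n k. node1.excess T n (\<rho> * (real k * \<delta>)))"
  define A2 where "A2 = (\<lambda>n k. node2.excess T n (y - (real k + 2) * \<delta>))"
  have \<epsilon>4: "0 < \<epsilon> / 4" using \<epsilon> by simp
  have E1: "\<forall>\<^sub>F n in sequentially. \<forall>k\<in>{..m}. measure M (A1 n k) \<le>
      exp (- v (real n) * (c1 * (max 0 (\<rho> * (real k * \<delta>))) powr \<alpha> - \<epsilon> / 4))"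
    unfolding A1_def by (intro eventually_ball_finite ballI node1.excess_bound \<epsilon>4 T) auto
  have E2: "\<forall>\<^sub>F n in sequentially. \<forall>k\<in>{..m}. measure M (A2 n k) \<le>
      exp (- v (real n) * (c2 * (max 0 (y - (real k + 2) * \<delta>)) powr \<alpha> - \<epsilon> / 4))"
    unfolding A2_def by (intro eventually_ball_finite ballI node2.excess_bound \<epsilon>4 T) auto
  have E3: "\<forall>\<^sub>F n in sequentially. 0 * ln (real n) + ln (real m + 1) \<le> \<epsilon> / 4 * v (real n)"
    by (rule node1.v_sequence_dominates[OF \<epsilon>4])
  have rate: "I - \<epsilon> / 4 \<le> c1 * (max 0 (\<rho> * (real k * \<delta>))) powr \<alpha> + c2 * (max 0 (y - (real k + 2) * \<delta>)) powr \<alpha>"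
    if k: "k \<in> {..m}" for k
  proof -
    define x where "x = real k * \<delta>"
    have x: "0 \<le> x" "x \<le> \<kappa> * T"
    proof -
      show "0 \<le> x" using \<delta> by (simp add: x_def)
      have "x \<le> real m * \<delta>" unfolding x_def using k \<delta> by (intro mult_right_mono) auto
      then show "x \<le> \<kappa> * T" using m by simp
    qed
    have "I = min (c2 * y powr \<alpha>) ((c1 * \<rho> powr \<alpha>) * xs powr \<alpha> + c2 * (y - xs) powr \<alpha>)"
    proof -
      have "(\<rho> * xs) powr \<alpha> = \<rho> powr \<alpha> * xs powr \<alpha>"
        by (rule powr_mult)
      then show ?thesis unfolding I_def by (simp only: mult.assoc)
    qed
    also have "\<dots> \<le> (c1 * \<rho> powr \<alpha>) * x powr \<alpha> + c2 * (max 0 (y - x)) powr \<alpha>"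
      by (rule split_cost_lower_bound)
         (use x \<kappa> T y alpha node1.c node2.c in \<open>auto simp: xs_def min_def\<close>)
    also have "c2 * (max 0 (y - x)) powr \<alpha> \<le> c2 * ((max 0 (y - x - 2 * \<delta>)) powr \<alpha> + (2 * \<delta>) powr \<alpha>)"
    proof (intro mult_left_mono)
      have "(max 0 (y - x)) powr \<alpha> \<le> (max 0 (y - x - 2 * \<delta>) + 2 * \<delta>) powr \<alpha>"
        using \<delta> alpha by (intro powr_mono2) auto
      also have "\<dots> \<le> (max 0 (y - x - 2 * \<delta>)) powr \<alpha> + (2 * \<delta>) powr \<alpha>"
        using \<delta> alpha by (intro powr_subadd) auto
      finally show "(max 0 (y - x)) powr \<alpha> \<le> (max 0 (y - x - 2 * \<delta>)) powr \<alpha> + (2 * \<delta>) powr \<alpha>" .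
    qed (use node2.c in auto)
    also have "\<dots> = c2 * (max 0 (y - x - 2 * \<delta>)) powr \<alpha> + \<epsilon> / 4"
      using \<delta>p by (simp add: distrib_left)
    also have "(c1 * \<rho> powr \<alpha>) * x powr \<alpha> = c1 * (max 0 (\<rho> * x)) powr \<alpha>"
    proof -
      have "max 0 (\<rho> * x) = \<rho> * x" using \<rho> x by (intro max_absorb2 mult_nonneg_nonneg) auto
      moreover have "(\<rho> * x) powr \<alpha> = \<rho> powr \<alpha> * x powr \<alpha>" by (rule powr_mult)
      ultimately show ?thesis by (simp only: mult.assoc)
    qed
    finally show ?thesis by (simp add: x_def algebra_simps)
  qed
  show ?thesis
    using E1 E2 E3 eventually_gt_at_top[of 0] node1.v_sequence_pos
  proof eventually_elim
    case (elim n)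
    have meas: "A1 n k \<in> sets node1.input_algebra" "A2 n k \<in> sets node2.input_algebra" for k
      unfolding A1_def A2_def by (rule node1.excess_sets[OF T] node2.excess_sets[OF T])+
    note ind = prob_Int[OF meas]
    have "measure M {\<omega> \<in> space M. y \<le> content n \<omega>} \<le> measure M (\<Union>k\<in>{..m}. A1 n k \<inter> A2 n k)"
    proof (rule node1.finite_measure_mono_AE)
      show "AE \<omega> in M. \<omega> \<in> {\<omega> \<in> space M. y \<le> content n \<omega>} \<longrightarrow> \<omega> \<in> (\<Union>k\<in>{..m}. A1 n k \<inter> A2 n k)"
        using nondecreasing_inputs
      proof eventually_elim
        case el: (elim \<omega>)
        show ?case
        proof
          assume "\<omega> \<in> {\<omega> \<in> space M. y \<le> content n \<omega>}"
          then have yc: "y \<le> content n \<omega>" by simp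
          define K where "K = {k\<in>{..m}. \<omega> \<in> A1 n k}"
          have "0 \<in> K" using el by (simp add: K_def A1_def node1.excess_def)
          moreover have "finite K" by (simp add: K_def)
          ultimately have kK: "Max K \<in> K" and kmax: "\<And>i. i \<in> K \<Longrightarrow> i \<le> Max K" using Max_in by auto
          define k where "k = Max K"
          have k: "k \<le> m" "\<omega> \<in> A1 n k" using kK by (auto simp: K_def k_def)
          have "\<omega> \<in> A2 n k"
          proof (rule ccontr)
            assume n2: "\<omega> \<notin> A2 n k"
            define z where "z = y - (real k + 2) * \<delta>"
            have z: "\<omega> \<notin> node2.excess T n z" "0 < z"
              using n2 el by (auto simp: A2_def z_def node2.excess_def split: if_splits)
            have "content n \<omega> \<le> z + (real k + 1) * \<delta>"
            proof (cases "k = m")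
              case True
              then show ?thesis using content_le(2)[of \<omega> n z] el elim(4) z \<kappa> m by auto
            next
              case False
              have "\<omega> \<notin> A1 n (Suc k)"
              proof
                assume "\<omega> \<in> A1 n (Suc k)"
                then have "Suc k \<in> K" using False k by (auto simp: K_def)
                then show False using kmax[of "Suc k"] by (simp add: k_def)
              qed
              \<comment> \<open>Maximality of \<open>k\<close> bounds the contribution of node 1 by that of the next grid point.\<close>
              then have out: "\<omega> \<notin> node1.excess T n (\<rho> * (real (Suc k) * \<delta>))" unfolding A1_def .
              have "0 < real (Suc k) * \<delta>" using \<delta> by simp
              then have "0 < \<rho> * (real (Suc k) * \<delta>)" by (rule mult_pos_pos[OF \<rho>])
              with el elim(4) z \<kappa> out have "content n \<omega> \<le> z + (\<rho> * (real (Suc k) * \<delta>)) / \<rho>"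
                by (intro content_le(3)) blast+
              moreover have "(a * q) / a = q" if "0 < a" for a q :: real using that by simp
              ultimately have "content n \<omega> \<le> z + real (Suc k) * \<delta>" using \<rho> by metis
              then show ?thesis by (simp add: algebra_simps)
            qed
            then show False using yc \<delta> by (simp add: z_def algebra_simps)
          qed
          then show "\<omega> \<in> (\<Union>k\<in>{..m}. A1 n k \<inter> A2 n k)" using k by auto
        qed
      qed
      show "(\<Union>k\<in>{..m}. A1 n k \<inter> A2 n k) \<in> sets M" using ind by (intro sets.finite_UN) auto
    qed
    also have "\<dots> \<le> (\<Sum>k\<in>{..m}. measure M (A1 n k \<inter> A2 n k))"
      using ind by (intro node1.finite_measure_subadditive_finite) auto
    also have "\<dots> \<le> (\<Sum>k\<in>{..m}. exp (- v (real n) * (I - 3 * \<epsilon> / 4)))"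
    proof (rule sum_mono)
      fix k assume k: "k \<in> {..m}"
      have "measure M (A1 n k \<inter> A2 n k) = measure M (A1 n k) * measure M (A2 n k)" by (rule ind)
      also have "\<dots> \<le> exp (- v (real n) * (c1 * (max 0 (\<rho> * (real k * \<delta>))) powr \<alpha> - \<epsilon> / 4))
          * exp (- v (real n) * (c2 * (max 0 (y - (real k + 2) * \<delta>)) powr \<alpha> - \<epsilon> / 4))"
        using elim(1,2) k by (intro mult_mono) auto
      also have "\<dots> = exp (- v (real n) * ((c1 * (max 0 (\<rho> * (real k * \<delta>))) powr \<alpha>
          + c2 * (max 0 (y - (real k + 2) * \<delta>)) powr \<alpha>) - \<epsilon> / 2))"
        unfolding exp_add[symmetric] by (intro arg_cong[where f = exp]) (simp add: algebra_simps)
      also have "\<dots> \<le> exp (- v (real n) * (I - 3 * \<epsilon> / 4))"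
      proof -
        have "I - 3 * \<epsilon> / 4 \<le> (c1 * (max 0 (\<rho> * (real k * \<delta>))) powr \<alpha>
          + c2 * (max 0 (y - (real k + 2) * \<delta>)) powr \<alpha>) - \<epsilon> / 2" using rate[OF k] by linarith
        then show ?thesis using elim(5) by (auto intro: mult_left_mono)
      qed
      finally show "measure M (A1 n k \<inter> A2 n k) \<le> exp (- v (real n) * (I - 3 * \<epsilon> / 4))" .
    qed
    also have "\<dots> = exp (ln (real m + 1)) * exp (- v (real n) * (I - 3 * \<epsilon> / 4))" by simp
    also have "\<dots> \<le> exp (\<epsilon> / 4 * v (real n)) * exp (- v (real n) * (I - 3 * \<epsilon> / 4))"
      using elim(3) by (intro mult_right_mono) (auto simp del: exp_ln)
    also have "\<dots> = exp (- v (real n) * (I - \<epsilon>))"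
      unfolding exp_add[symmetric] by (intro arg_cong[where f = exp]) (simp add: algebra_simps)
    finally show ?case .
  qed
qed

text \<open>One big jump at node 2 during the last time unit; node 1 is ignored, since its output is nonnegative.\<close>

lemma lower_second_node:
  assumes y: "0 < y" and \<epsilon>: "0 < \<epsilon>"
  shows "\<forall>\<^sub>F n in sequentially. exp (- v (real n) * (c2 * y powr \<alpha> + \<epsilon>)) \<le> measure M {\<omega> \<in> space M. y \<le> content n \<omega>}"
proof -
  note alpha = node1.alpha
  define \<delta> where "\<delta> = (\<epsilon> / (2 * c2)) powr (1 / \<alpha>) / 2"
  have \<delta>: "0 < \<delta>" using \<epsilon> node2.c by (auto simp: \<delta>_def)
  have \<delta>p: "c2 * (2 * \<delta>) powr \<alpha> = \<epsilon> / 2"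
    using alpha \<epsilon> node2.c by (simp add: \<delta>_def powr_powr)
  have rate: "c2 * (y + 2 * \<delta>) powr \<alpha> + \<epsilon> / 2 \<le> c2 * y powr \<alpha> + \<epsilon>"
  proof -
    have "c2 * (y + 2 * \<delta>) powr \<alpha> \<le> c2 * (y powr \<alpha> + (2 * \<delta>) powr \<alpha>)"
      using y \<delta> alpha node2.c by (intro mult_left_mono powr_subadd) auto
    then show ?thesis using \<delta>p by (simp add: distrib_left)
  qed
  have "\<forall>\<^sub>F n in sequentially. r2 / \<delta> \<le> real n" "\<forall>\<^sub>F n in sequentially. 1 / T \<le> real n"
    by (rule eventually_compose_filterlim[OF eventually_ge_at_top filterlim_real_sequentially])+
  with node2.node_lower_bound[of "y + 2 * \<delta>" \<delta> "\<epsilon> / 2" T] y \<delta> \<epsilon> T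
  have "\<forall>\<^sub>F n in sequentially. (\<forall>s\<ge>0. \<forall>m. real m \<le> real n * T \<longrightarrow>
    exp (- v (real n) * (c2 * (y + 2 * \<delta>) powr \<alpha> + \<epsilon> / 2)) \<le> measure M (node2.surge n m s (y + 2 * \<delta>) \<delta>))
     \<and> r2 / \<delta> \<le> real n \<and> 1 / T \<le> real n"
    by (simp add: eventually_conj_iff node2.surge_def)
  then show ?thesis
    using eventually_gt_at_top[of 0] node1.v_sequence_pos
  proof eventually_elim
    case (elim n)
    have n: "r2 \<le> real n * \<delta>" "1 \<le> real n * T" using elim \<delta> T by (auto simp: field_simps)
    define s where "s = real n * T - 1"
    have s: "0 \<le> s" using n by (simp add: s_def)
    have "exp (- v (real n) * (c2 * y powr \<alpha> + \<epsilon>))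
       \<le> exp (- v (real n) * (c2 * (y + 2 * \<delta>) powr \<alpha> + \<epsilon> / 2))"
      using rate elim by (auto intro: mult_left_mono)
    also have "\<dots> \<le> measure M (node2.surge n 1 s (y + 2 * \<delta>) \<delta>)"
      using elim(1) s n by auto
    also have "\<dots> \<le> measure M {\<omega> \<in> space M. y \<le> content n \<omega>}"
    proof (rule node1.finite_measure_mono_AE)
      show "AE \<omega> in M. \<omega> \<in> node2.surge n 1 s (y + 2 * \<delta>) \<delta> \<longrightarrow> \<omega> \<in> {\<omega> \<in> space M. y \<le> content n \<omega>}"
        using nondecreasing_inputs
      proof eventually_elim
        case el: (elim \<omega>)
        show ?case
        proof
          assume "\<omega> \<in> node2.surge n 1 s (y + 2 * \<delta>) \<delta>"
          then have "real n * (y + 2 * \<delta>) + g2 - real n * \<delta> \<le> node2.J (real n * T) \<omega> - node2.J s \<omega>"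
            by (simp add: node2.surge_def s_def)
          then have big: "real n * y + real n * \<delta> \<le> node2.J (real n * T) \<omega> - node2.J s \<omega>"
            using node2.g_nonneg by (simp add: algebra_simps)
          define s0 where "s0 = T - 1 / real n"
          have ns: "real n * s0 = s" using elim by (simp add: s0_def s_def algebra_simps)
          have s0: "0 \<le> s0" "s0 \<le> T" using n elim by (auto simp: s0_def field_simps)
          have nn: "0 \<le> j1 n s \<omega>" "0 \<le> j2 n s \<omega>" if "s \<in> {0..T}" for s
          proof -
            have "node1.J 0 \<omega> \<le> node1.J (real n * s) \<omega>" "node2.J 0 \<omega> \<le> node2.J (real n * s) \<omega>"
              using el that by auto
            then show "0 \<le> j1 n s \<omega>" "0 \<le> j2 n s \<omega>"
              using el by (simp_all add: j1_def j2_def node1.J_0 node2.J_0)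
          qed
          have "y \<le> content n \<omega>"
            unfolding content_def
          proof (rule tandem_content_ge[where e = "r1 / real n", OF s0 nn r1_nonneg])
            show "0 \<le> r1 / real n" using r1_nonneg by simp
            fix u assume u: "u \<in> {s0..T}"
            have "j1 n s0 \<omega> \<le> j1 n u \<omega>"
              using el u s0 elim by (auto simp: j1_def intro!: divide_right_mono)
            moreover have "r1 * (u - s0) \<le> r1 * (1 / real n)"
              using u r1_nonneg by (intro mult_left_mono) (auto simp: s0_def)
            ultimately show "r1 * (u - s0) - r1 / real n \<le> j1 n u \<omega> - j1 n s0 \<omega>" by simp
          next
            have "(r2 - r1) * (T - s0) + r1 / real n + y = (r2 + real n * y) / real n"
              using elim by (simp add: s0_def field_simps)
            also have "\<dots> \<le> (real n * \<delta> + real n * y) / real n"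
              using n by (intro divide_right_mono) auto
            also have "\<dots> \<le> (node2.J (real n * T) \<omega> - node2.J s \<omega>) / real n"
              using big by (intro divide_right_mono) auto
            also have "\<dots> = j2 n T \<omega> - j2 n s0 \<omega>" by (simp add: j2_def ns diff_divide_distrib)
            finally show "(r2 - r1) * (T - s0) + r1 / real n + y \<le> j2 n T \<omega> - j2 n s0 \<omega>" .
          qed auto
          then show "\<omega> \<in> {\<omega> \<in> space M. y \<le> content n \<omega>}" using el by simp
        qed
      qed
    qed (rule content_event[OF elim(2)])
    finally show ?case .
  qed
qed

text \<open>Both nodes have a surge at time \<open>n * (T - x / \<kappa>)\<close>, the one of node 1 being just large enough to keep it
busy until \<open>n * T\<close>. In the extreme case \<open>x = y\<close> node 2 still gets a jump of the small size
\<open>2 * n * \<delta>\<close>: it absorbs the fluctuations of the input of node 2 and the output of node 1 lost before its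
big jump, at a cost that vanishes with \<open>\<delta>\<close>.\<close>

lemma lower_both_nodes:
  assumes \<kappa>: "0 < \<kappa>" and x: "0 < x" "x \<le> y" "x \<le> \<kappa> * T" and \<epsilon>: "0 < \<epsilon>"
  shows "\<forall>\<^sub>F n in sequentially.
    exp (- v (real n) * (c1 * (\<rho> * x) powr \<alpha> + c2 * (y - x) powr \<alpha> + \<epsilon>))
    \<le> measure M {\<omega> \<in> space M. y \<le> content n \<omega>}"
proof -
  note alpha = node1.alpha
  have \<rho>: "0 < \<rho>" using \<kappa> stable by simp
  define \<delta> where "\<delta> = (\<epsilon> / (4 * (c1 + c2))) powr (1 / \<alpha>) / 2"
  have c: "0 < c1 + c2" using node1.c node2.c by simp
  have \<delta>: "0 < \<delta>" using \<epsilon> c by (auto simp: \<delta>_def)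
  have \<delta>p: "(c1 + c2) * (2 * \<delta>) powr \<alpha> = \<epsilon> / 4"
  proof -
    have "(2 * \<delta>) powr \<alpha> = \<epsilon> / (4 * (c1 + c2))" using alpha \<epsilon> c by (simp add: \<delta>_def powr_powr)
    moreover have "D * (\<epsilon> / (4 * D)) = \<epsilon> / 4" if "0 < D" for D using that by simp
    ultimately show ?thesis using c by (simp only:)
  qed
  define a1 where "a1 = \<rho> * x + 2 * \<delta>"
  define a2 where "a2 = (y - x) + 2 * \<delta>"
  have a: "0 < a1" "0 < a2" using mult_pos_pos[OF \<rho> x(1)] x(2) \<delta> unfolding a1_def a2_def by linarith+
  have rate: "(c1 * a1 powr \<alpha> + \<epsilon> / 4) + (c2 * a2 powr \<alpha> + \<epsilon> / 4) \<le> c1 * (\<rho> * x) powr \<alpha> + c2 * (y - x) powr \<alpha> + \<epsilon>"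
  proof -
    have "c1 * a1 powr \<alpha> \<le> c1 * ((\<rho> * x) powr \<alpha> + (2 * \<delta>) powr \<alpha>)"
      unfolding a1_def using less_imp_le[OF mult_pos_pos[OF \<rho> x(1)]] \<delta> alpha node1.c
      by (intro mult_left_mono powr_subadd) simp_all
    moreover have "c2 * a2 powr \<alpha> \<le> c2 * ((y - x) powr \<alpha> + (2 * \<delta>) powr \<alpha>)"
      unfolding a2_def using x \<delta> alpha node2.c by (intro mult_left_mono powr_subadd) auto
    moreover have "c1 * (2 * \<delta>) powr \<alpha> + c2 * (2 * \<delta>) powr \<alpha> = \<epsilon> / 4"
      using \<delta>p by (simp add: distrib_right)
    ultimately show ?thesis using \<epsilon> by (simp add: distrib_left)
  qed
  define d where "d = x / \<kappa>"
  have d: "0 < d" "d \<le> T" "\<kappa> * d = x" "(r1 - g1) * d = \<rho> * x"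
    using \<kappa> x by (auto simp: d_def field_simps)
  have \<epsilon>4: "0 < \<epsilon> / 4" using \<epsilon> by simp
  have "\<forall>\<^sub>F n in sequentially. (r1 + g2) / \<delta> \<le> real n" "\<forall>\<^sub>F n in sequentially. 1 / d \<le> real n"
    by (rule eventually_compose_filterlim[OF eventually_ge_at_top filterlim_real_sequentially])+
  from node1.node_lower_bound[OF a(1) \<delta> \<epsilon>4 T] node2.node_lower_bound[OF a(2) \<delta> \<epsilon>4 T] this
    eventually_gt_at_top[of 0] node1.v_sequence_pos
  show ?thesis
  proof eventually_elim
    case (elim n)
    have n: "r1 + g2 \<le> real n * \<delta>" "1 \<le> real n * d" using elim(3,4) \<delta> d by (auto simp: field_simps)
    define s where "s = real n * (T - d)"
    define m where "m = nat \<lfloor>real n * d\<rfloor>"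
    have s: "0 \<le> s" using d by (simp add: s_def)
    have m: "1 \<le> m" "real m \<le> real n * d" "real n * d < real m + 1"
      using n unfolding m_def by linarith+
    have mT: "real m \<le> real n * T" using m(2) d mult_left_mono[of d T "real n"] by simp
    have sT: "s + real n * d = real n * T" by (simp add: s_def algebra_simps)
    let ?A = "node1.surge n m s a1 \<delta>" and ?B = "node2.surge n m s a2 \<delta>"
    note ind = prob_Int[OF node1.surge_sets[OF s] node2.surge_sets[OF s]]
    have "exp (- v (real n) * (c1 * (\<rho> * x) powr \<alpha> + c2 * (y - x) powr \<alpha> + \<epsilon>))
       \<le> exp (- v (real n) * ((c1 * a1 powr \<alpha> + \<epsilon> / 4) + (c2 * a2 powr \<alpha> + \<epsilon> / 4)))"
      using mult_left_mono[OF rate, of "v (real n)"] elim by (simp del: mult_le_cancel_left_pos)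
    also have "\<dots> = exp (- v (real n) * (c1 * a1 powr \<alpha> + \<epsilon> / 4)) * exp (- v (real n) * (c2 * a2 powr \<alpha> + \<epsilon> / 4))"
      unfolding exp_add[symmetric] by (simp only: distrib_left)
    also have "\<dots> \<le> measure M ?A * measure M ?B"
      using elim(1,2) s mT unfolding node1.surge_def node2.surge_def by (intro mult_mono) auto
    also have "\<dots> = measure M (?A \<inter> ?B)" by (rule ind(1)[symmetric])
    also have "\<dots> \<le> measure M {\<omega> \<in> space M. y \<le> content n \<omega>}"
    proof (rule node1.finite_measure_mono_AE)
      show "AE \<omega> in M. \<omega> \<in> ?A \<inter> ?B \<longrightarrow> \<omega> \<in> {\<omega> \<in> space M. y \<le> content n \<omega>}"
        using nondecreasing_inputs
      proof eventually_elim
        case el: (elim \<omega>)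
        show ?case
        proof
          assume AB: "\<omega> \<in> ?A \<inter> ?B"
          have A: "real n * a1 + g1 * real j - real n * \<delta> \<le> node1.J (s + real j) \<omega> - node1.J s \<omega>"
            if "j \<in> {1..m}" for j using AB that unfolding node1.surge_def by blast
          have B: "real n * a2 + g2 * real m - real n * \<delta> \<le> node2.J (s + real m) \<omega> - node2.J s \<omega>"
            using AB m unfolding node2.surge_def by auto
          have mono1: "node1.J u \<omega> \<le> node1.J w \<omega>" and mono2: "node2.J u \<omega> \<le> node2.J w \<omega>"
            if "0 \<le> u" "u \<le> w" for u w using el that by auto
          define s0 where "s0 = T - d"
          have ns: "real n * s0 = s" by (simp add: s0_def s_def)
          have s0: "0 \<le> s0" "s0 \<le> T" using d by (auto simp: s0_def)
          have nn: "0 \<le> j1 n s \<omega>" "0 \<le> j2 n s \<omega>" if "s \<in> {0..T}" for s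
            using mono1[of 0 "real n * s"] mono2[of 0 "real n * s"] el node1.J_0 node2.J_0 that
            by (auto simp: j1_def j2_def)
          \<comment> \<open>Node 1 loses at most the capacity \<open>r1\<close> of the first time unit, during which its big jump may still be pending.\<close>
          have busy: "r1 * w - r1 \<le> node1.J (s + w) \<omega> - node1.J s \<omega>" if w: "0 \<le> w" "w \<le> real n * d" for w
          proof (cases "w < 1")
            case True
            then have "r1 * w \<le> r1 * 1" using r1_nonneg by (intro mult_left_mono) auto
            then show ?thesis using mono1[of s "s + w"] s w by simp
          next
            case False
            define j where "j = nat \<lfloor>w\<rfloor>"
            have j: "1 \<le> j" "real j \<le> w" "w < real j + 1" using False unfolding j_def by linarith+
            have "real j < real m + 1" using j w m by linarith
            then have "j \<in> {1..m}" using j by auto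
            then have "real n * a1 + g1 * real j - real n * \<delta> \<le> node1.J (s + w) \<omega> - node1.J s \<omega>"
              using A[of j] mono1[of "s + real j" "s + w"] s j by linarith
            moreover have "(r1 - g1) * w \<le> real n * (\<rho> * x)"
            proof -
              have "(r1 - g1) * w \<le> (r1 - g1) * (real n * d)" using w stable by (intro mult_left_mono) auto
              also have "\<dots> = real n * ((r1 - g1) * d)" by simp
              finally show ?thesis by (simp only: d(4))
            qed
            moreover have "real n * a1 = real n * (\<rho> * x) + 2 * (real n * \<delta>)"
              unfolding a1_def by (simp only: distrib_left mult.left_commute)
            moreover have "g1 * w \<le> g1 * (real j + 1)" using j node1.g_nonneg by (intro mult_left_mono) auto
            moreover have "0 \<le> real n * \<delta>" using \<delta> by simp
            moreover have "g1 \<le> r1" using stable by simp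
            moreover have "(r1 - g1) * w = r1 * w - g1 * w" "g1 * (real j + 1) = g1 * real j + g1"
              by (simp_all only: left_diff_distrib distrib_left mult_1_right)
            ultimately show ?thesis by linarith
          qed
          have "y \<le> content n \<omega>"
            unfolding content_def
          proof (rule tandem_content_ge[where e = "r1 / real n", OF s0 nn r1_nonneg])
            show "0 \<le> r1 / real n" using r1_nonneg by simp
            fix u assume u: "u \<in> {s0..T}"
            have "s + real n * (u - s0) = real n * u" using ns by (simp add: algebra_simps)
            moreover have "real n * (u - s0) \<le> real n * d" using u by (intro mult_left_mono) (auto simp: s0_def)
            ultimately have "r1 * (real n * (u - s0)) - r1 \<le> node1.J (real n * u) \<omega> - node1.J s \<omega>"
              using busy[of "real n * (u - s0)"] u by simp
            then have "(r1 * (real n * (u - s0)) - r1) / real n \<le> (node1.J (real n * u) \<omega> - node1.J s \<omega>) / real n"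
              by (intro divide_right_mono) auto
            then show "r1 * (u - s0) - r1 / real n \<le> j1 n u \<omega> - j1 n s0 \<omega>"
              using elim(5) by (simp add: j1_def ns diff_divide_distrib)
          next
            have "real n * a2 + g2 * real m - real n * \<delta> \<le> node2.J (real n * T) \<omega> - node2.J s \<omega>"
              using B mono2[of "s + real m" "real n * T"] s m sT by linarith
            moreover have "g2 * (real n * d) \<le> g2 * (real m + 1)"
              using m node2.g_nonneg by (intro mult_left_mono) auto
            moreover have "g2 * (real m + 1) = g2 * real m + g2" by (simp add: distrib_left)
            moreover have "real n * a2 = real n * (y - x) + 2 * (real n * \<delta>)"
              unfolding a2_def by (simp add: algebra_simps)
            ultimately have "real n * (y - x) + g2 * (real n * d) + r1 \<le> node2.J (real n * T) \<omega> - node2.J s \<omega>"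
              using n by linarith
            moreover have "real n * (y - x) + g2 * (real n * d) = real n * ((r2 - r1) * d + y)"
            proof -
              have "y - x + g2 * d = (r2 - r1) * d + y" using d(3) by (simp add: algebra_simps)
              then have "real n * (y - x + g2 * d) = real n * ((r2 - r1) * d + y)" by (simp only:)
              then show ?thesis by (simp add: algebra_simps)
            qed
            ultimately have "(real n * ((r2 - r1) * d + y) + r1) / real n \<le> (node2.J (real n * T) \<omega> - node2.J s \<omega>) / real n"
              by (intro divide_right_mono) auto
            moreover have Td: "T - s0 = d" by (simp add: s0_def)
            ultimately show "(r2 - r1) * (T - s0) + r1 / real n + y \<le> j2 n T \<omega> - j2 n s0 \<omega>"
              using elim(5) Td by (simp add: j2_def ns add_divide_distrib diff_divide_distrib)
          qed auto
          then show "\<omega> \<in> {\<omega> \<in> space M. y \<le> content n \<omega>}" using el by simp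
        qed
      qed
    qed (rule content_event[OF elim(5)])
    finally show ?case .
  qed
qed

lemma decay_rate_slow_first_node:
  assumes "\<kappa> \<le> 0" "0 < y"
  shows "(\<lambda>n. 1 / v (real n) * ln (measure M {\<omega> \<in> space M. y \<le> content n \<omega>})) \<longlonglongrightarrow> - (c2 * y powr \<alpha>)"
  using node1.v_sequence_pos upper_single_node[OF assms] lower_second_node[OF assms(2)]
  by (rule log_asymptotics)

lemma decay_rate_fast_first_node:
  assumes \<kappa>: "0 < \<kappa>" and y: "0 < y"
  defines "xs \<equiv> min y (\<kappa> * T)"
  shows "(\<lambda>n. 1 / v (real n) * ln (measure M {\<omega> \<in> space M. y \<le> content n \<omega>}))
    \<longlonglongrightarrow> - min (c2 * y powr \<alpha>) (c1 * (\<rho> * xs) powr \<alpha> + c2 * (y - xs) powr \<alpha>)"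
proof (rule log_asymptotics[OF node1.v_sequence_pos])
  fix \<epsilon> :: real assume \<epsilon>: "0 < \<epsilon>"
  show "\<forall>\<^sub>F n in sequentially. measure M {\<omega> \<in> space M. y \<le> content n \<omega>}
      \<le> exp (- v (real n) * (min (c2 * y powr \<alpha>) (c1 * (\<rho> * xs) powr \<alpha> + c2 * (y - xs) powr \<alpha>) - \<epsilon>))"
    unfolding xs_def by (rule upper_two_nodes[OF \<kappa> y \<epsilon>])
  have xs: "0 < xs" "xs \<le> y" "xs \<le> \<kappa> * T" using \<kappa> y T by (auto simp: xs_def)
  show "\<forall>\<^sub>F n in sequentially.
      exp (- v (real n) * (min (c2 * y powr \<alpha>) (c1 * (\<rho> * xs) powr \<alpha> + c2 * (y - xs) powr \<alpha>) + \<epsilon>))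
      \<le> measure M {\<omega> \<in> space M. y \<le> content n \<omega>}"
    using lower_second_node[OF y \<epsilon>] lower_both_nodes[OF \<kappa> xs \<epsilon>]
    by eventually_elim (simp only: min_def simp_thms split: if_split)
qed

end

theorem mainTheorem4:
  fixes M :: "'w measure"
    and T \<alpha> y :: real
    and L :: "real \<Rightarrow> real"
    and c \<gamma> r b :: "real^2"
    and N :: "2 \<Rightarrow> real \<Rightarrow> 'w \<Rightarrow> nat"
    and Y :: "2 \<Rightarrow> nat \<Rightarrow> 'w \<Rightarrow> real"
    and J :: "2 \<Rightarrow> real \<Rightarrow> 'w \<Rightarrow> real"
    and Z :: "nat \<Rightarrow> real \<Rightarrow> 'w \<Rightarrow> real^2"
  assumes "prob_space M"
    and "0 < T"
    and "0 < \<alpha>" and "\<alpha> < 1"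
    and "\<forall>i. 0 < c $ i"
    and "slowly_varying L"
    and "\<exists>x\<^sub>0. antimono_on {x\<^sub>0..} (\<lambda>x. L x / x powr (1 - \<alpha>))"
    and "\<forall>i. prob_space.compound_poisson_input M (N i) (Y i)"
    and "\<forall>i. has_bochner_integral M (Y i 1) (\<gamma> $ i)"
    and "\<forall>i. \<forall>x\<ge>0. measure M {\<omega> \<in> space M. x \<le> Y i 1 \<omega>} = exp (- (c $ i * L x * x powr \<alpha>))"
    and J_def: "J = (\<lambda>i. compound_poisson (N i) (Y i))"
    and "prob_space.indep_families M {0..} borel (J 1) {0..} borel (J 2)"
    and stability: "\<forall>i. (matrix_inv (reflection_matrix tandem_routing) *v \<gamma>) $ i < r $ i"
    and Z_def: "Z = scaled_content T tandem_routing r J"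
    and "b = vector [0, 1]"
    and "0 < y"
  shows
    "(r $ 2 \<ge> r $ 1 + \<gamma> $ 2 \<longrightarrow>
       (\<lambda>n. 1 / (L (real n) * real n powr \<alpha>) * ln (measure M {\<omega> \<in> space M. b \<bullet> Z n T \<omega> \<ge> y}))
         \<longlonglongrightarrow> - c $ 2 * y powr \<alpha>) \<and>
     (r $ 2 < r $ 1 + \<gamma> $ 2 \<and> y \<le> (r $ 1 + \<gamma> $ 2 - r $ 2) * T \<longrightarrow>
       (\<lambda>n. 1 / (L (real n) * real n powr \<alpha>) * ln (measure M {\<omega> \<in> space M. b \<bullet> Z n T \<omega> \<ge> y}))
         \<longlonglongrightarrow> - min (c $ 1 * ((r $ 1 - \<gamma> $ 1) / (r $ 1 + \<gamma> $ 2 - r $ 2)) powr \<alpha>) (c $ 2) * y powr \<alpha>) \<and>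
     (r $ 2 < r $ 1 + \<gamma> $ 2 \<and> y > (r $ 1 + \<gamma> $ 2 - r $ 2) * T \<longrightarrow>
       (\<lambda>n. 1 / (L (real n) * real n powr \<alpha>) * ln (measure M {\<omega> \<in> space M. b \<bullet> Z n T \<omega> \<ge> y}))
         \<longlonglongrightarrow> - min (c $ 2 * y powr \<alpha>)
                    (c $ 1 * ((r $ 1 - \<gamma> $ 1) * T) powr \<alpha>
                      + c $ 2 * (y - (r $ 1 + \<gamma> $ 2 - r $ 2) * T) powr \<alpha>))"
proof -
  interpret prob_space M by fact
  define v where "v = (\<lambda>x. L x * x powr \<alpha>)"
  obtain x0 where x0: "antimono_on {x0..} (\<lambda>x. L x / x powr (1 - \<alpha>))" using assms(7) by blast
  have st: "\<gamma> $ 1 < r $ 1" "\<gamma> $ 1 + \<gamma> $ 2 < r $ 2" using stability by (simp_all add: tandem_stability_iff)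
  have tl: "measure M {\<omega> \<in> space M. x \<le> Y i 1 \<omega>} = exp (- (c $ i * v x))" if "0 \<le> x" for i x
    using assms(10) that by (simp add: v_def mult.assoc)
  \<comment> \<open>The assumptions on \<open>L\<close>, and the monotonicity that comes from \<open>v\<close> being the exponent of a tail function.\<close>
  have rv: "reg_var v \<alpha> (max x0 1)"
  proof
    show "0 < \<alpha>" "\<alpha> < 1" by fact+
    show "0 < max x0 1" by simp
    fix x y :: real
    show "v x \<le> v y" if xy: "0 \<le> x" "x \<le> y"
    proof -
      have Ym: "Y 1 1 \<in> borel_measurable M"
        using assms(8) by (auto simp: compound_poisson_input_def indep_vars_def)
      have "measure M {\<omega> \<in> space M. y \<le> Y 1 1 \<omega>} \<le> measure M {\<omega> \<in> space M. x \<le> Y 1 1 \<omega>}"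
        using Ym xy by (intro finite_measure_mono) auto
      then have "c $ 1 * v x \<le> c $ 1 * v y" 
        unfolding tl[OF xy(1)] tl[OF order_trans[OF xy]] by simp
      then show ?thesis using assms(5) by simp
    qed
    show "v y / y \<le> v x / x" if xy: "max x0 1 \<le> x" "x \<le> y"
    proof -
      have "v z / z = L z / z powr (1 - \<alpha>)" if "0 < z" for z
        using that by (simp add: v_def powr_diff)
      moreover have "L y / y powr (1 - \<alpha>) \<le> L x / x powr (1 - \<alpha>)"
        using monotone_onD[OF x0, of x y] xy by simp
      ultimately show ?thesis using xy by simp
    qed
  next
    have L: "\<forall>\<^sub>F x in at_top. 0 < L x" using assms(6) by (simp add: slowly_varying_def)
    show "\<forall>\<^sub>F x in at_top. 0 < v x"
      using L eventually_gt_at_top[of 0] by eventually_elim (simp add: v_def)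
    fix a :: real assume a: "0 < a"
    have "((\<lambda>x. L (a * x) / L x * a powr \<alpha>) \<longlongrightarrow> 1 * a powr \<alpha>) at_top"
      using assms(6) a by (intro tendsto_intros) (simp_all add: slowly_varying_def)
    then have "((\<lambda>x. L (a * x) / L x * a powr \<alpha>) \<longlongrightarrow> a powr \<alpha>) at_top" by simp
    then show "((\<lambda>x. v (a * x) / v x) \<longlongrightarrow> a powr \<alpha>) at_top"
      by (rule Lim_transform_eventually)
         (use eventually_gt_at_top[of 0] in eventually_elim, use a in \<open>simp add: v_def powr_mult\<close>)
  qed
  have node: "heavy_tailed_node M (N i) (Y i) v \<alpha> (max x0 1) (c $ i) (\<gamma> $ i)" for i
    by (intro heavy_tailed_node.intro compound_poisson_space.intro compound_poisson_space_axioms.intro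
        heavy_tailed_node_axioms.intro rv prob_space_axioms)
       (use assms(5,8,9) tl in auto)
  interpret n1: heavy_tailed_node M "N 1" "Y 1" v \<alpha> "max x0 1" "c $ 1" "\<gamma> $ 1" by (rule node)
  interpret n2: heavy_tailed_node M "N 2" "Y 2" v \<alpha> "max x0 1" "c $ 2" "\<gamma> $ 2" by (rule node)
  interpret net: tandem_network M v \<alpha> "max x0 1" "N 1" "Y 1" "c $ 1" "\<gamma> $ 1" "N 2" "Y 2" "c $ 2" "\<gamma> $ 2"
    "r $ 1" "r $ 2" T
  proof
    show "indep_set (sets n1.input_algebra) (sets n2.input_algebra)"
      using assms(12) unfolding indep_families_def n1.input_algebra_def n2.input_algebra_def J_def .
  qed (use st \<open>0 < T\<close> in auto)
  \<comment> \<open>Identifies the scaled content of node 2 with the explicit functional of the scaled inputs.\<close>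
  have content: "b \<bullet> Z n T \<omega> = net.content n \<omega>" if n: "0 < n" and w: "\<omega> \<in> space M" for n \<omega>
  proof -
    let ?x = "\<lambda>s. scaled_potential tandem_routing r J n s \<omega>"
    have Rr: "(reflection_matrix tandem_routing *v r) $ 1 = r $ 1"
      "(reflection_matrix tandem_routing *v r) $ 2 = r $ 2 - r $ 1"
      by (simp_all add: reflection_matrix_tandem matrix_vector_mult_def sum_2)
    have x: "?x s $ 1 = net.j1 n s \<omega> - r $ 1 * s" "?x s $ 2 = net.j2 n s \<omega> - (r $ 2 - r $ 1) * s" for s
      using n by (simp_all add: scaled_potential_def content_potential_def Rr J_def net.j1_def net.j2_def
          diff_divide_distrib mult.commute)
    obtain B where B: "\<forall>s\<in>{0..T}. - (net.j1 n s \<omega> - r $ 1 * s) \<le> B"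
        "\<forall>s\<in>{0..T}. - (net.j2 n s \<omega> - (r $ 2 - r $ 1) * s) \<le> B"
      using net.drifted_bounds[OF w n] by blast
    have "reflected T tandem_routing ?x T $ 2 = tandem_content (\<lambda>s. ?x s $ 1) (\<lambda>s. ?x s $ 2) T"
    proof (rule reflected_tandem[where B = B])
      fix t and i :: 2 assume t: "t \<in> {0..<T}"
      have "((\<lambda>s. ?x s $ 1) \<longlongrightarrow> ?x t $ 1) (at_right t)" "((\<lambda>s. ?x s $ 2) \<longlongrightarrow> ?x t $ 2) (at_right t)"
        unfolding x by (intro tendsto_intros net.scaled_input(1)[OF w n t] net.scaled_input(2)[OF w n t])+
      then have "\<forall>i. ((\<lambda>s. ?x s $ i) \<longlongrightarrow> ?x t $ i) (at_right t)" by (simp only: forall_2)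
      then show "((\<lambda>s. ?x s $ i) \<longlongrightarrow> ?x t $ i) (at_right t)" ..
    next
      fix t and i :: 2 assume t: "t \<in> {0..T}"
      have "\<forall>i. - B \<le> ?x t $ i" unfolding forall_2 x
        using bspec[OF B(1) t] bspec[OF B(2) t] by linarith
      then show "- B \<le> ?x t $ i" ..
    next
      fix i :: 2
      have "\<forall>i. ?x 0 $ i = 0" unfolding forall_2 x
        using n1.J_0[OF w] n2.J_0[OF w] by (simp add: net.j1_def net.j2_def)
      then show "?x 0 $ i = 0" ..
    qed (use \<open>0 < T\<close> in simp)
    then have "Z n T \<omega> $ 2 = net.content n \<omega>"
      unfolding Z_def scaled_content_def net.content_def x .
    then show ?thesis using \<open>b = vector [0, 1]\<close> by (simp add: inner_vec_def sum_2)
  qed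
  have lim: "(\<lambda>n. 1 / (L (real n) * real n powr \<alpha>) * ln (measure M {\<omega> \<in> space M. b \<bullet> Z n T \<omega> \<ge> y})) \<longlonglongrightarrow> l"
    if "(\<lambda>n. 1 / v (real n) * ln (measure M {\<omega> \<in> space M. y \<le> net.content n \<omega>})) \<longlonglongrightarrow> l" for l
  proof (rule Lim_transform_eventually[OF that])
    show "\<forall>\<^sub>F n in sequentially. 1 / v (real n) * ln (measure M {\<omega> \<in> space M. y \<le> net.content n \<omega>})
        = 1 / (L (real n) * real n powr \<alpha>) * ln (measure M {\<omega> \<in> space M. b \<bullet> Z n T \<omega> \<ge> y})"
      using eventually_gt_at_top[of 0]
    proof eventually_elim
      case (elim n)
      have "{\<omega> \<in> space M. y \<le> net.content n \<omega>} = {\<omega> \<in> space M. b \<bullet> Z n T \<omega> \<ge> y}"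
        using content[OF elim] by auto
      then show ?case by (simp add: v_def)
    qed
  qed
  define \<kappa> where "\<kappa> = r $ 1 + \<gamma> $ 2 - r $ 2"
  show ?thesis
  proof (intro conjI impI)
    assume "r $ 2 \<ge> r $ 1 + \<gamma> $ 2"
    then show "(\<lambda>n. 1 / (L (real n) * real n powr \<alpha>) * ln (measure M {\<omega> \<in> space M. b \<bullet> Z n T \<omega> \<ge> y}))
         \<longlonglongrightarrow> - c $ 2 * y powr \<alpha>"
      using lim[OF net.decay_rate_slow_first_node] \<open>0 < y\<close> by simp
  next
    assume k: "r $ 2 < r $ 1 + \<gamma> $ 2 \<and> y \<le> (r $ 1 + \<gamma> $ 2 - r $ 2) * T"
    define q where "q = (r $ 1 - \<gamma> $ 1) / (r $ 1 + \<gamma> $ 2 - r $ 2)"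
    have m: "min y ((r $ 1 + \<gamma> $ 2 - r $ 2) * T) = y" using k by simp
    have "min (c $ 2 * y powr \<alpha>) (c $ 1 * (q * y) powr \<alpha> + c $ 2 * (y - y) powr \<alpha>)
        = min (c $ 1 * q powr \<alpha>) (c $ 2) * y powr \<alpha>"
      by (simp add: powr_mult min_mult_distrib_right min.commute mult.assoc)
    then show "(\<lambda>n. 1 / (L (real n) * real n powr \<alpha>) * ln (measure M {\<omega> \<in> space M. b \<bullet> Z n T \<omega> \<ge> y}))
         \<longlonglongrightarrow> - min (c $ 1 * ((r $ 1 - \<gamma> $ 1) / (r $ 1 + \<gamma> $ 2 - r $ 2)) powr \<alpha>) (c $ 2) * y powr \<alpha>"
      using lim[OF net.decay_rate_fast_first_node] \<open>0 < y\<close> k unfolding q_def[symmetric] m by simp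
  next
    assume k: "r $ 2 < r $ 1 + \<gamma> $ 2 \<and> y > (r $ 1 + \<gamma> $ 2 - r $ 2) * T"
    have m: "min y ((r $ 1 + \<gamma> $ 2 - r $ 2) * T) = (r $ 1 + \<gamma> $ 2 - r $ 2) * T" using k by simp
    have "(r $ 1 - \<gamma> $ 1) / (r $ 1 + \<gamma> $ 2 - r $ 2) * ((r $ 1 + \<gamma> $ 2 - r $ 2) * T) = (r $ 1 - \<gamma> $ 1) * T"
      using k by simp
    then show "(\<lambda>n. 1 / (L (real n) * real n powr \<alpha>) * ln (measure M {\<omega> \<in> space M. b \<bullet> Z n T \<omega> \<ge> y}))
         \<longlonglongrightarrow> - min (c $ 2 * y powr \<alpha>)
                    (c $ 1 * ((r $ 1 - \<gamma> $ 1) * T) powr \<alpha>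
                      + c $ 2 * (y - (r $ 1 + \<gamma> $ 2 - r $ 2) * T) powr \<alpha>)"
      using lim[OF net.decay_rate_fast_first_node] \<open>0 < y\<close> k unfolding m by (simp only:) simp
  qed
qed

end
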